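(* Let $V$ be the $56$-dimensional irreducible representation of $e_7$, with invariant symplectic form $\omega$ and invariant symmetric quartic form $d$. Then the centralizer algebra $\mathrm{End}_{e_7}(V^{\otimes 3})$ has dimension $35$. It contains as a subalgebra the Brauer algebra $\mathrm{End}_{sp(56)}(V^{\otimes 3})$, and it is spanned by the operators corresponding (under the isomorphism $\Phi:\mathrm{End}(V^{\otimes3})\to (V^* )^{\otimes 6}$ given in the context) to the following $40$ six-linear forms in $(v_1,\dots,v_6)$: (order zero) the $15$ forms $\omega(v_i,v_j)\,\omega(v_k,v_l)\,\omega(v_p,v_q)$, one for each partition $\{i,j\},\{k,l\},\{p,q\}$ of $\{1,\dots,6\}$ into pairs (these span $\mathrm{End}_{sp(56)}(V^{\otimes3})$); (order one) the $15$ forms $\omega(v_i,v_j)\,d(v_k,v_l,v_p,v_q)$, one for each pair $\{i,j\}\subset\{1,\dots,6\}$ with complement $\{k,l,p,q\}$; (order two) the $10$ forms $\sum_{r,s} d(v_i,v_j,v_k,e_r)\,\omega^{rs}\,d(e_s,v_l,v_p,v_q)$, one for each partition $\{i,j,k\},\{l,p,q\}$ of $\{1,\dots,6\}$ into two triples. (Reordering the elements within pairs or exchanging the two triples changes a form only by a sign.)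
   Context: Work over $\mathbb{C}$. $V$ is the $56$-dimensional irreducible representation of the simple Lie algebra $e_7$. It carries an $e_7$-invariant nondegenerate alternating bilinear form $\omega$, unique up to scale, giving $e_7\subset sp(56)=sp(V,\omega)$, and an $e_7$-invariant nonzero symmetric quartic form $d\in \mathrm{Sym}^4(V^* )$, also unique up to scale. $(e_r)$ is a basis of $V$ and $(\omega^{rs})$ is the inverse of the matrix $(\omega(e_r,e_s))$. $\mathrm{End}_{\mathfrak g}(V^{\otimes 3})$ denotes the algebra of linear operators on $V^{\otimes 3}$ commuting with the action of $\mathfrak g$. The linear isomorphism $\Phi:\mathrm{End}(V^{\otimes 3})\to (V^* )^{\otimes 6}$ is $$\Phi(X)(v_1,\dots,v_6)=\omega^{\otimes 3}\big(v_1\otimes v_2\otimes v_3,\;X(v_4\otimes v_5\otimes v_6)\big),$$ where $\omega^{\otimes3}(x_1\otimes x_2\otimes x_3,y_1\otimes y_2\otimes y_3)=\omega(x_1,y_1)\omega(x_2,y_2)\omega(x_3,y_3)$. *)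

theory Defs
  imports "HOL-Analysis.Analysis"
begin

section \<open>Complex matrices as a complex vector space\<close>

definition cmat_scale :: "complex \<Rightarrow> complex ^ 'n ^ 'm \<Rightarrow> complex ^ 'n ^ 'm" where
  "cmat_scale c A = (\<chi> i j. c * A $ i $ j)"

interpretation cmat: vector_space "cmat_scale :: complex \<Rightarrow> complex ^ 'n ^ 'm \<Rightarrow> _"
  by unfold_locales (simp_all add: cmat_scale_def vec_eq_iff algebra_simps)


section \<open>Complex Lie algebras and their representations\<close>

locale lie_algebra = vector_space scale
  for scale :: "complex \<Rightarrow> 'g::ab_group_add \<Rightarrow> 'g" +
  fixes bracket :: "'g \<Rightarrow> 'g \<Rightarrow> 'g"
  assumes bracket_linear_right: "Vector_Spaces.linear scale scale (\<lambda>y. bracket x y)"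
    and bracket_linear_left: "Vector_Spaces.linear scale scale (\<lambda>x. bracket x y)"
    and bracket_self: "bracket x x = 0"
    and jacobi: "bracket x (bracket y z) + bracket y (bracket z x) + bracket z (bracket x y) = 0"
begin

definition lie_subalgebra :: "'g set \<Rightarrow> bool" where
  "lie_subalgebra S \<longleftrightarrow> subspace S \<and> (\<forall>x\<in>S. \<forall>y\<in>S. bracket x y \<in> S)"

definition lie_ideal :: "'g set \<Rightarrow> bool" where
  "lie_ideal I \<longleftrightarrow> subspace I \<and> (\<forall>x. \<forall>y\<in>I. bracket x y \<in> I)"

definition lie_simple :: bool where
  "lie_simple \<longleftrightarrow>
     (\<exists>x y. bracket x y \<noteq> 0) \<and> (\<forall>I. lie_ideal I \<longrightarrow> I = {0} \<or> I = UNIV)"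

definition lie_generates :: "'g set \<Rightarrow> bool" where
  "lie_generates G \<longleftrightarrow> (\<forall>S. lie_subalgebra S \<and> G \<subseteq> S \<longrightarrow> S = UNIV)"

text \<open>
  The Chevalley--Serre relations for a Cartan matrix \<open>a\<close> with rows and columns indexed by
  \<open>I\<close>, in the convention \<open>a i j = \<alpha>\<^sub>j (h\<^sub>i)\<close>.
\<close>

definition chevalley_serre ::
  "'i set \<Rightarrow> ('i \<Rightarrow> 'i \<Rightarrow> int) \<Rightarrow> ('i \<Rightarrow> 'g) \<Rightarrow> ('i \<Rightarrow> 'g) \<Rightarrow> ('i \<Rightarrow> 'g) \<Rightarrow> bool" where
  "chevalley_serre I a e f h \<longleftrightarrow>
     (\<forall>i\<in>I. \<forall>j\<in>I.
        bracket (h i) (h j) = 0 \<and>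
        bracket (h i) (e j) = scale (of_int (a i j)) (e j) \<and>
        bracket (h i) (f j) = scale (- of_int (a i j)) (f j) \<and>
        bracket (e i) (f j) = (if i = j then h i else 0) \<and>
        (i \<noteq> j \<longrightarrow>
           (bracket (e i) ^^ nat (1 - a i j)) (e j) = 0 \<and>
           (bracket (f i) ^^ nat (1 - a i j)) (f j) = 0))"

end

text \<open>
  The Cartan matrix of type \<open>E\<^sub>7\<close> on the nodes \<open>1, \<dots>, 7\<close>, in Bourbaki's numbering: the Dynkin
  diagram is the chain 1 -- 3 -- 4 -- 5 -- 6 -- 7 with the node 2 attached to the node 4.
\<close>

definition cartan_E7 :: "nat \<Rightarrow> nat \<Rightarrow> int" where
  "cartan_E7 i j =
     (if i = j then 2
      else if {i, j} \<in> {{1, 3}, {3, 4}, {4, 5}, {5, 6}, {6, 7}, {2, 4}} then - 1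
      else 0)"

text \<open>
  The simple Lie algebra \<open>e\<^sub>7\<close>. By Serre's theorem the relations present it, so these axioms
  determine the Lie algebra up to isomorphism; in particular it is finite-dimensional.
\<close>

locale e7_lie_algebra = lie_algebra +
  assumes simple: "lie_simple"
    and chevalley_generators:
      "\<exists>e f h. chevalley_serre {1..7} cartan_E7 e f h \<and>
               lie_generates (e ` {1..7} \<union> f ` {1..7} \<union> h ` {1..7})"

definition lie_representation ::
  "(complex \<Rightarrow> 'g::ab_group_add \<Rightarrow> 'g) \<Rightarrow> ('g \<Rightarrow> 'g \<Rightarrow> 'g) \<Rightarrow> ('g \<Rightarrow> complex ^ 'n ^ 'n) \<Rightarrow> bool" where
  "lie_representation sc bracket \<rho> \<longleftrightarrow>
     Vector_Spaces.linear sc cmat_scale \<rho> \<and>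
     (\<forall>x y. \<rho> (bracket x y) = \<rho> x ** \<rho> y - \<rho> y ** \<rho> x)"

definition irreducible_representation :: "('g \<Rightarrow> complex ^ 'n ^ 'n) \<Rightarrow> bool" where
  "irreducible_representation \<rho> \<longleftrightarrow>
     (\<forall>W. vec.subspace W \<and> (\<forall>x. \<forall>w\<in>W. \<rho> x *v w \<in> W) \<longrightarrow> W = {0} \<or> W = UNIV)"


section \<open>Invariant forms\<close>

definition linear_form :: "(complex ^ 'n \<Rightarrow> complex) \<Rightarrow> bool" where
  "linear_form \<phi> \<longleftrightarrow> Vector_Spaces.linear (*s) (*) \<phi>"

definition symplectic_form :: "(complex ^ 'n \<Rightarrow> complex ^ 'n \<Rightarrow> complex) \<Rightarrow> bool" where
  "symplectic_form \<omega> \<longleftrightarrow>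
     (\<forall>v. linear_form (\<omega> v)) \<and> (\<forall>w. linear_form (\<lambda>v. \<omega> v w)) \<and>
     (\<forall>v. \<omega> v v = 0) \<and>
     (\<forall>v. (\<forall>w. \<omega> v w = 0) \<longrightarrow> v = 0)"

text \<open>\<open>Sym\<^sup>4(V\<^sup>*)\<close>, realised as the symmetric four-linear forms.\<close>

definition symmetric_quartic_form ::
  "(complex ^ 'n \<Rightarrow> complex ^ 'n \<Rightarrow> complex ^ 'n \<Rightarrow> complex ^ 'n \<Rightarrow> complex) \<Rightarrow> bool" where
  "symmetric_quartic_form d \<longleftrightarrow>
     (\<forall>b c e. linear_form (\<lambda>a. d a b c e)) \<and>
     (\<forall>a b c e. d b a c e = d a b c e \<and> d a c b e = d a b c e \<and> d a b e c = d a b c e)"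

definition invariant_bilinear ::
  "('g \<Rightarrow> complex ^ 'n ^ 'n) \<Rightarrow> (complex ^ 'n \<Rightarrow> complex ^ 'n \<Rightarrow> complex) \<Rightarrow> bool" where
  "invariant_bilinear \<rho> \<omega> \<longleftrightarrow> (\<forall>x v w. \<omega> (\<rho> x *v v) w + \<omega> v (\<rho> x *v w) = 0)"

definition invariant_quartic ::
  "('g \<Rightarrow> complex ^ 'n ^ 'n) \<Rightarrow>
   (complex ^ 'n \<Rightarrow> complex ^ 'n \<Rightarrow> complex ^ 'n \<Rightarrow> complex ^ 'n \<Rightarrow> complex) \<Rightarrow> bool" where
  "invariant_quartic \<rho> d \<longleftrightarrow>
     (\<forall>x a b c e. d (\<rho> x *v a) b c e + d a (\<rho> x *v b) c e
                 + d a b (\<rho> x *v c) e + d a b c (\<rho> x *v e) = 0)"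

definition sp_algebra :: "(complex ^ 'n \<Rightarrow> complex ^ 'n \<Rightarrow> complex) \<Rightarrow> (complex ^ 'n ^ 'n) set" where
  "sp_algebra \<omega> = {A. \<forall>v w. \<omega> (A *v v) w + \<omega> v (A *v w) = 0}"

definition is_basis :: "('n \<Rightarrow> complex ^ 'n) \<Rightarrow> bool" where
  "is_basis b \<longleftrightarrow> inj b \<and> vec.independent (range b) \<and> vec.span (range b) = UNIV"


section \<open>The tensor cube and centralizer algebras\<close>

text \<open>
  For \<open>V = complex ^ 'n\<close> the space \<open>V \<otimes> V \<otimes> V\<close> is \<open>complex ^ ('n \<times> 'n \<times> 'n)\<close>, the coordinate at
  \<open>(i, j, k)\<close> being the coefficient of \<open>axis i 1 \<otimes> axis j 1 \<otimes> axis k 1\<close>. Linear operators on it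
  are matrices indexed by \<open>'n \<times> 'n \<times> 'n\<close>, and \<open>kron3 A B C\<close> is \<open>A \<otimes> B \<otimes> C\<close>.
\<close>

definition tensor3 ::
  "complex ^ 'n \<Rightarrow> complex ^ 'n \<Rightarrow> complex ^ 'n \<Rightarrow> complex ^ ('n \<times> 'n \<times> 'n)" where
  "tensor3 u v w = (\<chi> p. case p of (i, j, k) \<Rightarrow> u $ i * v $ j * w $ k)"

definition kron3 ::
  "complex ^ 'n ^ 'n \<Rightarrow> complex ^ 'n ^ 'n \<Rightarrow> complex ^ 'n ^ 'n \<Rightarrow>
   complex ^ ('n \<times> 'n \<times> 'n) ^ ('n \<times> 'n \<times> 'n)" where
  "kron3 A B C =
     (\<chi> p q. case p of (i, j, k) \<Rightarrow> case q of (l, m, n) \<Rightarrow> A $ i $ l * B $ j $ m * C $ k $ n)"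

definition tensor3_action ::
  "complex ^ 'n ^ 'n \<Rightarrow> complex ^ ('n \<times> 'n \<times> 'n) ^ ('n \<times> 'n \<times> 'n)" where
  "tensor3_action A =
     kron3 A (mat 1) (mat 1) + kron3 (mat 1) A (mat 1) + kron3 (mat 1) (mat 1) A"

definition centralizer3 ::
  "(complex ^ 'n ^ 'n) set \<Rightarrow> (complex ^ ('n \<times> 'n \<times> 'n) ^ ('n \<times> 'n \<times> 'n)) set" where
  "centralizer3 \<A> = {X. \<forall>A\<in>\<A>. X ** tensor3_action A = tensor3_action A ** X}"

definition matrix_subalgebra :: "(complex ^ 'n ^ 'n) set \<Rightarrow> bool" where
  "matrix_subalgebra \<A> \<longleftrightarrow>
     cmat.subspace \<A> \<and> mat 1 \<in> \<A> \<and> (\<forall>X\<in>\<A>. \<forall>Y\<in>\<A>. X ** Y \<in> \<A>)"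


section \<open>Operators on the tensor cube and six-linear forms\<close>

text \<open>\<open>\<omega> \<otimes> \<omega> \<otimes> \<omega>\<close>: the bilinear extension of its values on the standard basis tensors.\<close>

definition tensor3_form ::
  "(complex ^ 'n \<Rightarrow> complex ^ 'n \<Rightarrow> complex) \<Rightarrow>
   complex ^ ('n \<times> 'n \<times> 'n) \<Rightarrow> complex ^ ('n \<times> 'n \<times> 'n) \<Rightarrow> complex" where
  "tensor3_form \<omega> s t =
     (\<Sum>(i, j, k)\<in>UNIV. \<Sum>(l, m, n)\<in>UNIV. s $ (i, j, k) * t $ (l, m, n) *
        (\<omega> (axis i 1) (axis l 1) * \<omega> (axis j 1) (axis m 1) * \<omega> (axis k 1) (axis n 1)))"

text \<open>
  A form in \<open>(v\<^sub>1, \<dots>, v\<^sub>6)\<close> is a function of \<open>v :: nat \<Rightarrow> V\<close> that only looks at \<open>v 1, \<dots>, v 6\<close>.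
\<close>

definition Phi ::
  "(complex ^ 'n \<Rightarrow> complex ^ 'n \<Rightarrow> complex) \<Rightarrow>
   complex ^ ('n \<times> 'n \<times> 'n) ^ ('n \<times> 'n \<times> 'n) \<Rightarrow> (nat \<Rightarrow> complex ^ 'n) \<Rightarrow> complex" where
  "Phi \<omega> X v = tensor3_form \<omega> (tensor3 (v 1) (v 2) (v 3)) (X *v tensor3 (v 4) (v 5) (v 6))"

definition six_linear_forms :: "((nat \<Rightarrow> complex ^ 'n) \<Rightarrow> complex) set" where
  "six_linear_forms =
     {F. (\<forall>i\<in>{1..6}. \<forall>v. linear_form (\<lambda>x. F (v(i := x)))) \<and>
         (\<forall>v w. (\<forall>i\<in>{1..6}. v i = w i) \<longrightarrow> F v = F w)}"

definition order_zero_form ::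
  "(complex ^ 'n \<Rightarrow> complex ^ 'n \<Rightarrow> complex) \<Rightarrow>
   nat \<Rightarrow> nat \<Rightarrow> nat \<Rightarrow> nat \<Rightarrow> nat \<Rightarrow> nat \<Rightarrow> (nat \<Rightarrow> complex ^ 'n) \<Rightarrow> complex" where
  "order_zero_form \<omega> i j k l p q v = \<omega> (v i) (v j) * \<omega> (v k) (v l) * \<omega> (v p) (v q)"

definition order_one_form ::
  "(complex ^ 'n \<Rightarrow> complex ^ 'n \<Rightarrow> complex) \<Rightarrow>
   (complex ^ 'n \<Rightarrow> complex ^ 'n \<Rightarrow> complex ^ 'n \<Rightarrow> complex ^ 'n \<Rightarrow> complex) \<Rightarrow>
   nat \<Rightarrow> nat \<Rightarrow> nat \<Rightarrow> nat \<Rightarrow> nat \<Rightarrow> nat \<Rightarrow> (nat \<Rightarrow> complex ^ 'n) \<Rightarrow> complex" where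
  "order_one_form \<omega> d i j k l p q v = \<omega> (v i) (v j) * d (v k) (v l) (v p) (v q)"

definition inverse_gram ::
  "(complex ^ 'n \<Rightarrow> complex ^ 'n \<Rightarrow> complex) \<Rightarrow> ('n \<Rightarrow> complex ^ 'n) \<Rightarrow> complex ^ 'n ^ 'n" where
  "inverse_gram \<omega> b = matrix_inv (\<chi> r s. \<omega> (b r) (b s))"

definition order_two_form ::
  "(complex ^ 'n \<Rightarrow> complex ^ 'n \<Rightarrow> complex) \<Rightarrow>
   (complex ^ 'n \<Rightarrow> complex ^ 'n \<Rightarrow> complex ^ 'n \<Rightarrow> complex ^ 'n \<Rightarrow> complex) \<Rightarrow>
   ('n \<Rightarrow> complex ^ 'n) \<Rightarrow>
   nat \<Rightarrow> nat \<Rightarrow> nat \<Rightarrow> nat \<Rightarrow> nat \<Rightarrow> nat \<Rightarrow> (nat \<Rightarrow> complex ^ 'n) \<Rightarrow> complex" where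
  "order_two_form \<omega> d b i j k l p q v =
     (\<Sum>r\<in>UNIV. \<Sum>s\<in>UNIV.
        d (v i) (v j) (v k) (b r) * inverse_gram \<omega> b $ r $ s * d (b s) (v l) (v p) (v q))"

text \<open>
  The partitions of \<open>{1..6}\<close> of the three shapes, each written as a sextuple in the unique way
  that is increasing inside the blocks and lists blocks of equal size by their least elements.
\<close>

definition pairings6 :: "(nat \<times> nat \<times> nat \<times> nat \<times> nat \<times> nat) set" where
  "pairings6 = {(i, j, k, l, p, q).
     {i, j, k, l, p, q} = {1..6} \<and> i < j \<and> k < l \<and> p < q \<and> i < k \<and> k < p}"

definition pair_quadruples6 :: "(nat \<times> nat \<times> nat \<times> nat \<times> nat \<times> nat) set" where
  "pair_quadruples6 = {(i, j, k, l, p, q).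
     {i, j, k, l, p, q} = {1..6} \<and> i < j \<and> k < l \<and> l < p \<and> p < q}"

definition triple_pairs6 :: "(nat \<times> nat \<times> nat \<times> nat \<times> nat \<times> nat) set" where
  "triple_pairs6 = {(i, j, k, l, p, q).
     {i, j, k, l, p, q} = {1..6} \<and> i < j \<and> j < k \<and> l < p \<and> p < q \<and> i < l}"

definition order_zero_forms ::
  "(complex ^ 'n \<Rightarrow> complex ^ 'n \<Rightarrow> complex) \<Rightarrow> ((nat \<Rightarrow> complex ^ 'n) \<Rightarrow> complex) set" where
  "order_zero_forms \<omega> =
     {order_zero_form \<omega> i j k l p q | i j k l p q. (i, j, k, l, p, q) \<in> pairings6}"

definition order_one_forms ::
  "(complex ^ 'n \<Rightarrow> complex ^ 'n \<Rightarrow> complex) \<Rightarrow>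
   (complex ^ 'n \<Rightarrow> complex ^ 'n \<Rightarrow> complex ^ 'n \<Rightarrow> complex ^ 'n \<Rightarrow> complex) \<Rightarrow>
   ((nat \<Rightarrow> complex ^ 'n) \<Rightarrow> complex) set" where
  "order_one_forms \<omega> d =
     {order_one_form \<omega> d i j k l p q | i j k l p q. (i, j, k, l, p, q) \<in> pair_quadruples6}"

definition order_two_forms ::
  "(complex ^ 'n \<Rightarrow> complex ^ 'n \<Rightarrow> complex) \<Rightarrow>
   (complex ^ 'n \<Rightarrow> complex ^ 'n \<Rightarrow> complex ^ 'n \<Rightarrow> complex ^ 'n \<Rightarrow> complex) \<Rightarrow>
   ('n \<Rightarrow> complex ^ 'n) \<Rightarrow> ((nat \<Rightarrow> complex ^ 'n) \<Rightarrow> complex) set" where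
  "order_two_forms \<omega> d b =
     {order_two_form \<omega> d b i j k l p q | i j k l p q. (i, j, k, l, p, q) \<in> triple_pairs6}"

definition corresponding_operators ::
  "(complex ^ 'n \<Rightarrow> complex ^ 'n \<Rightarrow> complex) \<Rightarrow> ((nat \<Rightarrow> complex ^ 'n) \<Rightarrow> complex) set \<Rightarrow>
   (complex ^ ('n \<times> 'n \<times> 'n) ^ ('n \<times> 'n \<times> 'n)) set" where
  "corresponding_operators \<omega> \<F> = {X. Phi \<omega> X \<in> \<F>}"


section \<open>Compatibility of the coordinate definitions\<close>

lemma linear_form_coordinates:
  assumes "linear_form \<phi>"
  shows "\<phi> x = (\<Sum>i\<in>UNIV. x $ i * \<phi> (axis i 1))"
proof -
  interpret Vector_Spaces.linear "(*s)" "(*)" \<phi> using assms by (simp add: linear_form_def)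
  have "\<phi> x = \<phi> (\<Sum>i\<in>UNIV. x $ i *s axis i 1)" by (simp add: basis_expansion)
  thus ?thesis by (simp add: sum scale)
qed

lemma symplectic_coordinates:
  assumes "symplectic_form \<omega>"
  shows "\<omega> x y = (\<Sum>i\<in>UNIV. \<Sum>l\<in>UNIV. x $ i * y $ l * \<omega> (axis i 1) (axis l 1))"
proof -
  have l: "\<omega> x y = (\<Sum>i\<in>UNIV. x $ i * \<omega> (axis i 1) y)"
    using assms by (intro linear_form_coordinates) (simp add: symplectic_form_def)
  have r: "\<omega> u y = (\<Sum>l\<in>UNIV. y $ l * \<omega> u (axis l 1))" for u
    using assms by (intro linear_form_coordinates) (simp add: symplectic_form_def)
  have "\<omega> x y = (\<Sum>i\<in>UNIV. x $ i * (\<Sum>l\<in>UNIV. y $ l * \<omega> (axis i 1) (axis l 1)))"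
    by (subst l) (simp only: r[symmetric])
  thus ?thesis by (simp add: sum_distrib_left mult.assoc)
qed

lemma sum_UNIV_triple:
  "(\<Sum>(i::'a::finite, j::'b::finite, k::'c::finite)\<in>UNIV. f i j k)
     = (\<Sum>i\<in>UNIV. \<Sum>j\<in>UNIV. \<Sum>k\<in>UNIV. f i j (k::'c) :: complex)"
  by (simp add: sum.cartesian_product UNIV_Times_UNIV[symmetric] del: UNIV_Times_UNIV)

lemma sum_triple_prod:
  "(\<Sum>p\<in>(UNIV::('a::finite \<times> 'b::finite \<times> 'c::finite) set).
      f (fst p) * g (fst (snd p)) * h (snd (snd p)))
     = (\<Sum>i\<in>UNIV. f i) * (\<Sum>j\<in>UNIV. g j) * (\<Sum>k\<in>UNIV. h k :: complex)"
  using sum_UNIV_triple[of "\<lambda>i j k. f i * g j * h k"]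
  by (simp add: case_prod_unfold sum_distrib_left[symmetric] sum_distrib_right[symmetric])

lemma kron3_tensor3: "kron3 A B C *v tensor3 u v w = tensor3 (A *v u) (B *v v) (C *v w)"
proof -
  have "(kron3 A B C *v tensor3 u v w) $ (i, j, k) = tensor3 (A *v u) (B *v v) (C *v w) $ (i, j, k)"
    for i j k
    using sum_triple_prod[of "\<lambda>l. A $ i $ l * u $ l" "\<lambda>m. B $ j $ m * v $ m" "\<lambda>n. C $ k $ n * w $ n"]
    by (simp add: matrix_vector_mult_def kron3_def tensor3_def case_prod_unfold mult_ac)
  thus ?thesis by (simp add: vec_eq_iff split_paired_all)
qed

lemma kron3_mult: "kron3 A B C ** kron3 A' B' C' = kron3 (A ** A') (B ** B') (C ** C')"
proof -
  have "(kron3 A B C ** kron3 A' B' C') $ (i, j, k) $ (l, m, n)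
      = kron3 (A ** A') (B ** B') (C ** C') $ (i, j, k) $ (l, m, n)" for i j k l m n
    using sum_triple_prod[of "\<lambda>x. A $ i $ x * A' $ x $ l" "\<lambda>x. B $ j $ x * B' $ x $ m" "\<lambda>x. C $ k $ x * C' $ x $ n"]
    by (simp add: matrix_matrix_mult_def kron3_def case_prod_unfold mult_ac)
  thus ?thesis by (simp add: vec_eq_iff split_paired_all)
qed

lemma kron3_one: "kron3 (mat 1) (mat 1) (mat 1) = mat 1"
  by (auto simp: vec_eq_iff kron3_def mat_def split_paired_all)

definition gram :: "(complex ^ 'n \<Rightarrow> complex ^ 'n \<Rightarrow> complex) \<Rightarrow> complex ^ 'n ^ 'n" where
  "gram \<omega> = (\<chi> i j. \<omega> (axis i 1) (axis j 1))"

lemma tensor3_axis: "tensor3 (axis i 1) (axis j 1) (axis k 1) = axis (i, j, k) 1"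
  by (auto simp: vec_eq_iff tensor3_def axis_def)

lemma tensor3_form_gram:
  "tensor3_form \<omega> s t = (\<Sum>p\<in>UNIV. s $ p * (kron3 (gram \<omega>) (gram \<omega>) (gram \<omega>) *v t) $ p)"
  by (simp add: tensor3_form_def kron3_def gram_def matrix_vector_mult_def case_prod_unfold
      sum_distrib_left mult_ac)

lemma symplectic_gram:
  assumes "symplectic_form \<omega>"
  shows "\<omega> x y = (\<Sum>i\<in>UNIV. x $ i * (gram \<omega> *v y) $ i)"
  by (subst symplectic_coordinates[OF assms])
     (simp add: gram_def matrix_vector_mult_def sum_distrib_left mult_ac)

lemma tensor3_form_tensor3:
  assumes "symplectic_form \<omega>"
  shows "tensor3_form \<omega> (tensor3 x1 x2 x3) (tensor3 y1 y2 y3) = \<omega> x1 y1 * \<omega> x2 y2 * \<omega> x3 y3"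
  using sum_triple_prod[of "\<lambda>i. x1 $ i * (gram \<omega> *v y1) $ i" "\<lambda>i. x2 $ i * (gram \<omega> *v y2) $ i"
      "\<lambda>i. x3 $ i * (gram \<omega> *v y3) $ i"]
  by (simp add: tensor3_form_gram kron3_tensor3 symplectic_gram[OF assms])
     (simp add: tensor3_def case_prod_unfold mult_ac)

lemma tensor3_action_tensor3:
  "tensor3_action A *v tensor3 u v w =
     tensor3 (A *v u) v w + tensor3 u (A *v v) w + tensor3 u v (A *v w)"
  by (simp add: tensor3_action_def matrix_vector_mult_add_rdistrib kron3_tensor3)

lemma gram_left_inverse:
  assumes "symplectic_form \<omega>"
  obtains J where "J ** gram \<omega> = mat 1" "gram \<omega> ** J = mat 1"
proof -
  have "x = 0" if "gram \<omega> *v x = 0" for x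
  proof -
    have "\<omega> w x = 0" for w using that by (simp add: symplectic_gram[OF assms, of w x])
    moreover have "\<omega> x w = - \<omega> w x" for w
    proof -
      have r: "\<omega> v (x + y) = \<omega> v x + \<omega> v y" and l: "\<omega> (x + y) v = \<omega> x v + \<omega> y v" for v x y
        using assms by (simp_all add: symplectic_form_def linear_form_def Vector_Spaces.linear_iff)
      have z: "\<omega> v v = 0" for v using assms by (simp add: symplectic_form_def)
      have "\<omega> (x + w) (x + w) = \<omega> x x + \<omega> x w + \<omega> w x + \<omega> w w" unfolding l r by simp
      hence "\<omega> x w + \<omega> w x = 0" unfolding z by simp
      thus ?thesis by (simp only: eq_neg_iff_add_eq_0)
    qed
    ultimately show "x = 0" using assms by (simp add: symplectic_form_def)
  qed
  then obtain J where J: "J ** gram \<omega> = mat 1"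
    using matrix_left_invertible_ker[of "gram \<omega>"] by blast
  moreover from J have "gram \<omega> ** J = mat 1" by (simp add: matrix_left_right_inverse)
  ultimately show thesis by (rule that)
qed

lemma Phi_axis:
  "Phi \<omega> X (\<lambda>n. axis (c n) 1) =
     (kron3 (gram \<omega>) (gram \<omega>) (gram \<omega>) ** X) $ (c 1, c 2, c 3) $ (c 4, c 5, c 6)"
proof -
  have "(\<Sum>p\<in>UNIV. axis a 1 $ p * f p) = f a" for f :: "'b::finite \<Rightarrow> complex" and a
    by (simp add: axis_def if_distrib[of "\<lambda>x. x * _"] cong: if_cong)
  note * = this
  show ?thesis
    unfolding Phi_def tensor3_axis tensor3_form_gram matrix_vector_mul_assoc *
    by (simp add: matrix_vector_mult_def axis_def if_distrib[of "\<lambda>x. _ * x"] cong: if_cong)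
qed

lemma Phi_linear:
  "Phi \<omega> (X + Y) v = Phi \<omega> X v + Phi \<omega> Y v"
  "Phi \<omega> (cmat_scale c X) v = c * Phi \<omega> X v"
proof -
  have "cmat_scale c X *v t = c *s (X *v t)" for t
    by (simp add: cmat_scale_def matrix_vector_mult_def vec_eq_iff sum_distrib_left mult_ac)
  thus "Phi \<omega> (cmat_scale c X) v = c * Phi \<omega> X v"
    by (simp add: Phi_def tensor3_form_gram vec.linear_scale sum_distrib_left mult_ac
        vector_scalar_commute)
  show "Phi \<omega> (X + Y) v = Phi \<omega> X v + Phi \<omega> Y v"
    unfolding Phi_def tensor3_form_gram matrix_vector_mult_add_rdistrib vec.add vector_add_component
      distrib_left sum.distrib by (rule refl)
qed

lemma linear_form_iff:
  "linear_form \<phi> \<longleftrightarrow> (\<forall>x y. \<phi> (x + y) = \<phi> x + \<phi> y) \<and> (\<forall>c x. \<phi> (c *s x) = c * \<phi> x)"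
  by (simp add: linear_form_def Vector_Spaces.linear_iff vec.vector_space_axioms
      vector_space_over_itself.vector_space_axioms)

lemma tensor3_add:
  "tensor3 (x + y) v w = tensor3 x v w + tensor3 y v w"
  "tensor3 u (x + y) w = tensor3 u x w + tensor3 u y w"
  "tensor3 u v (x + y) = tensor3 u v x + tensor3 u v y"
  by (simp_all add: tensor3_def vec_eq_iff case_prod_unfold algebra_simps)

lemma tensor3_scale:
  "tensor3 (c *s u) v w = c *s tensor3 u v w"
  "tensor3 u (c *s v) w = c *s tensor3 u v w"
  "tensor3 u v (c *s w) = c *s tensor3 u v w"
  by (simp_all add: tensor3_def vec_eq_iff case_prod_unfold algebra_simps)

lemma tensor3_form_bilinear:
  "tensor3_form \<omega> (s + s') t = tensor3_form \<omega> s t + tensor3_form \<omega> s' t"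
  "tensor3_form \<omega> s (t + t') = tensor3_form \<omega> s t + tensor3_form \<omega> s t'"
  "tensor3_form \<omega> (c *s s) t = c * tensor3_form \<omega> s t"
  "tensor3_form \<omega> s (c *s t) = c * tensor3_form \<omega> s t"
  by (simp_all add: tensor3_form_gram vec.add vec.scale distrib_left distrib_right sum.distrib
      sum_distrib_left mult_ac)

lemma Phi_six_linear: "Phi \<omega> X \<in> six_linear_forms"
proof -
  have "linear_form (\<lambda>x. Phi \<omega> X (v(i := x)))" if "i \<in> {1..6}" for i v
  proof -
    from that have "i = 1 \<or> i = 2 \<or> i = 3 \<or> i = 4 \<or> i = 5 \<or> i = 6" by auto
    thus ?thesis
      by (elim disjE; simp add: linear_form_iff Phi_def tensor3_add tensor3_scale
          tensor3_form_bilinear vec.add vec.scale)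
  qed
  thus ?thesis by (simp add: six_linear_forms_def Phi_def)
qed

lemma six_linear_forms_eqI:
  assumes F: "F \<in> six_linear_forms" and G: "G \<in> six_linear_forms"
    and eq: "\<And>c. F (\<lambda>n. axis (c n) 1) = G (\<lambda>n. axis (c n) 1)"
  shows "F = G"
proof -
  have "F v = G v" if "m \<le> 6" "\<forall>i\<in>{m<..6}. \<exists>c. v i = axis c 1" for m v
    using that
  proof (induction m arbitrary: v)
    case 0
    then have "\<forall>i\<in>{0<..6}. \<exists>c. v i = axis c 1" by simp
    then obtain c where c: "\<forall>i\<in>{0<..6}. v i = axis (c i) 1" using bchoice[of "{0<..6::nat}"] by metis
    have "F v = F (\<lambda>n. axis (c n) 1)" "G v = G (\<lambda>n. axis (c n) 1)"
      using F G c by (auto simp: six_linear_forms_def)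
    thus ?case using eq by simp
  next
    case (Suc m)
    have ind: "F (v(Suc m := axis j 1)) = G (v(Suc m := axis j 1))" for j
      using Suc.prems by (intro Suc.IH) auto
    have "linear_form (\<lambda>x. F (v(Suc m := x)))" "linear_form (\<lambda>x. G (v(Suc m := x)))"
      using F G Suc.prems(1) by (simp_all add: six_linear_forms_def)
    from this[THEN linear_form_coordinates, of "v (Suc m)"] show ?case by (simp add: ind)
  qed
  from this[of 6] show ?thesis by auto
qed

text \<open>Together with the linearity above: \<open>Phi \<omega>\<close> is a linear isomorphism onto \<open>(V\<^sup>*)\<^sup>\<otimes>\<^sup>6\<close>.\<close>

lemma Phi_bij_betw:
  assumes "symplectic_form (\<omega> :: complex ^ 'n \<Rightarrow> complex ^ 'n \<Rightarrow> complex)"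
  shows "bij_betw (Phi \<omega>) UNIV six_linear_forms"
proof -
  obtain J where J: "J ** gram \<omega> = mat 1" "gram \<omega> ** J = mat 1"
    using gram_left_inverse[OF assms] .
  define K K' where "K = kron3 (gram \<omega>) (gram \<omega>) (gram \<omega>)" and "K' = kron3 J J J"
  have KK': "K' ** K = mat 1" "K ** K' = mat 1"
    by (simp_all add: K_def K'_def kron3_mult J kron3_one)
  have "inj (Phi \<omega>)"
  proof (rule injI)
    fix X Y assume XY: "Phi \<omega> X = Phi \<omega> Y"
    have "(K ** X) $ (i, j, k) $ (l, m, n) = (K ** Y) $ (i, j, k) $ (l, m, n)" for i j k l m n
      using fun_cong[OF XY, of "\<lambda>a. axis (if a = 1 then i else if a = 2 then j else if a = 3 then k
          else if a = 4 then l else if a = 5 then m else n) 1"]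
      by (simp only: Phi_axis K_def[symmetric]) simp
    hence "K ** X = K ** Y" by (simp add: vec_eq_iff split_paired_all)
    hence "K' ** (K ** X) = K' ** (K ** Y)" by simp
    thus "X = Y" by (simp add: matrix_mul_assoc KK')
  qed
  moreover have "F \<in> range (Phi \<omega>)" if F: "F \<in> six_linear_forms" for F
  proof -
    define e where "e = (\<lambda>(i, j, k) (l, m, n) a :: nat. axis (if a = 1 then i else if a = 2 then j
      else if a = 3 then k else if a = 4 then l else if a = 5 then m else n) (1 :: complex) :: complex ^ 'n)"
    define M where "M = (\<chi> p q. F (e p q))"
    have "Phi \<omega> (K' ** M) = F"
    proof (rule six_linear_forms_eqI[OF Phi_six_linear F])
      fix c :: "nat \<Rightarrow> 'n"
      have "Phi \<omega> (K' ** M) (\<lambda>n. axis (c n) 1) = F (e (c 1, c 2, c 3) (c 4, c 5, c 6))"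
        by (simp only: Phi_axis K_def[symmetric] matrix_mul_assoc KK' matrix_mul_lid)
           (simp add: M_def)
      also have "\<dots> = F (\<lambda>n. axis (c n) 1)"
      proof -
        have "e (c 1, c 2, c 3) (c 4, c 5, c 6) i = axis (c i) 1" if "i \<in> {1..6}" for i
        proof -
          from that have "i = 1 \<or> i = 2 \<or> i = 3 \<or> i = 4 \<or> i = 5 \<or> i = 6" by auto
          thus ?thesis by (elim disjE) (simp_all add: e_def)
        qed
        thus ?thesis using F by (simp add: six_linear_forms_def)
      qed
      finally show "Phi \<omega> (K' ** M) (\<lambda>n. axis (c n) 1) = F (\<lambda>n. axis (c n) 1)" .
    qed
    thus ?thesis by (metis rangeI)
  qed
  ultimately show ?thesis
    using Phi_six_linear by (auto simp: bij_betw_def)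
qed


end

theory Submission
  imports Defs "HOL-Computational_Algebra.Fundamental_Theorem_Algebra" "HOL-Library.Numeral_Type"
begin

text \<open>
  A highest weight vector of the module has weight \<open>\<omega>\<^sub>7\<close>, since every other nonzero dominant weight
  has more than 56 weights below it. So the module is minuscule and has a basis of weight vectors
  that the lowering operators permute up to zero.

  Upper bound. Evaluating the last argument from the lowest weight upwards, a form killed by the
  lowering operators is determined by its values at the tuples of weights with dominant partial
  sums. For invariant six-linear forms only closed paths matter: a dominant path of length three
  followed by the negative of another one with the same end point, read backwards. There are
  \<open>4\<^sup>2 + 2\<^sup>2 + 3\<^sup>2 + 1 + 2\<^sup>2 + 1 = 35\<close> of them.

  Lower bound. The weights in the span of the three orthogonal simple roots 2, 5 and 7 span a tensor
  product of three planes, on which \<open>d\<close> is a nonzero multiple of Cayley's hyperdeterminant. There the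
  values of all forms are explicit integers up to scaling. A transvection in \<open>sp\<close> kills the forms of
  order zero and is injective on the span of 20 of the others, by an invertible integer matrix; the
  15 forms of order zero are separated by their values at the pairings. This gives 35 independent
  forms, and shows that an \<open>e\<^sub>7\<close>-invariant form killed by the transvection has order zero.
\<close>

section \<open>Weights of type \<open>E\<^sub>7\<close>\<close>

text \<open>\<open>\<omega>\<close> and \<open>d\<close> are known only through their axioms, so
  whatever is computed on the eight-dimensional subspace depends on two unknown scalars,
  \<open>\<omega>\<^sub>0\<close> and \<open>\<kappa>\<close>. Nondegeneracy makes the first
  nonzero. The delicate point is that \<open>\<kappa>\<close> is nonzero, that is, that
  \<open>d\<close> does not vanish on this small subspace; it is settled by a second use of the
  upper bound argument, now for four-linear forms. The closed paths of length four are x, y, -y, -x,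
  and simple reflections, which change the value of \<open>d\<close> on such a quadruple at most by
  a sign, carry all of them into the subspace. The values of the forms of order zero, one and two
  then carry the factors \<open>\<omega>\<^sub>0 ^ 3\<close>,
  \<open>\<omega>\<^sub>0 * \<kappa>\<close> and
  \<open>\<kappa> * \<kappa> / \<omega>\<^sub>0\<close>. These merely rescale columns, so that
  independence becomes a statement about fixed integer matrices. The squares in the count 35 are
  those of the multiplicities of the irreducible constituents of
  \<open>V \<otimes> V \<otimes> V\<close>.\<close>

text \<open>
  Weights are the lists of their values on the seven simple coroots, in Bourbaki's numbering
  shifted by one.
\<close>

definition e7_roots :: "int list list" where
  "e7_roots =
    [[2, 0, -1, 0, 0, 0, 0], [0, 2, 0, -1, 0, 0, 0], [-1, 0, 2, -1, 0, 0, 0],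
     [0, -1, -1, 2, -1, 0, 0], [0, 0, 0, -1, 2, -1, 0], [0, 0, 0, 0, -1, 2, -1],
     [0, 0, 0, 0, 0, -1, 2]]"

definition wplus :: "int list \<Rightarrow> int list \<Rightarrow> int list" where
  "wplus = map2 (+)"

definition wminus :: "int list \<Rightarrow> int list \<Rightarrow> int list" where
  "wminus = map2 (-)"

definition descend :: "int list list \<Rightarrow> int list list" where
  "descend S = remdups [wminus \<mu> (e7_roots ! i). \<mu> \<leftarrow> S, i \<leftarrow> [0..<7], 0 < \<mu> ! i]"

primrec descents :: "nat \<Rightarrow> int list list \<Rightarrow> int list list" where
  "descents 0 S = S"
| "descents (Suc n) S = S @ descents n (descend S)"

definition fundamental_weight :: "nat \<Rightarrow> int list" where
  "fundamental_weight i = (replicate 7 0)[i := 1]"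

definition e7_weights :: "int list list" where
  "e7_weights =
    [[0, 0, 0, 0, 0, 0, 1], [0, 0, 0, 0, 0, 1, -1], [0, 0, 0, 0, 1, -1, 0], [0, 0, 0, 1, -1, 0, 0],
    [0, 1, 1, -1, 0, 0, 0], [0, -1, 1, 0, 0, 0, 0], [1, 1, -1, 0, 0, 0, 0], [-1, 1, 0, 0, 0, 0, 0],
    [1, -1, -1, 1, 0, 0, 0], [-1, -1, 0, 1, 0, 0, 0], [1, 0, 0, -1, 1, 0, 0], [-1, 0, 1, -1, 1, 0,
    0], [1, 0, 0, 0, -1, 1, 0], [0, 0, -1, 0, 1, 0, 0], [-1, 0, 1, 0, -1, 1, 0], [1, 0, 0, 0, 0, -1,
    1], [0, 0, -1, 1, -1, 1, 0], [-1, 0, 1, 0, 0, -1, 1], [1, 0, 0, 0, 0, 0, -1], [0, 1, 0, -1, 0,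
    1, 0], [0, 0, -1, 1, 0, -1, 1], [-1, 0, 1, 0, 0, 0, -1], [0, -1, 0, 0, 0, 1, 0], [0, 1, 0, -1,
    1, -1, 1], [0, 0, -1, 1, 0, 0, -1], [0, -1, 0, 0, 1, -1, 1], [0, 1, 0, 0, -1, 0, 1], [0, 1, 0,
    -1, 1, 0, -1], [0, -1, 0, 1, -1, 0, 1], [0, -1, 0, 0, 1, 0, -1], [0, 1, 0, 0, -1, 1, -1], [0, 0,
    1, -1, 0, 0, 1], [0, -1, 0, 1, -1, 1, -1], [0, 1, 0, 0, 0, -1, 0], [1, 0, -1, 0, 0, 0, 1], [0,
    0, 1, -1, 0, 1, -1], [0, -1, 0, 1, 0, -1, 0], [-1, 0, 0, 0, 0, 0, 1], [1, 0, -1, 0, 0, 1, -1],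
    [0, 0, 1, -1, 1, -1, 0], [-1, 0, 0, 0, 0, 1, -1], [1, 0, -1, 0, 1, -1, 0], [0, 0, 1, 0, -1, 0,
    0], [-1, 0, 0, 0, 1, -1, 0], [1, 0, -1, 1, -1, 0, 0], [-1, 0, 0, 1, -1, 0, 0], [1, 1, 0, -1, 0,
    0, 0], [-1, 1, 1, -1, 0, 0, 0], [1, -1, 0, 0, 0, 0, 0], [0, 1, -1, 0, 0, 0, 0], [-1, -1, 1, 0,
    0, 0, 0], [0, -1, -1, 1, 0, 0, 0], [0, 0, 0, -1, 1, 0, 0], [0, 0, 0, 0, -1, 1, 0], [0, 0, 0, 0,
    0, -1, 1], [0, 0, 0, 0, 0, 0, -1]]"

text \<open>Subtracting a simple root lowers the coheight by 2; it runs from 27 at the highest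
  weight to -27 at its negative, so 27 levels reach the bottom.\<close>

lemma e7_weights_eq: "descents 27 [fundamental_weight 6] = e7_weights"
  by code_simp

text \<open>
  If a weight of a module is positive at a simple coroot, then subtracting the simple root gives
  another weight. Hence a module whose highest weight dominates one of these seven starting weights
  has more than 56 weights.
\<close>

lemma many_weights:
  "\<forall>i\<in>set [0..<6]. distinct (descents ([16, 11, 10, 8, 8, 11] ! i) [fundamental_weight i]) \<and>
     56 < length (descents ([16, 11, 10, 8, 8, 11] ! i) [fundamental_weight i])"
  "distinct (descents 12 [wplus (fundamental_weight 6) (fundamental_weight 6)]) \<and>
     56 < length (descents 12 [wplus (fundamental_weight 6) (fundamental_weight 6)])"
  by code_simp+

text \<open>The coefficients are those of the sum of the positive coroots in the simple ones.\<close>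

definition coheight :: "int list \<Rightarrow> int" where
  "coheight \<mu> = (\<Sum>(c, m)\<leftarrow>zip [34, 49, 66, 96, 75, 52, 27] \<mu>. c * m)"

text \<open>The number of simple roots subtracted from the highest weight, where
  \<open>coheight\<close> is 27; every simple root has \<open>coheight\<close> 2.\<close>

definition depth :: "int list \<Rightarrow> nat" where
  "depth \<mu> = nat ((27 - coheight \<mu>) div 2)"

text \<open>The last clause is what makes the module rigid: if two simple roots that can both be
  added were not orthogonal, adding one of them would bring the value at the other coroot down to
  -2.\<close>

lemma e7_weights_check:
  "\<forall>\<mu>\<in>set e7_weights. length \<mu> = 7 \<and> map uminus \<mu> \<in> set e7_weights \<and> depth \<mu> \<le> 27 \<and>
     (\<mu> \<noteq> fundamental_weight 6 \<longrightarrow> (\<exists>i\<in>set [0..<7]. \<mu> ! i = -1)) \<and>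
     (\<forall>i\<in>set [0..<7]. \<mu> ! i \<in> {-1, 0, 1} \<and>
        (\<mu> ! i = -1 \<longrightarrow>
           depth \<mu> = Suc (depth (wplus \<mu> (e7_roots ! i))) \<and>
           (\<forall>j\<in>set [0..<7]. \<mu> ! j = -1 \<and> i \<noteq> j \<longrightarrow> e7_roots ! i ! j = 0)))"
  by code_simp

lemma e7_weights_raise_check:
  "\<forall>\<mu>\<in>set e7_weights. \<forall>i\<in>set [0..<7]. \<mu> ! i = -1 \<longrightarrow> wplus \<mu> (e7_roots ! i) \<in> set e7_weights"
  by code_simp

lemma e7_weights_distinct: "distinct e7_weights" and length_e7_weights: "length e7_weights = 56"
  by code_simp+

lemma e7_roots_check:
  "\<forall>i\<in>set [0..<7]. length (e7_roots ! i) = 7 \<and> e7_roots ! i ! i = 2 \<and>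
     (\<forall>j\<in>set [0..<7]. e7_roots ! i ! j = cartan_E7 (Suc i) (Suc j) \<and> e7_roots ! i ! j = e7_roots ! j ! i)"
  by code_simp

section \<open>Eigenvectors and strings\<close>

lemma mat_vec_simps:
  fixes A B :: "complex ^ 'n ^ 'n"
  shows "A *v (x + y) = A *v x + A *v y" "A *v (x - y) = A *v x - A *v y"
    "A *v (c *s x) = c *s (A *v x)" "A *v 0 = 0" "A *v (- x) = - (A *v x)" "(- A) *v x = - (A *v x)"
    "(A + B) *v x = A *v x + B *v x" "(A - B) *v x = A *v x - B *v x" "(0 :: complex ^ 'n ^ 'n) *v x = 0"
    "cmat_scale c A *v x = c *s (A *v x)"
  by (simp_all add: vec.add vec.diff vec.scale vec.neg matrix_vector_mult_add_rdistrib)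
     (simp_all add: matrix_vector_mult_def vec_eq_iff sum_negf sum_subtractf algebra_simps
        cmat_scale_def sum_distrib_left)

text \<open>Dependence of a family rather than of a set: a repetition is itself a relation. So
  weight vectors, iterates and sampled forms can be counted by their indices.\<close>

lemma family_dependent:
  fixes x :: "'a \<Rightarrow> complex ^ 'n"
  assumes I: "finite I" and card: "CARD('n) < card I"
  obtains c where "\<exists>i\<in>I. c i \<noteq> 0" "(\<Sum>i\<in>I. c i *s x i) = 0"
proof (cases "inj_on x I")
  case True
  have "vec.dependent (x ` I)"
  proof (rule ccontr)
    assume "vec.independent (x ` I)"
    hence "card (x ` I) \<le> vec.dim (UNIV :: (complex ^ 'n) set)"
      by (intro vec.independent_card_le_dim) auto
    thus False using card True by (simp add: card_image card_cart_basis)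
  qed
  then obtain u where u: "\<exists>v\<in>x ` I. u v \<noteq> 0" "(\<Sum>v\<in>x ` I. u v *s v) = 0"
    using I by (auto simp: vec.dependent_finite)
  show thesis
    by (rule that[of "u \<circ> x"]) (use u True in \<open>auto simp: sum.reindex\<close>)
next
  case False
  then obtain i j where ij: "i \<in> I" "j \<in> I" "i \<noteq> j" "x i = x j" by (auto simp: inj_on_def)
  define c where "c k = (if k = i then 1 else if k = j then - 1 else 0 :: complex)" for k
  have "(\<Sum>k\<in>I. c k *s x k) = (\<Sum>k\<in>{i, j}. c k *s x k)"
    using ij I by (intro sum.mono_neutral_right) (auto simp: c_def)
  also have "\<dots> = 0" using ij by (simp add: c_def)
  finally show thesis using ij by (intro that[of c]) (auto simp: c_def)
qed

text \<open>Take a nonzero polynomial of least degree that annihilates u when evaluated at A. It has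
  a root z, and the cofactor of X - z, evaluated at A and applied to u, is an eigenvector in W;
  minimality keeps it nonzero.\<close>

lemma eigenvector_in_invariant_subspace:
  fixes A :: "complex ^ 'n ^ 'n"
  assumes W: "vec.subspace W" "\<And>w. w \<in> W \<Longrightarrow> A *v w \<in> W" and u: "u \<in> W" "u \<noteq> 0"
  obtains c w where "w \<in> W" "w \<noteq> 0" "A *v w = c *s w"
proof -
  \<comment> \<open>This is p(A) u as soon as n bounds the degree of p; the free bound n allows
    polynomials of different degrees to be compared term by term.\<close>
  define g where "g n p = (\<Sum>i\<le>n. coeff p i *s ((*v) A ^^ i) u)" for n and p :: "complex poly"
  have g_eq: "g n p = g (degree p) p" if "degree p \<le> n" for n p
    unfolding g_def using that by (intro sum.mono_neutral_right) (auto simp: coeff_eq_0)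
  have g_mem: "g n p \<in> W" for n p
  proof -
    have "((*v) A ^^ i) u \<in> W" for i by (induction i) (use W u in auto)
    thus ?thesis unfolding g_def by (intro vec.subspace_sum[OF W(1)] vec.subspace_scale[OF W(1)])
  qed
  have g_pCons: "g (Suc n) (pCons 0 p) = A *v g n p" for n p
    unfolding g_def sum.atMost_Suc_shift by (simp add: vec.sum vec.scale)
  obtain c where c: "\<exists>i\<in>{..CARD('n)}. c i \<noteq> 0" "(\<Sum>i\<in>{..CARD('n)}. c i *s ((*v) A ^^ i) u) = 0"
    using family_dependent[of "{..CARD('n)}" "\<lambda>i. ((*v) A ^^ i) u"] by auto
  define p where "p = (\<Sum>i\<le>CARD('n). monom (c i) i)"
  have cp: "coeff p i = (if i \<le> CARD('n) then c i else 0)" for i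
    by (simp add: p_def coeff_sum)
  have "p \<noteq> 0" using c(1) cp by (metis atMost_iff coeff_0)
  moreover have "g (degree p) p = 0"
  proof -
    have "degree p \<le> CARD('n)" by (rule degree_le) (simp add: cp)
    hence "g (degree p) p = g (CARD('n)) p" by (rule g_eq[symmetric])
    also have "\<dots> = 0" using c(2) by (simp add: g_def cp)
    finally show ?thesis .
  qed
  ultimately obtain q where q: "q \<noteq> 0" "g (degree q) q = 0"
    and min: "\<And>r. r \<noteq> 0 \<Longrightarrow> g (degree r) r = 0 \<Longrightarrow> degree q \<le> degree r"
    using ex_has_least_nat[of "\<lambda>r. r \<noteq> 0 \<and> g (degree r) r = 0" p degree] by blast
  have "degree q \<noteq> 0"
  proof
    assume "degree q = 0"
    then obtain a where "q = [:a:]" by (metis degree_eq_zeroE)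
    thus False using q u by (simp add: g_def)
  qed
  hence "\<not> constant (poly q)" by (simp add: constant_degree)
  then obtain z where "poly q z = 0" using fundamental_theorem_of_algebra by blast
  then obtain r where r: "q = [:- z, 1:] * r" by (auto simp: poly_eq_0_iff_dvd)
  have r0: "r \<noteq> 0" using q r by auto
  have deg: "degree q = Suc (degree r)" using r0 unfolding r by (subst degree_mult_eq) auto
  have "coeff q i = coeff (pCons 0 r) i - z * coeff r i" for i by (simp add: r)
  hence "g (Suc (degree r)) q = g (Suc (degree r)) (pCons 0 r) - z *s g (Suc (degree r)) r"
    unfolding g_def by (simp only: vec.scale_left_diff_distrib sum_subtractf vec.scale_sum_right vec.scale_scale)
  hence "A *v g (degree r) r - z *s g (degree r) r = 0"
    using q(2) g_eq[of r "Suc (degree r)"] by (simp add: deg g_pCons)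
  moreover have "g (degree r) r \<noteq> 0" using min[OF r0] deg by auto
  ultimately show thesis by (intro that[of "g (degree r) r" z]) (auto simp: g_mem)
qed

text \<open>Stated for triples with the roles of \<open>e\<close> and \<open>f\<close> interchangeable through \<open>h \<mapsto> - h\<close>.\<close>

lemma sl2_string:
  fixes e f h :: "complex ^ 'n ^ 'n"
  assumes ef: "e ** f - f ** e = h" and he: "h ** e - e ** h = cmat_scale 2 e"
    and v: "f *v v = 0" "h *v v = m *s v"
  shows "f *v (((*v) e ^^ Suc k) v) = - (of_nat (Suc k) * (m + of_nat k)) *s (((*v) e ^^ k) v)"
proof -
  have fe: "f *v (e *v w) = e *v (f *v w) - h *v w" for w
    by (simp add: ef[symmetric] mat_vec_simps matrix_vector_mul_assoc)
  have he': "h *v (e *v w) = e *v (h *v w) + 2 *s (e *v w)" for w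
    using arg_cong[OF he, of "\<lambda>A. A *v w"] by (simp add: mat_vec_simps matrix_vector_mul_assoc algebra_simps)
  have hk: "h *v (((*v) e ^^ k) v) = (m + 2 * of_nat k) *s (((*v) e ^^ k) v)" for k
  proof (induction k)
    case (Suc k)
    have "h *v (((*v) e ^^ Suc k) v) = e *v (h *v (((*v) e ^^ k) v)) + 2 *s (e *v (((*v) e ^^ k) v))"
      by (simp add: he')
    also have "\<dots> = (m + 2 * of_nat k + 2) *s (e *v (((*v) e ^^ k) v))"
      unfolding Suc by (simp add: mat_vec_simps vec.scale_left_distrib)
    finally show ?case by (simp add: algebra_simps)
  qed (simp add: v)
  show ?thesis
  proof (induction k)
    case 0
    show ?case by (simp add: fe v mat_vec_simps)
  next
    case (Suc k)
    have "f *v (((*v) e ^^ Suc (Suc k)) v) = e *v (f *v (((*v) e ^^ Suc k) v)) - h *v (((*v) e ^^ Suc k) v)"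
      by (simp add: fe)
    also have "\<dots> = (- (of_nat (Suc k) * (m + of_nat k)) - (m + 2 * of_nat (Suc k))) *s (((*v) e ^^ Suc k) v)"
      unfolding Suc.IH hk by (simp add: mat_vec_simps vec.scale_left_diff_distrib)
    also have "- (of_nat (Suc k) * (m + of_nat k)) - (m + 2 * of_nat (Suc k))
        = - (of_nat (Suc (Suc k)) * (m + of_nat (Suc k)))"
      by (simp add: algebra_simps)
    finally show ?case .
  qed
qed

section \<open>The 56-dimensional module\<close>

lemma wplus_nth: "length x = 7 \<Longrightarrow> length y = 7 \<Longrightarrow> i < 7 \<Longrightarrow> wplus x y ! i = x ! i + y ! i"
  and wminus_nth: "length x = 7 \<Longrightarrow> length y = 7 \<Longrightarrow> i < 7 \<Longrightarrow> wminus x y ! i = x ! i - y ! i"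
  and length_wplus: "length x = 7 \<Longrightarrow> length y = 7 \<Longrightarrow> length (wplus x y) = 7"
  and length_wminus: "length x = 7 \<Longrightarrow> length y = 7 \<Longrightarrow> length (wminus x y) = 7"
  by (simp_all add: wplus_def wminus_def)

lemma wplus_wminus_cancel: "length x = 7 \<Longrightarrow> length y = 7 \<Longrightarrow> wplus (wminus x y) y = x"
  and wminus_wplus_cancel: "length x = 7 \<Longrightarrow> length y = 7 \<Longrightarrow> wminus (wplus x y) y = x"
  by (intro nth_equalityI; simp add: wplus_def wminus_def)+

lemma e7_roots_length: "i < 7 \<Longrightarrow> length (e7_roots ! i) = 7"
  and e7_roots_diag: "i < 7 \<Longrightarrow> e7_roots ! i ! i = 2"
  using e7_roots_check by auto

lemma e7_roots_sym: "i < 7 \<Longrightarrow> j < 7 \<Longrightarrow> e7_roots ! i ! j = e7_roots ! j ! i"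
  using e7_roots_check by (metis atLeastLessThan_iff le0 set_upt)

text \<open>The images of the Chevalley generators, renumbered from 0. The root of
  \<open>E j\<close> is evaluated at the coroot of \<open>H i\<close>, hence
  \<open>e7_roots ! j ! i\<close>. \<open>FF\<close> is the Serre relation for orthogonal nodes,
  which will make products of lowering operators independent of their order.\<close>

locale e7_triples =
  fixes E F H :: "nat \<Rightarrow> complex ^ 'n ^ 'n"
  assumes HH: "i < 7 \<Longrightarrow> j < 7 \<Longrightarrow> H i ** H j = H j ** H i"
    and HE: "i < 7 \<Longrightarrow> j < 7 \<Longrightarrow> H i ** E j - E j ** H i = cmat_scale (of_int (e7_roots ! j ! i)) (E j)"
    and HF: "i < 7 \<Longrightarrow> j < 7 \<Longrightarrow> H i ** F j - F j ** H i = cmat_scale (- of_int (e7_roots ! j ! i)) (F j)"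
    and EF: "i < 7 \<Longrightarrow> j < 7 \<Longrightarrow> E i ** F j - F j ** E i = (if i = j then H i else 0)"
    and FF: "i < 7 \<Longrightarrow> j < 7 \<Longrightarrow> i \<noteq> j \<Longrightarrow> e7_roots ! i ! j = 0 \<Longrightarrow> F i ** F j = F j ** F i"
    and irreducible: "vec.subspace W \<Longrightarrow>
      (\<And>i w. i < 7 \<Longrightarrow> w \<in> W \<Longrightarrow> E i *v w \<in> W \<and> F i *v w \<in> W \<and> H i *v w \<in> W) \<Longrightarrow> W = {0} \<or> W = UNIV"
    and card: "CARD('n) = 56"
begin

text \<open>Complex values are allowed because integrality has yet to be proved, and the zero vector
  because a vector may be shown to vanish by its weight.\<close>

definition weight_vector :: "(nat \<Rightarrow> complex) \<Rightarrow> complex ^ 'n \<Rightarrow> bool" where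
  "weight_vector m v \<longleftrightarrow> (\<forall>i<7. H i *v v = m i *s v)"

lemma HE_apply: "i < 7 \<Longrightarrow> j < 7 \<Longrightarrow> H i *v (E j *v w) = E j *v (H i *v w) + of_int (e7_roots ! j ! i) *s (E j *v w)"
  using arg_cong[OF HE, of i j "\<lambda>A. A *v w"] by (simp add: mat_vec_simps matrix_vector_mul_assoc algebra_simps)

lemma HF_apply: "i < 7 \<Longrightarrow> j < 7 \<Longrightarrow> H i *v (F j *v w) = F j *v (H i *v w) - of_int (e7_roots ! j ! i) *s (F j *v w)"
  using arg_cong[OF HF, of i j "\<lambda>A. A *v w"] by (simp add: mat_vec_simps matrix_vector_mul_assoc algebra_simps)

lemma EF_apply: "i < 7 \<Longrightarrow> j < 7 \<Longrightarrow> E i *v (F j *v w) = F j *v (E i *v w) + (if i = j then H i *v w else 0)"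
  using arg_cong[OF EF, of i j "\<lambda>A. A *v w"] by (simp add: mat_vec_simps matrix_vector_mul_assoc algebra_simps split: if_splits)

lemma FF_apply: "i < 7 \<Longrightarrow> j < 7 \<Longrightarrow> i \<noteq> j \<Longrightarrow> e7_roots ! i ! j = 0 \<Longrightarrow> F i *v (F j *v w) = F j *v (F i *v w)"
  using FF[of i j] by (simp add: matrix_vector_mul_assoc)

lemma weight_vector_E:
  "weight_vector m v \<Longrightarrow> j < 7 \<Longrightarrow> weight_vector (\<lambda>i. m i + of_int (e7_roots ! j ! i)) (E j *v v)"
  by (simp add: weight_vector_def HE_apply mat_vec_simps vec.scale_left_distrib)

lemma weight_vector_F:
  "weight_vector m v \<Longrightarrow> j < 7 \<Longrightarrow> weight_vector (\<lambda>i. m i - of_int (e7_roots ! j ! i)) (F j *v v)"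
  by (simp add: weight_vector_def HF_apply mat_vec_simps vec.scale_left_diff_distrib)

lemma weight_vector_F_power:
  "weight_vector m v \<Longrightarrow> j < 7 \<Longrightarrow>
     weight_vector (\<lambda>i. m i - of_nat k * of_int (e7_roots ! j ! i)) (((*v) (F j) ^^ k) v)"
proof (induction k)
  case (Suc k)
  from weight_vector_F[OF Suc.IH[OF Suc.prems] Suc.prems(2)] show ?case by (simp add: algebra_simps)
qed simp

lemma weight_vector_E_power:
  "weight_vector m v \<Longrightarrow> j < 7 \<Longrightarrow>
     weight_vector (\<lambda>i. m i + of_nat k * of_int (e7_roots ! j ! i)) (((*v) (E j) ^^ k) v)"
proof (induction k)
  case (Suc k)
  from weight_vector_E[OF Suc.IH[OF Suc.prems] Suc.prems(2)] show ?case by (simp add: algebra_simps)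
qed simp

text \<open>Choose a coroot i that separates the weights of k and l. Subtracting
  \<open>m l i\<close> times the relation from its image under \<open>H i\<close> removes the term
  of l and multiplies that of k by a nonzero factor.\<close>

lemma weight_vectors_independent:
  assumes "finite I" "\<And>k. k \<in> I \<Longrightarrow> weight_vector (m k) (x k)"
    and "\<And>k l. k \<in> I \<Longrightarrow> l \<in> I \<Longrightarrow> k \<noteq> l \<Longrightarrow> \<exists>i<7. m k i \<noteq> m l i"
    and "(\<Sum>k\<in>I. x k) = 0" "k \<in> I"
  shows "x k = 0"
  using assms
proof (induction I arbitrary: x k rule: finite_induct)
  case (insert l I)
  have 0: "x k = 0" if k: "k \<in> I" for k
  proof -
    obtain i where i: "i < 7" "m k i \<noteq> m l i" using insert.prems(2)[of k l] k insert.hyps by auto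
    have "(m k i - m l i) *s x k = 0"
    proof (rule insert.IH[of "\<lambda>k. (m k i - m l i) *s x k"])
      show "weight_vector (m j) ((m j i - m l i) *s x j)" if "j \<in> I" for j
        using insert.prems(1)[of j] that by (simp add: weight_vector_def mat_vec_simps mult.commute)
      have H: "H i *v x j = m j i *s x j" if "j \<in> insert l I" for j
        using insert.prems(1)[OF that] i(1) by (simp add: weight_vector_def)
      have "H i *v (\<Sum>k\<in>insert l I. x k) = 0" "m l i *s (\<Sum>k\<in>insert l I. x k) = 0"
        unfolding insert.prems(3) by (simp_all add: mat_vec_simps)
      hence "H i *v (\<Sum>k\<in>insert l I. x k) - m l i *s (\<Sum>k\<in>insert l I. x k) = 0" by simp
      also have "H i *v (\<Sum>k\<in>insert l I. x k) = (\<Sum>k\<in>insert l I. m k i *s x k)"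
        unfolding vec.sum by (intro sum.cong refl H)
      finally show "(\<Sum>k\<in>I. (m k i - m l i) *s x k) = 0"
        using insert.hyps by (simp add: vec.scale_sum_right vec.scale_left_diff_distrib sum_subtractf algebra_simps)
    qed (use insert.prems k in auto)
    thus ?thesis using i by simp
  qed
  moreover have "x l = 0" using insert.prems(3) insert.hyps 0 by simp
  ultimately show ?case using insert.prems(4) by auto
qed simp

text \<open>The source of finiteness: strings break off, raising comes to an end, and the module has
  at most 56 weights.\<close>

lemma card_weight_vectors_le:
  assumes I: "finite I" and wv: "\<And>k. k \<in> I \<Longrightarrow> weight_vector (m k) (x k)"
    and nz: "\<And>k. k \<in> I \<Longrightarrow> x k \<noteq> 0"
    and ne: "\<And>k l. k \<in> I \<Longrightarrow> l \<in> I \<Longrightarrow> k \<noteq> l \<Longrightarrow> \<exists>i<7. m k i \<noteq> m l i"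
  shows "card I \<le> 56"
proof (rule ccontr)
  assume "\<not> card I \<le> 56"
  then obtain c where c: "\<exists>i\<in>I. c i \<noteq> 0" "(\<Sum>i\<in>I. c i *s x i) = 0"
    using family_dependent[OF I, of x] card by auto
  have "c k *s x k = 0" if "k \<in> I" for k
  proof (rule weight_vectors_independent[OF I _ ne c(2) that])
    show "weight_vector (m k) (c k *s x k)" if "k \<in> I" for k
      using wv[OF that] by (simp add: weight_vector_def mat_vec_simps vec.scale_left_commute)
  qed
  thus False using c(1) nz by auto
qed

text \<open>A root takes the value 2 at its own coroot, so the iterates have distinct weights, and
  57 of them cannot all be nonzero.\<close>

lemma F_nilpotent:
  assumes v: "weight_vector m v" and j: "j < 7"
  obtains k where "((*v) (F j) ^^ k) v = 0"
proof (rule ccontr)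
  assume "\<not> thesis"
  hence nz: "((*v) (F j) ^^ k) v \<noteq> 0" for k using that by blast
  have "card {..56::nat} \<le> 56"
    by (rule card_weight_vectors_le[OF _ weight_vector_F_power[OF v j] nz])
       (use j in \<open>auto intro!: exI[of _ j] simp: e7_roots_diag\<close>)
  thus False by simp
qed

lemma E_nilpotent:
  assumes v: "weight_vector m v" and j: "j < 7"
  obtains k where "((*v) (E j) ^^ k) v = 0"
proof (rule ccontr)
  assume "\<not> thesis"
  hence nz: "((*v) (E j) ^^ k) v \<noteq> 0" for k using that by blast
  have "card {..56::nat} \<le> 56"
    by (rule card_weight_vectors_le[OF _ weight_vector_E_power[OF v j] nz])
       (use j in \<open>auto intro!: exI[of _ j] simp: e7_roots_diag\<close>)
  thus False by simp
qed

section \<open>Strings of the simple roots and highest weight vectors\<close>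

lemma sl2_E_string:
  assumes "j < 7" "F j *v v = 0" "weight_vector m v"
  shows "F j *v (((*v) (E j) ^^ Suc k) v) = - (of_nat (Suc k) * (m j + of_nat k)) *s (((*v) (E j) ^^ k) v)"
  by (rule sl2_string[of _ _ "H j"])
     (use assms EF[of j j] HE[of j j] in \<open>simp_all add: e7_roots_diag weight_vector_def\<close>)

lemma sl2_F_string:
  assumes "j < 7" "E j *v v = 0" "weight_vector m v"
  shows "E j *v (((*v) (F j) ^^ Suc k) v) = - (of_nat (Suc k) * (- m j + of_nat k)) *s (((*v) (F j) ^^ k) v)"
proof (rule sl2_string[of _ _ "- H j"])
  show "F j ** E j - E j ** F j = - H j" using EF[of j j] assms by (simp add: algebra_simps)
  have "- H j ** F j - F j ** - H j = - (H j ** F j - F j ** H j)"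
    by (simp add: matrix_eq mat_vec_simps matrix_vector_mul_assoc[symmetric])
  thus "- H j ** F j - F j ** - H j = cmat_scale 2 (F j)"
    using HF[of j j] assms by (simp add: e7_roots_diag cmat_scale_def vec_eq_iff)
  show "E j *v v = 0" by fact
  show "- H j *v v = (- m j) *s v" using assms by (simp add: weight_vector_def mat_vec_simps)
qed

lemma nonzero_iterate:
  fixes f :: "'a::zero \<Rightarrow> 'a"
  assumes "f 0 = 0" "(f ^^ k) v = 0" "v \<noteq> 0"
  obtains l where "(f ^^ l) v \<noteq> 0" "(f ^^ Suc l) v = 0"
proof -
  define P where "P k \<longleftrightarrow> (f ^^ k) v = 0" for k
  have "P k" "\<not> P 0" using assms by (auto simp: P_def)
  then obtain l where "\<not> P l" "P (Suc l)" using ex_least_nat_less[of P k] by blast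
  thus thesis using that by (simp add: P_def)
qed

text \<open>If \<open>F j\<close> killed v, then v would be the bottom of an \<open>E j\<close>
  string. The string breaks off, and there the string formula gives \<open>m j\<close> = -l for some
  natural number l.\<close>

lemma F_nonzero:
  assumes j: "j < 7" and v: "weight_vector m v" "v \<noteq> 0" and pos: "Re (m j) > 0"
  shows "F j *v v \<noteq> 0"
proof
  assume F: "F j *v v = 0"
  obtain k where "((*v) (E j) ^^ k) v = 0" using E_nilpotent[OF v(1) j] .
  then obtain l where l: "((*v) (E j) ^^ l) v \<noteq> 0" "((*v) (E j) ^^ Suc l) v = 0"
    using nonzero_iterate[of "(*v) (E j)"] v(2) by (metis mat_vec_simps(4))
  from sl2_E_string[OF j F v(1), of l] l have "of_nat (Suc l) * (m j + of_nat l) = 0"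
    unfolding l(2) by (simp add: mat_vec_simps)
  hence "m j + of_nat l = 0" using of_nat_neq_0 mult_eq_0_iff by metis
  hence "Re (m j) + l = 0" by (metis plus_complex.sel(1) complex_Re_of_nat zero_complex.sel(1))
  thus False using pos by simp
qed

lemma E_nonzero:
  assumes j: "j < 7" and v: "weight_vector m v" "v \<noteq> 0" and neg: "Re (m j) < 0"
  shows "E j *v v \<noteq> 0"
proof
  assume E: "E j *v v = 0"
  obtain k where "((*v) (F j) ^^ k) v = 0" using F_nilpotent[OF v(1) j] .
  then obtain l where l: "((*v) (F j) ^^ l) v \<noteq> 0" "((*v) (F j) ^^ Suc l) v = 0"
    using nonzero_iterate[of "(*v) (F j)"] v(2) by (metis mat_vec_simps(4))
  from sl2_F_string[OF j E v(1), of l] l have "of_nat (Suc l) * (- m j + of_nat l) = 0"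
    unfolding l(2) by (simp add: mat_vec_simps)
  hence "- m j + of_nat l = 0" using of_nat_neq_0 mult_eq_0_iff by metis
  hence "- Re (m j) + l = 0" by (metis plus_complex.sel(1) uminus_complex.sel(1) complex_Re_of_nat zero_complex.sel(1))
  thus False using neg by simp
qed

text \<open>Here v is the top of an \<open>F j\<close> string; if its last nonzero vector is reached
  after l steps, the string formula forces \<open>m j\<close> = l.\<close>

lemma highest_weight_integral:
  assumes j: "j < 7" and v: "weight_vector m v" "v \<noteq> 0" and E: "E j *v v = 0"
  shows "\<exists>n. m j = of_nat n"
proof -
  obtain k where "((*v) (F j) ^^ k) v = 0" using F_nilpotent[OF v(1) j] .
  then obtain l where l: "((*v) (F j) ^^ l) v \<noteq> 0" "((*v) (F j) ^^ Suc l) v = 0"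
    using nonzero_iterate[of "(*v) (F j)"] v(2) by (metis mat_vec_simps(4))
  from sl2_F_string[OF j E v(1), of l] l have "of_nat (Suc l) * (- m j + of_nat l) = 0"
    unfolding l(2) by (simp add: mat_vec_simps)
  hence "- m j + of_nat l = 0" using of_nat_neq_0 mult_eq_0_iff by metis
  thus ?thesis by (intro exI[of _ l]) (simp add: algebra_simps)
qed

text \<open>The commuting \<open>H i\<close> are treated one at a time: the common eigenspace of the
  first k of them is preserved by the next one.\<close>

lemma weight_vector_exists: "\<exists>m v. v \<noteq> 0 \<and> weight_vector m v"
proof -
  have "\<exists>m v. v \<noteq> 0 \<and> (\<forall>i<k. H i *v v = m i *s v)" if "k \<le> 7" for k
    using that
  proof (induction k)
    case 0
    show ?case by (rule exI, rule exI[of _ "axis undefined 1"]) (simp add: axis_eq_0_iff)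
  next
    case (Suc k)
    then obtain m v where mv: "v \<noteq> 0" "\<forall>i<k. H i *v v = m i *s v" by auto
    define W where "W = {w. \<forall>i<k. H i *v w = m i *s w}"
    have "vec.subspace W"
      by (auto simp: W_def vec.subspace_def mat_vec_simps vec.scale_right_distrib vec.scale_left_commute)
    moreover have "H k *v w \<in> W" if "w \<in> W" for w
    proof -
      have "H i *v (H k *v w) = m i *s (H k *v w)" if i: "i < k" for i
      proof -
        have "H i *v (H k *v w) = H k *v (H i *v w)"
          using HH[of i k] i Suc.prems by (simp add: matrix_vector_mul_assoc)
        thus ?thesis using \<open>w \<in> W\<close> i by (simp add: W_def mat_vec_simps)
      qed
      thus ?thesis by (simp add: W_def)
    qed
    moreover have "v \<in> W" using mv by (simp add: W_def)
    ultimately obtain c w where w: "w \<in> W" "w \<noteq> 0" "H k *v w = c *s w"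
      using mv(1) by (elim eigenvector_in_invariant_subspace) blast+
    show ?case
      by (rule exI[of _ "m(k := c)"], rule exI[of _ w]) (use w in \<open>auto simp: W_def less_Suc_eq\<close>)
  qed
  from this[of 7] show ?thesis by (simp add: weight_vector_def)
qed


text \<open>\<open>coheight\<close> for weights not yet known to be integral. Every raising adds 2,
  so it separates the weights along a chain of raised vectors.\<close>

definition complex_coheight :: "(nat \<Rightarrow> complex) \<Rightarrow> complex" where
  "complex_coheight m = (\<Sum>i<7. of_int ([34, 49, 66, 96, 75, 52, 27] ! i) * m i)"

lemma complex_coheight_root: "j < 7 \<Longrightarrow> complex_coheight (\<lambda>i. m i + of_int (e7_roots ! j ! i)) = complex_coheight m + 2"
proof -
  assume "j < 7"
  moreover have "\<forall>j\<in>set [0..<7]. (\<Sum>i\<leftarrow>[0..<7]. [34, 49, 66, 96, 75, 52, 27] ! i * e7_roots ! j ! i) = 2"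
    by code_simp
  ultimately have "(\<Sum>i<7. [34, 49, 66, 96, 75, 52, 27] ! i * e7_roots ! j ! i) = 2"
    by (simp add: sum_list_distinct_conv_sum_set atLeast0LessThan del: upt_rec_numeral)
  hence "of_int (\<Sum>i<7. [34, 49, 66, 96, 75, 52, 27] ! i * e7_roots ! j ! i) = (2 :: complex)" by (simp only:) simp
  thus ?thesis by (simp add: complex_coheight_def distrib_left sum.distrib)
qed

text \<open>Otherwise raising operators would produce weight vectors for infinitely many weights.\<close>

lemma highest_weight_vector_exists:
  "\<exists>m v. v \<noteq> 0 \<and> weight_vector m v \<and> (\<forall>i<7. E i *v v = 0)"
proof (rule ccontr)
  assume no: "\<not> ?thesis"
  define P where "P = (\<lambda>(n::nat) (m, v). v \<noteq> 0 \<and> weight_vector m v)"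
  define Q where "Q = (\<lambda>(n::nat) (m, v :: complex ^ 'n) (m', v' :: complex ^ 'n). complex_coheight m' = complex_coheight m + 2)"
  have "\<exists>f. \<forall>n. P n (f n) \<and> Q n (f n) (f (Suc n))"
  proof (rule dependent_nat_choice)
    show "\<exists>x. P 0 x" using weight_vector_exists by (auto simp: P_def)
    fix x n assume "P n x"
    then obtain m v where mv: "x = (m, v)" "v \<noteq> 0" "weight_vector m v" by (auto simp: P_def)
    then obtain i where "i < 7" "E i *v v \<noteq> 0" using no by blast
    thus "\<exists>y. P (Suc n) y \<and> Q n x y"
      using weight_vector_E[OF mv(3), of i] complex_coheight_root[of i m] mv
      by (intro exI[of _ "(\<lambda>k. m k + of_int (e7_roots ! i ! k), E i *v v)"]) (simp add: P_def Q_def)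
  qed
  then obtain f where f: "\<And>n. P n (f n)" "\<And>n. Q n (f n) (f (Suc n))" by blast
  have h: "complex_coheight (fst (f n)) = complex_coheight (fst (f 0)) + 2 * of_nat n" for n
    by (induction n) (use f(2) in \<open>auto simp: Q_def case_prod_unfold\<close>)
  have "card {..56::nat} \<le> 56"
  proof (rule card_weight_vectors_le)
    show "weight_vector (fst (f n)) (snd (f n))" "snd (f n) \<noteq> 0" for n
      using f(1)[of n] by (auto simp: P_def case_prod_unfold)
    fix k l :: nat assume "k \<noteq> l"
    hence "complex_coheight (fst (f k)) \<noteq> complex_coheight (fst (f l))" by (subst (1 2) h) simp
    thus "\<exists>i<7. fst (f k) i \<noteq> fst (f l) i" unfolding complex_coheight_def by (metis (no_types, lifting) lessThan_iff sum.cong)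
  qed simp
  thus False by simp
qed

section \<open>Determination of the weights by counting\<close>

definition is_weight :: "int list \<Rightarrow> bool" where
  "is_weight \<mu> \<longleftrightarrow> length \<mu> = 7 \<and> (\<exists>v. v \<noteq> 0 \<and> weight_vector (\<lambda>i. of_int (\<mu> ! i)) v)"

lemma weights_bounded:
  assumes "distinct L" "\<forall>\<mu>\<in>set L. is_weight \<mu>"
  shows "length L \<le> 56"
proof -
  obtain x where x: "\<And>\<mu>. \<mu> \<in> set L \<Longrightarrow> x \<mu> \<noteq> 0 \<and> weight_vector (\<lambda>i. of_int (\<mu> ! i)) (x \<mu>)"
    using assms(2) unfolding is_weight_def by metis
  have "card (set L) \<le> 56"
  proof (rule card_weight_vectors_le[where m = "\<lambda>\<mu> i. of_int (\<mu> ! i)" and x = x])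
    fix k l assume "k \<in> set L" "l \<in> set L" "k \<noteq> l"
    hence "length k = 7" "length l = 7" "k \<noteq> l" using assms(2) by (auto simp: is_weight_def)
    thus "\<exists>i<7. of_int (k ! i) \<noteq> (of_int (l ! i) :: complex)" by (auto simp: list_eq_iff_nth_eq)
  qed (use x in auto)
  thus ?thesis using assms(1) by (simp add: distinct_card)
qed

lemma weight_vector_cong: "(\<And>i. i < 7 \<Longrightarrow> m i = m' i) \<Longrightarrow> weight_vector m v \<longleftrightarrow> weight_vector m' v"
  by (simp add: weight_vector_def)

lemma weight_vector_lower:
  assumes "length \<mu> = 7" "weight_vector (\<lambda>i. of_int (\<mu> ! i)) v" "j < 7"
  shows "weight_vector (\<lambda>i. of_int (wminus \<mu> (e7_roots ! j) ! i)) (F j *v v)"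
  using weight_vector_F[OF assms(2,3)]
  by (rule back_subst[of "\<lambda>b. b"]) (intro weight_vector_cong, simp add: wminus_nth assms e7_roots_length)

lemma is_weight_lower:
  assumes "is_weight \<mu>" "j < 7" "0 < \<mu> ! j"
  shows "is_weight (wminus \<mu> (e7_roots ! j))"
proof -
  obtain v where v: "length \<mu> = 7" "v \<noteq> 0" "weight_vector (\<lambda>i. of_int (\<mu> ! i)) v"
    using assms by (auto simp: is_weight_def)
  have "F j *v v \<noteq> 0" by (rule F_nonzero[OF assms(2) v(3,2)]) (use assms in simp)
  thus ?thesis using weight_vector_lower[OF v(1,3) assms(2)] v(1) assms(2)
    by (auto simp: is_weight_def length_wminus e7_roots_length)
qed

text \<open>The dominant shift \<delta> only increases coroot values, so a descent from \<mu> is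
  also one from \<delta> + \<mu>. One computation thus serves every highest weight that dominates
  the starting weight.\<close>

lemma is_weight_descents:
  assumes "length \<delta> = 7" "\<forall>i<7. 0 \<le> \<delta> ! i"
    and "\<forall>\<mu>\<in>set S. length \<mu> = 7 \<and> is_weight (wplus \<delta> \<mu>)"
  shows "\<forall>\<mu>\<in>set (descents n S). length \<mu> = 7 \<and> is_weight (wplus \<delta> \<mu>)"
  using assms(3)
proof (induction n arbitrary: S)
  case (Suc n)
  have "\<forall>\<mu>\<in>set (descend S). length \<mu> = 7 \<and> is_weight (wplus \<delta> \<mu>)"
  proof
    fix \<nu> assume "\<nu> \<in> set (descend S)"
    then obtain \<mu> j where *: "\<mu> \<in> set S" "j < 7" "0 < \<mu> ! j" "\<nu> = wminus \<mu> (e7_roots ! j)"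
      by (auto simp: descend_def)
    have l: "length \<mu> = 7" using Suc.prems * by auto
    have "is_weight (wminus (wplus \<delta> \<mu>) (e7_roots ! j))"
      using is_weight_lower[of "wplus \<delta> \<mu>" j] * Suc.prems assms(1,2) by (force simp: wplus_nth)
    moreover have "wminus (wplus \<delta> \<mu>) (e7_roots ! j) = wplus \<delta> \<nu>"
      using l assms(1) e7_roots_length[OF *(2)] unfolding *(4)
      by (intro nth_equalityI) (simp_all add: wplus_def wminus_def)
    ultimately show "length \<nu> = 7 \<and> is_weight (wplus \<delta> \<nu>)"
      using l * by (simp add: length_wminus e7_roots_length)
  qed
  from Suc.IH[OF this] show ?case using Suc.prems by auto
qed simp

lemma weights_bounded_descents:
  assumes "length \<delta> = 7" "\<forall>i<7. 0 \<le> \<delta> ! i" "length s = 7" "is_weight (wplus \<delta> s)"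
    and "distinct (descents n [s])"
  shows "length (descents n [s]) \<le> 56"
proof -
  have *: "\<forall>\<mu>\<in>set (descents n [s]). length \<mu> = 7 \<and> is_weight (wplus \<delta> \<mu>)"
    by (rule is_weight_descents[OF assms(1,2)]) (use assms in auto)
  have "inj_on (wplus \<delta>) (set (descents n [s]))"
  proof (rule inj_onI)
    fix x y assume xy: "x \<in> set (descents n [s])" "y \<in> set (descents n [s])" "wplus \<delta> x = wplus \<delta> y"
    hence l: "length x = 7" "length y = 7" using * by auto
    have "x ! i = y ! i" if "i < 7" for i
      using arg_cong[OF xy(3), of "\<lambda>z. z ! i"] l assms(1) that by (simp add: wplus_nth)
    thus "x = y" using l by (intro nth_equalityI) auto
  qed
  with assms(5) have "distinct (map (wplus \<delta>) (descents n [s]))" by (simp add: distinct_map)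
  from weights_bounded[OF this] show ?thesis using * by simp
qed

lemma dominant_below:
  assumes "is_weight t" "\<forall>i<7. s ! i \<le> t ! i" "length s = 7" "distinct (descents n [s])"
  shows "length (descents n [s]) \<le> 56"
proof (rule weights_bounded_descents)
  have l: "length t = 7" using assms(1) by (simp add: is_weight_def)
  show "length (wminus t s) = 7" using l assms by (simp add: length_wminus)
  show "\<forall>i<7. 0 \<le> wminus t s ! i" using l assms by (simp add: wminus_nth)
  have "wplus (wminus t s) s = t"
    using l assms by (intro nth_equalityI) (simp_all add: wplus_def wminus_def)
  thus "is_weight (wplus (wminus t s) s)" using assms by simp
qed fact+

text \<open>Dominance and the counts leave only 0 and the last fundamental weight, and a highest
  weight vector of weight 0 would span a one-dimensional submodule.\<close>

lemma highest_weight: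
  "\<exists>v. v \<noteq> 0 \<and> weight_vector (\<lambda>i. of_int (fundamental_weight 6 ! i)) v"
proof -
  obtain m v where mv: "v \<noteq> 0" "weight_vector m v" "\<And>i. i < 7 \<Longrightarrow> E i *v v = 0"
    using highest_weight_vector_exists by blast
  have "\<exists>n. m i = of_nat n" if "i < 7" for i
    by (rule highest_weight_integral[OF that mv(2,1) mv(3)[OF that]])
  then obtain n where n: "\<And>i. i < 7 \<Longrightarrow> m i = of_nat (n i)" by metis
  define t where "t = map (\<lambda>i. int (n i)) [0..<7]"
  have l: "length t = 7" and nth: "\<And>i. i < 7 \<Longrightarrow> t ! i = int (n i)" by (simp_all add: t_def)
  have wv: "weight_vector (\<lambda>i. of_int (t ! i)) v"
    using mv(2) n nth by (simp add: weight_vector_def)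
  hence wt: "is_weight t" using mv(1) l by (auto simp: is_weight_def)
  have 1: "n i = 0" if "i < 6" for i
  proof (rule ccontr)
    assume "n i \<noteq> 0"
    have "fundamental_weight i ! k \<le> t ! k" if "k < 7" for k
      using that \<open>n i \<noteq> 0\<close> by (cases "k = i") (auto simp: fundamental_weight_def nth)
    hence le: "\<forall>k<7. fundamental_weight i ! k \<le> t ! k" and len: "length (fundamental_weight i) = 7"
      by (simp_all add: fundamental_weight_def)
    have "i \<in> set [0..<6]" using that by simp
    with many_weights(1) show False using dominant_below[OF wt le len] by (meson not_le)
  qed
  have 2: "n 6 \<le> 1"
  proof (rule ccontr)
    assume "\<not> n 6 \<le> 1"
    hence le: "\<forall>k<7. wplus (fundamental_weight 6) (fundamental_weight 6) ! k \<le> t ! k"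
      and len: "length (wplus (fundamental_weight 6) (fundamental_weight 6)) = 7"
      by (auto simp: fundamental_weight_def nth nth_list_update wplus_nth length_wplus)
    with many_weights(2) show False using dominant_below[OF wt le len] by (meson not_le)
  qed
  have 3: "n 6 \<noteq> 0"
  proof
    assume "n 6 = 0"
    have m0: "m i = 0" if "i < 7" for i
      using 1[of i] \<open>n 6 = 0\<close> n[of i] that by (cases "i = 6") auto
    \<comment> \<open>Otherwise this vector would have the value -2 at coroot i, so
      \<open>E i\<close> could not kill it; but \<open>E i\<close> maps it to
      \<open>H i *v v\<close>, which is 0.\<close>
    have F0: "F i *v v = 0" if i: "i < 7" for i
    proof (rule ccontr)
      assume "F i *v v \<noteq> 0"
      hence "E i *v (F i *v v) \<noteq> 0"
        using weight_vector_F[OF mv(2) i] i m0 by (intro E_nonzero) (auto simp: e7_roots_diag)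
      moreover have "E i *v (F i *v v) = 0"
        using EF_apply[OF i i, of v] mv(2,3) i m0 by (simp add: weight_vector_def mat_vec_simps)
      ultimately show False by simp
    qed
    have "vec.span {v} = {0} \<or> vec.span {v} = UNIV"
    proof (rule irreducible)
      fix i :: nat and w assume i: "i < 7" and "w \<in> vec.span {v}"
      then obtain c where "w = c *s v" by (auto simp: vec.span_singleton)
      thus "E i *v w \<in> vec.span {v} \<and> F i *v w \<in> vec.span {v} \<and> H i *v w \<in> vec.span {v}"
        using i mv(2,3) F0 m0 by (simp add: mat_vec_simps weight_vector_def vec.span_zero)
    qed simp
    moreover have "vec.span {v} \<noteq> {0}" using mv(1) vec.span_base[of v "{v}"] by auto
    ultimately have "vec.dim (vec.span {v}) = vec.dim (UNIV :: (complex ^ 'n) set)" by simp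
    moreover have "vec.dim (vec.span {v}) \<le> card {v}" by (simp only: vec.dim_span) (rule vec.dim_le_card', simp)
    ultimately show False using card by (simp add: card_cart_basis)
  qed
  have "t = fundamental_weight 6"
  proof (rule nth_equalityI)
    fix i assume "i < length t"
    thus "t ! i = fundamental_weight 6 ! i"
      using 1[of i] 2 3 l by (cases "i = 6") (auto simp: nth fundamental_weight_def nth_list_update)
  qed (simp add: l fundamental_weight_def)
  thus ?thesis using wv mv(1) by blast
qed


text \<open>The 56 listed weights are reached by descent from the highest one, and any further
  weight would be a 57th.\<close>

lemma is_weight_iff: "is_weight \<mu> \<longleftrightarrow> \<mu> \<in> set e7_weights"
proof
  have l: "\<forall>\<mu>\<in>set e7_weights. is_weight \<mu>"
  proof -
    obtain \<delta> :: "int list" where \<delta>: "\<delta> = replicate 7 0" by blast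
    have len: "length (fundamental_weight 6) = 7" by (simp add: fundamental_weight_def)
    have *: "wplus \<delta> \<mu> = \<mu>" if "length \<mu> = 7" for \<mu>
      using that \<delta> by (intro nth_equalityI) (simp_all add: wplus_def)
    have "is_weight (wplus \<delta> (fundamental_weight 6))"
      using highest_weight len by (simp add: is_weight_def *)
    hence "\<forall>\<mu>\<in>set (descents 27 [fundamental_weight 6]). length \<mu> = 7 \<and> is_weight (wplus \<delta> \<mu>)"
      using \<delta> len by (intro is_weight_descents) auto
    thus ?thesis unfolding e7_weights_eq using * by metis
  qed
  show "\<mu> \<in> set e7_weights \<Longrightarrow> is_weight \<mu>" using l by blast
  assume \<mu>: "is_weight \<mu>"
  show "\<mu> \<in> set e7_weights"
  proof (rule ccontr)
    assume "\<mu> \<notin> set e7_weights"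
    hence "length (\<mu> # e7_weights) \<le> 56"
      using l \<mu> e7_weights_distinct by (intro weights_bounded) auto
    thus False by (simp add: length_e7_weights)
  qed
qed

lemma non_weight_zero:
  assumes "length \<mu> = 7" "weight_vector (\<lambda>i. of_int (\<mu> ! i)) v" "\<mu> \<notin> set e7_weights"
  shows "v = 0"
  using assms is_weight_iff[of \<mu>] by (auto simp: is_weight_def)

end

lemma e7_weightD:
  assumes "\<mu> \<in> set e7_weights"
  shows "length \<mu> = 7" "map uminus \<mu> \<in> set e7_weights" "depth \<mu> \<le> 27"
    and "\<mu> \<noteq> fundamental_weight 6 \<Longrightarrow> \<exists>i<7. \<mu> ! i = -1"
    and "i < 7 \<Longrightarrow> \<mu> ! i = -1 \<or> \<mu> ! i = 0 \<or> \<mu> ! i = 1"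
    and "i < 7 \<Longrightarrow> \<mu> ! i = -1 \<Longrightarrow> depth \<mu> = Suc (depth (wplus \<mu> (e7_roots ! i)))"
    and "i < 7 \<Longrightarrow> \<mu> ! i = -1 \<Longrightarrow> wplus \<mu> (e7_roots ! i) \<in> set e7_weights"
    and "i < 7 \<Longrightarrow> j < 7 \<Longrightarrow> \<mu> ! i = -1 \<Longrightarrow> \<mu> ! j = -1 \<Longrightarrow> i \<noteq> j \<Longrightarrow> e7_roots ! i ! j = 0"
  using bspec[OF e7_weights_check assms] bspec[OF e7_weights_raise_check assms] by auto

text \<open>Follows from the computed case of raising, since the weights are symmetric under
  negation.\<close>

lemma e7_weight_lower:
  assumes "\<mu> \<in> set e7_weights" "i < 7" "\<mu> ! i = 1"
  shows "wminus \<mu> (e7_roots ! i) \<in> set e7_weights"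
proof -
  have l: "length \<mu> = 7" "length (e7_roots ! i) = 7" using assms e7_weightD e7_roots_length by auto
  have "wplus (map uminus \<mu>) (e7_roots ! i) \<in> set e7_weights"
    using e7_weightD(2)[OF assms(1)] assms(2,3) l by (intro e7_weightD(7)) auto
  hence "map uminus (wplus (map uminus \<mu>) (e7_roots ! i)) \<in> set e7_weights" by (rule e7_weightD(2))
  also have "map uminus (wplus (map uminus \<mu>) (e7_roots ! i)) = wminus \<mu> (e7_roots ! i)"
    using l by (intro nth_equalityI) (auto simp: wplus_def wminus_def)
  finally show ?thesis .
qed

lemma depth_lower:
  assumes "\<mu> \<in> set e7_weights" "i < 7" "\<mu> ! i = 1"
  shows "depth (wminus \<mu> (e7_roots ! i)) = Suc (depth \<mu>)"
  using e7_weightD(6)[OF e7_weight_lower[OF assms] assms(2)] assms e7_weightD(1)[OF assms(1)]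
  by (simp add: wminus_def e7_roots_length e7_roots_diag wplus_wminus_cancel[unfolded wminus_def])

text \<open>
  The minuscule module is rigid: two simple lowering operators that are both applicable commute,
  so the products of lowering operators from the highest weight vector depend only on the weight.
\<close>

primrec lowered :: "(nat \<Rightarrow> complex ^ 'n ^ 'n) \<Rightarrow> complex ^ 'n \<Rightarrow> nat \<Rightarrow> int list \<Rightarrow> complex ^ 'n" where
  "lowered F u 0 \<mu> = u"
| "lowered F u (Suc k) \<mu> =
     (let i = (SOME i. i < 7 \<and> \<mu> ! i = -1) in F i *v lowered F u k (wplus \<mu> (e7_roots ! i)))"

context e7_triples
begin

text \<open>Consistency by induction on the depth: if a weight can be reached by lowering at i and
  at j, the two roots are orthogonal, both ways start from the weight raised at i and at j, and
  \<open>F i\<close> and \<open>F j\<close> commute.\<close>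

lemma minuscule_basis:
  "\<exists>v. \<forall>\<mu>\<in>set e7_weights. v \<mu> \<noteq> 0 \<and> (\<forall>i<7. H i *v v \<mu> = of_int (\<mu> ! i) *s v \<mu> \<and>
      F i *v v \<mu> = (if \<mu> ! i = 1 then v (wminus \<mu> (e7_roots ! i)) else 0))"
proof -
  obtain u where u: "u \<noteq> 0" "weight_vector (\<lambda>i. of_int (fundamental_weight 6 ! i)) u"
    using highest_weight by blast
  define v where "v \<mu> = lowered F u (depth \<mu>) \<mu>" for \<mu>
  have d0: "depth (fundamental_weight 6) = 0" by code_simp
  have main: "weight_vector (\<lambda>i. of_int (\<mu> ! i)) (v \<mu>) \<and> v \<mu> \<noteq> 0 \<and>
      (\<forall>i<7. \<mu> ! i = -1 \<longrightarrow> v \<mu> = F i *v v (wplus \<mu> (e7_roots ! i)))"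
    if "\<mu> \<in> set e7_weights" for \<mu>
    using that
  proof (induction "depth \<mu>" arbitrary: \<mu> rule: less_induct)
    case less
    show ?case
    proof (cases "\<mu> = fundamental_weight 6")
      case True
      thus ?thesis using u d0 by (auto simp: v_def fundamental_weight_def nth_list_update split: if_splits)
    next
      case False
      define j where "j = (SOME i. i < 7 \<and> \<mu> ! i = -1)"
      have j: "j < 7" "\<mu> ! j = -1"
        using someI_ex[of "\<lambda>i. i < 7 \<and> \<mu> ! i = -1"] e7_weightD(4)[OF less.prems False] by (auto simp: j_def)
      have len: "length \<mu> = 7" using e7_weightD(1)[OF less.prems] .
      let ?up = "\<lambda>\<mu> i. wplus \<mu> (e7_roots ! i)"
      have IH: "weight_vector (\<lambda>k. of_int (?up \<mu> i ! k)) (v (?up \<mu> i)) \<and> v (?up \<mu> i) \<noteq> 0 \<and>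
          (\<forall>k<7. ?up \<mu> i ! k = -1 \<longrightarrow> v (?up \<mu> i) = F k *v v (?up (?up \<mu> i) k))"
        if "i < 7" "\<mu> ! i = -1" for i
        using less.hyps[of "?up \<mu> i"] e7_weightD(6,7)[OF less.prems that] by simp
      have vj: "v \<mu> = F j *v v (?up \<mu> j)"
        unfolding v_def e7_weightD(6)[OF less.prems j] by (simp add: Let_def j_def[symmetric])
      have nthj: "?up \<mu> j ! j = 1" using j len by (simp add: wplus_nth e7_roots_length e7_roots_diag)
      have "v \<mu> \<noteq> 0" unfolding vj
        by (rule F_nonzero[OF j(1), of "\<lambda>k. of_int (?up \<mu> j ! k)"]) (use IH[OF j] nthj in auto)
      moreover have "weight_vector (\<lambda>i. of_int (\<mu> ! i)) (v \<mu>)"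
        using weight_vector_lower[of "?up \<mu> j" "v (?up \<mu> j)" j] IH[OF j] j len
        by (simp add: vj length_wplus e7_roots_length wminus_wplus_cancel)
      moreover have "v \<mu> = F i *v v (?up \<mu> i)" if i: "i < 7" "\<mu> ! i = -1" for i
      proof (cases "i = j")
        case False
        have r: "e7_roots ! i ! j = 0" "e7_roots ! j ! i = 0"
          using e7_weightD(8)[OF less.prems] i j False by auto
        have n: "?up \<mu> j ! i = -1" "?up \<mu> i ! j = -1"
          using i j len r by (simp_all add: wplus_nth e7_roots_length)
        have c: "?up (?up \<mu> i) j = ?up (?up \<mu> j) i"
          using i j len by (intro nth_equalityI) (auto simp: wplus_def e7_roots_length)
        have "v \<mu> = F j *v (F i *v v (?up (?up \<mu> j) i))" using vj IH[OF j] n i by simp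
        also have "\<dots> = F i *v (F j *v v (?up (?up \<mu> i) j))" using FF_apply[of i j] i j False r c by simp
        also have "\<dots> = F i *v v (?up \<mu> i)" using IH[OF i] n j by simp
        finally show ?thesis .
      qed (use vj in simp)
      ultimately show ?thesis by blast
    qed
  qed
  show ?thesis
  proof (rule exI[of _ v], intro ballI conjI allI impI)
    fix \<mu> i assume \<mu>: "\<mu> \<in> set e7_weights" and i: "i < (7::nat)"
    have len: "length \<mu> = 7" using e7_weightD(1)[OF \<mu>] .
    show "H i *v v \<mu> = of_int (\<mu> ! i) *s v \<mu>" using main[OF \<mu>] i by (simp add: weight_vector_def)
    show "F i *v v \<mu> = (if \<mu> ! i = 1 then v (wminus \<mu> (e7_roots ! i)) else 0)"
    proof (cases "\<mu> ! i = 1")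
      case True
      have "wminus \<mu> (e7_roots ! i) ! i = -1" using True i len by (simp add: wminus_nth e7_roots_length e7_roots_diag)
      thus ?thesis using main[OF e7_weight_lower[OF \<mu> i True]] i True len
        by (simp add: wplus_wminus_cancel e7_roots_length)
    next
      case False
      \<comment> \<open>Its weight would take a value below -1 at coroot i, which no weight of the
        module does.\<close>
      have "F i *v v \<mu> = 0"
      proof (rule non_weight_zero)
        show "length (wminus \<mu> (e7_roots ! i)) = 7" using len i by (simp add: length_wminus e7_roots_length)
        show "weight_vector (\<lambda>k. of_int (wminus \<mu> (e7_roots ! i) ! k)) (F i *v v \<mu>)"
          using main[OF \<mu>] i len by (intro weight_vector_lower) auto
        have "wminus \<mu> (e7_roots ! i) ! i < -1"
          using False e7_weightD(5)[OF \<mu> i] len i by (auto simp: wminus_nth e7_roots_length e7_roots_diag)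
        thus "wminus \<mu> (e7_roots ! i) \<notin> set e7_weights" using e7_weightD(5)[of "wminus \<mu> (e7_roots ! i)" i] i by auto
      qed
      thus ?thesis using False by simp
    qed
  qed (use main in blast)
qed


text \<open>Together with x, which has the index \<open>None\<close>, there are 57 vectors in
  dimension 56. In a relation between them the coefficient of x is nonzero, because the weight
  vectors are independent.\<close>

lemma minuscule_basis_spans:
  assumes v: "\<And>\<mu>. \<mu> \<in> set e7_weights \<Longrightarrow> v \<mu> \<noteq> 0"
    and H: "\<And>\<mu> i. \<mu> \<in> set e7_weights \<Longrightarrow> i < 7 \<Longrightarrow> H i *v v \<mu> = of_int (\<mu> ! i) *s v \<mu>"
  shows "\<exists>c. x = (\<Sum>\<mu>\<in>set e7_weights. c \<mu> *s v \<mu>)"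
proof -
  define I where "I = insert None (Some ` set e7_weights)"
  define y where "y k = (case k of None \<Rightarrow> x | Some \<mu> \<Rightarrow> v \<mu>)" for k
  have sum_I: "(\<Sum>k\<in>I. c k *s y k) = c None *s x + (\<Sum>\<mu>\<in>set e7_weights. c (Some \<mu>) *s v \<mu>)" for c
    by (simp add: I_def y_def sum.reindex)
  have "card I = 57"
    by (simp add: I_def card_image distinct_card e7_weights_distinct length_e7_weights)
  then obtain c where c: "\<exists>k\<in>I. c k \<noteq> 0" "(\<Sum>k\<in>I. c k *s y k) = 0"
    using family_dependent[of I y] card by (auto simp: I_def)
  have "c None \<noteq> 0"
  proof
    assume 0: "c None = 0"
    have "c (Some \<mu>) *s v \<mu> = 0" if "\<mu> \<in> set e7_weights" for \<mu>
    proof (rule weight_vectors_independent[where m = "\<lambda>\<mu> i. of_int (\<mu> ! i)" and I = "set e7_weights"])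
      show "weight_vector (\<lambda>i. of_int (\<mu> ! i)) (c (Some \<mu>) *s v \<mu>)" if "\<mu> \<in> set e7_weights" for \<mu>
        using H[OF that] by (simp add: weight_vector_def mat_vec_simps mult.commute)
      show "(\<Sum>\<mu>\<in>set e7_weights. c (Some \<mu>) *s v \<mu>) = 0" using c(2) 0 by (simp add: sum_I)
      fix k l assume "k \<in> set e7_weights" "l \<in> set e7_weights" "k \<noteq> l"
      hence "length k = 7" "length l = 7" "k \<noteq> l" by (auto dest: e7_weightD(1))
      thus "\<exists>i<7. of_int (k ! i) \<noteq> (of_int (l ! i) :: complex)" by (auto simp: list_eq_iff_nth_eq)
    qed (use that in auto)
    thus False using c(1) 0 v by (auto simp: I_def)
  qed
  have "x = inverse (c None) *s (c None *s x)" using \<open>c None \<noteq> 0\<close> by simp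
  also have "c None *s x = - (\<Sum>\<mu>\<in>set e7_weights. c (Some \<mu>) *s v \<mu>)"
    using c(2) unfolding sum_I by (simp add: eq_neg_iff_add_eq_0)
  also have "inverse (c None) *s \<dots> = (\<Sum>\<mu>\<in>set e7_weights. (- inverse (c None) * c (Some \<mu>)) *s v \<mu>)"
    by (simp add: vec.scale_sum_right sum_negf)
  finally show ?thesis by (rule exI[of _ "\<lambda>\<mu>. - inverse (c None) * c (Some \<mu>)"])
qed

end

section \<open>Forms annihilated by the lowering operators\<close>

locale e7_minuscule =
  fixes F H :: "nat \<Rightarrow> complex ^ 'n ^ 'n" and v :: "int list \<Rightarrow> complex ^ 'n"
  assumes v_nonzero: "\<mu> \<in> set e7_weights \<Longrightarrow> v \<mu> \<noteq> 0"
    and H_v: "\<mu> \<in> set e7_weights \<Longrightarrow> i < 7 \<Longrightarrow> H i *v v \<mu> = of_int (\<mu> ! i) *s v \<mu>"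
    and F_v: "\<mu> \<in> set e7_weights \<Longrightarrow> i < 7 \<Longrightarrow>
      F i *v v \<mu> = (if \<mu> ! i = 1 then v (wminus \<mu> (e7_roots ! i)) else 0)"
    and v_spans: "\<exists>c. x = (\<Sum>\<mu>\<in>set e7_weights. c \<mu> *s v \<mu>)"

definition multilinear :: "nat \<Rightarrow> ((nat \<Rightarrow> complex ^ 'n) \<Rightarrow> complex) \<Rightarrow> bool" where
  "multilinear k G \<longleftrightarrow> (\<forall>i\<in>{1..k}. \<forall>w. linear_form (\<lambda>x. G (w(i := x))))"

text \<open>Up to sign the infinitesimal action of A on k-linear forms, so that invariance means
  that it vanishes.\<close>

definition derivation :: "nat \<Rightarrow> complex ^ 'n ^ 'n \<Rightarrow> ((nat \<Rightarrow> complex ^ 'n) \<Rightarrow> complex) \<Rightarrow> (nat \<Rightarrow> complex ^ 'n) \<Rightarrow> complex" where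
  "derivation k A G w = (\<Sum>j\<in>{1..k}. G (w(j := A *v w j)))"

lemma linear_form_zero: "linear_form \<phi> \<Longrightarrow> \<phi> 0 = 0"
  by (metis linear_form_iff mult_zero_left vec.scale_zero_left)

lemma linear_form_sum: "linear_form \<phi> \<Longrightarrow> \<phi> (\<Sum>k\<in>I. c k *s x k) = (\<Sum>k\<in>I. c k * \<phi> (x k))"
  by (induction I rule: infinite_finite_induct) (auto simp: linear_form_zero linear_form_iff)

lemma multilinear_zero: "multilinear k G \<Longrightarrow> j \<in> {1..k} \<Longrightarrow> G (w(j := 0)) = 0"
  using linear_form_zero[of "\<lambda>x. G (w(j := x))"] by (simp add: multilinear_def)

lemma multilinear_scale: "multilinear k G \<Longrightarrow> j \<in> {1..k} \<Longrightarrow> G (w(j := c *s x)) = c * G (w(j := x))"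
  unfolding multilinear_def linear_form_iff by blast

text \<open>
  As for \<open>sl\<^sub>2\<close> acting on the functions on the subsets of \<open>P\<close>: if \<open>f\<close> kills \<open>g\<close>, then \<open>f\<close> maps
  the \<open>(j + 1)\<close>-st raising of \<open>g\<close> to a multiple of the \<open>j\<close>-th, and the factor does not vanish below
  the middle cardinality. On the empty set \<open>f\<close> gives \<open>0\<close>, whence the claim by descent.
\<close>

lemma set_lowering_injective:
  fixes g :: "'a set \<Rightarrow> complex"
  assumes P: "finite P" and g: "\<And>T. T \<subseteq> P \<Longrightarrow> (\<Sum>s\<in>T. g (T - {s})) = 0"
    and S: "S \<subseteq> P" "2 * card S < card P"
  shows "g S = 0"
proof -
  define e where "e = (\<lambda>(g :: 'a set \<Rightarrow> complex) R. \<Sum>s\<in>P - R. g (insert s R))"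
  define f where "f = (\<lambda>(g :: 'a set \<Rightarrow> complex) T. \<Sum>s\<in>T. g (T - {s}))"
  define r where "r = (of_nat (card P) :: complex)"
  have e_apply: "e g R = (\<Sum>s\<in>P - R. g (insert s R))" for g R by (simp add: e_def)
  have fin: "finite S" if "S \<subseteq> P" for S using that P finite_subset by blast
  \<comment> \<open>Here \<open>e\<close> sums over the sets with one element more and
    \<open>f\<close> over those with one less. As in \<open>sl\<^sub>2\<close>, their commutator
    multiplies the value at S by card P - 2 card S.\<close>
  have comm: "f (e g) S = e (f g) S - (r - 2 * of_nat (card S)) * g S" if S: "S \<subseteq> P" for g S
  proof -
    let ?X = "\<Sum>s\<in>P - S. \<Sum>u\<in>S. g (insert s (S - {u}))"
    have "e (f g) S = (\<Sum>s\<in>P - S. g S + (\<Sum>u\<in>S. g (insert s (S - {u}))))"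
      unfolding e_def f_def
    proof (intro sum.cong refl)
      fix s assume s: "s \<in> P - S"
      hence "(\<Sum>u\<in>insert s S. g (insert s S - {u})) = g (insert s S - {s}) + (\<Sum>u\<in>S. g (insert s S - {u}))"
        using fin[OF S] by (subst sum.insert) auto
      also have "insert s S - {s} = S" using s by auto
      also have "(\<Sum>u\<in>S. g (insert s S - {u})) = (\<Sum>u\<in>S. g (insert s (S - {u})))"
        using s by (intro sum.cong refl arg_cong[of _ _ g]) auto
      finally show "(\<Sum>u\<in>insert s S. g (insert s S - {u})) = g S + (\<Sum>u\<in>S. g (insert s (S - {u})))" .
    qed
    hence 1: "e (f g) S = of_nat (card (P - S)) * g S + ?X" by (simp add: sum.distrib)
    have "f (e g) S = (\<Sum>u\<in>S. g S + (\<Sum>s\<in>P - S. g (insert s (S - {u}))))"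
      unfolding e_def f_def
    proof (intro sum.cong refl)
      fix u assume u: "u \<in> S"
      hence "P - (S - {u}) = insert u (P - S)" using S by auto
      thus "(\<Sum>s\<in>P - (S - {u}). g (insert s (S - {u}))) = g S + (\<Sum>s\<in>P - S. g (insert s (S - {u})))"
        using u P by (simp add: insert_absorb)
    qed
    also have "\<dots> = of_nat (card S) * g S + ?X" by (simp add: sum.distrib) (rule sum.swap)
    finally have 2: "f (e g) S = of_nat (card S) * g S + ?X" .
    have "card P = card S + card (P - S)"
      using S P fin[OF S] card_mono[OF P S] by (simp add: card_Diff_subset)
    hence "r = of_nat (card S) + of_nat (card (P - S))" by (simp add: r_def)
    thus ?thesis unfolding 1 2 by (simp add: algebra_simps)
  qed
  have step: "f ((e ^^ Suc j) g) S = - of_nat (Suc j) * (r - 2 * of_nat (card S) - of_nat j) * (e ^^ j) g S"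
    if "S \<subseteq> P" for j S
    using that
  proof (induction j arbitrary: S)
    case 0
    have "e (f g) S = 0" unfolding e_def f_def by (rule sum.neutral, intro ballI g) (use 0 in auto)
    thus ?case using comm[OF 0, of g] by (simp add: algebra_simps)
  next
    case (Suc j)
    have "e (f ((e ^^ Suc j) g)) S
        = (\<Sum>s\<in>P - S. - of_nat (Suc j) * (r - 2 * of_nat (Suc (card S)) - of_nat j) * (e ^^ j) g (insert s S))"
      unfolding e_apply[of "f ((e ^^ Suc j) g)" S]
      using Suc.prems fin[OF Suc.prems] by (intro sum.cong refl) (subst Suc.IH, auto)
    also have "\<dots> = - of_nat (Suc j) * (r - 2 * of_nat (Suc (card S)) - of_nat j) * (e ^^ Suc j) g S"
      by (simp only: funpow.simps comp_apply e_apply[of "(e ^^ j) g" S] sum_distrib_left)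
    finally have *: "e (f ((e ^^ Suc j) g)) S
        = - of_nat (Suc j) * (r - 2 * of_nat (Suc (card S)) - of_nat j) * (e ^^ Suc j) g S" .
    show ?case using comm[OF Suc.prems, of "(e ^^ Suc j) g"] unfolding *
      by (simp add: algebra_simps)
  qed
  have "(e ^^ j) g T = 0" if "T \<subseteq> P" "card T + j = card S" for T j
    using that
  proof (induction "card T" arbitrary: T j rule: less_induct)
    case less
    have "(e ^^ Suc j) g (T - {u}) = 0" if u: "u \<in> T" for u
    proof (rule less.hyps)
      show "card (T - {u}) < card T" using u fin[OF less.prems(1)] by (intro card_Diff1_less) auto
      thus "card (T - {u}) + Suc j = card S" using u fin[OF less.prems(1)] less.prems(2) by simp
    qed (use less.prems in auto)
    hence "f ((e ^^ Suc j) g) T = 0" unfolding f_def by (intro sum.neutral ballI) blast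
    hence "- of_nat (Suc j) * (r - 2 * of_nat (card T) - of_nat j) * (e ^^ j) g T = 0"
      using step[OF less.prems(1), of j] by (simp only:)
    moreover have "r - 2 * of_nat (card T) - of_nat j \<noteq> 0"
    proof
      assume "r - 2 * of_nat (card T) - of_nat j = 0"
      hence "of_nat (card P) = (of_nat (2 * card T + j) :: complex)" by (simp add: r_def algebra_simps)
      hence "card P = 2 * card T + j" by (simp only: of_nat_eq_iff)
      thus False using S(2) less.prems(2) by simp
    qed
    ultimately show ?case by (simp del: of_nat_Suc)
  qed
  from this[of S 0] S show ?thesis by simp
qed

context e7_minuscule
begin

text \<open>At the simple root i, arguments of value 0 are killed by \<open>F i\<close> and the
  others lie in doublets. Letting the positions in a subset T be up and the rest down makes G a
  function of T to which \<open>set_lowering_injective\<close> applies; a negative total says that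
  fewer than half of the doublets are up.\<close>

lemma lowering_invariant_negative:
  assumes G: "multilinear k G" and inv: "\<And>w. derivation k (F i) G w = 0" and i: "i < 7"
    and p: "\<And>j. j \<in> {1..k} \<Longrightarrow> p j \<in> set e7_weights" and w: "\<And>j. j \<in> {1..k} \<Longrightarrow> w j = v (p j)"
    and neg: "(\<Sum>j\<in>{1..k}. p j ! i) < 0"
  shows "G w = 0"
proof -
  define P where "P = {j\<in>{1..k}. p j ! i \<noteq> 0}"
  define S where "S = {j\<in>{1..k}. p j ! i = 1}"
  define up where "up j = (if p j ! i = 1 then p j else wplus (p j) (e7_roots ! i))" for j
  define dn where "dn j = (if p j ! i = 1 then wminus (p j) (e7_roots ! i) else p j)" for j
  \<comment> \<open>The upper vector of each doublet at the positions in T, the lower one at the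
    remaining positions of P; \<open>W S\<close> is the given w.\<close>
  define W where "W T j = (if j \<in> P then (if j \<in> T then v (up j) else v (dn j)) else w j)" for T j
  have fin: "finite P" "finite S" "S \<subseteq> P" by (auto simp: P_def S_def)
  have pm: "p j ! i = -1" if "j \<in> {1..k}" "p j ! i \<noteq> 0" "p j ! i \<noteq> 1" for j
    using e7_weightD(5)[OF p[OF that(1)] i] that by auto
  have up: "up j \<in> set e7_weights" "up j ! i = 1" "wminus (up j) (e7_roots ! i) = dn j" if "j \<in> P" for j
    using that p[of j] pm[of j] e7_weightD(1,7)[OF p[of j]] i
    by (auto simp: P_def up_def dn_def wplus_def e7_roots_length e7_roots_diag wminus_wplus_cancel[unfolded wplus_def])
  have dn: "dn j \<in> set e7_weights" "dn j ! i = -1" if "j \<in> P" for j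
    using that p[of j] pm[of j] e7_weight_lower[OF p[of j]] e7_weightD(1)[OF p[of j]] i
    by (auto simp: P_def dn_def wminus_def e7_roots_length e7_roots_diag)
  have "G (W S) = 0"
  proof (rule set_lowering_injective[OF fin(1) _ fin(3)])
    show "(\<Sum>s\<in>T. G (W (T - {s}))) = 0" if T: "T \<subseteq> P" for T
    proof -
      have "G ((W T)(j := F i *v W T j)) = (if j \<in> T then G (W (T - {j})) else 0)" if j: "j \<in> {1..k}" for j
      proof (cases "j \<in> T")
        case True
        hence "F i *v W T j = v (dn j)" using T up F_v[of "up j" i] i by (auto simp: W_def)
        hence "(W T)(j := F i *v W T j) = W (T - {j})" using True T by (auto simp: W_def fun_eq_iff)
        thus ?thesis using True by simp
      next
        case False
        have "F i *v W T j = 0"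
        proof (cases "j \<in> P")
          case True
          thus ?thesis using False dn F_v[of "dn j" i] i by (simp add: W_def)
        next
          case False
          hence "p j ! i = 0" using j by (simp add: P_def)
          thus ?thesis using False w[OF j] p[OF j] F_v[of "p j" i] i by (simp add: W_def)
        qed
        thus ?thesis using False multilinear_zero[OF G j] by simp
      qed
      hence "derivation k (F i) G (W T) = (\<Sum>j\<in>{1..k}. if j \<in> T then G (W (T - {j})) else 0)"
        unfolding derivation_def by (intro sum.cong refl) blast
      also have "\<dots> = (\<Sum>j\<in>T. G (W (T - {j})))"
        using T by (intro sum.mono_neutral_cong_right) (auto simp: P_def)
      finally show ?thesis using inv by simp
    qed
    have "(\<Sum>j\<in>{1..k}. p j ! i) = (\<Sum>j\<in>P. p j ! i)"
      by (intro sum.mono_neutral_right) (auto simp: P_def)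
    also have "\<dots> = (\<Sum>j\<in>P. 2 * of_bool (j \<in> S) - 1)"
      using pm by (intro sum.cong refl) (auto simp: P_def S_def)
    also have "\<dots> = 2 * int (card S) - int (card P)"
      using fin by (simp add: sum_subtractf sum_distrib_left[symmetric] Int_absorb1 of_bool_def sum.If_cases Int_def[symmetric])
    finally show "2 * card S < card P" using neg by linarith
  qed
  also have "W S = w"
  proof
    fix j
    show "W S j = w j" using w[of j] by (auto simp: W_def S_def P_def up_def dn_def)
  qed
  finally show ?thesis .
qed

lemma torus_invariant_nonzero:
  assumes G: "multilinear k G" and inv: "\<And>w. derivation k (H i) G w = 0" and i: "i < 7"
    and p: "\<And>j. j \<in> {1..k} \<Longrightarrow> p j \<in> set e7_weights" and w: "\<And>j. j \<in> {1..k} \<Longrightarrow> w j = v (p j)"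
    and "(\<Sum>j\<in>{1..k}. p j ! i) \<noteq> 0"
  shows "G w = 0"
proof -
  have "derivation k (H i) G w = (\<Sum>j\<in>{1..k}. of_int (p j ! i) * G w)"
    unfolding derivation_def
  proof (intro sum.cong refl)
    fix j assume j: "j \<in> {1..k}"
    have "w(j := H i *v w j) = w(j := of_int (p j ! i) *s w j)" using H_v[OF p[OF j] i] w[OF j] by simp
    thus "G (w(j := H i *v w j)) = of_int (p j ! i) * G w" using multilinear_scale[OF G j] by simp
  qed
  hence "of_int (\<Sum>j\<in>{1..k}. p j ! i) * G w = 0" using inv by (simp add: sum_distrib_right)
  thus ?thesis using assms(6) by (simp del: of_int_sum)
qed

end

section \<open>Dominant paths and closed paths\<close>

definition wtotal :: "int list list \<Rightarrow> int list" where
  "wtotal p = foldr wplus p (replicate 7 0)"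

text \<open>The minuscule case of Littelmann's path model: the paths with a given end point count
  the irreducible constituents of that highest weight in the tensor power.\<close>

primrec dominant_paths :: "nat \<Rightarrow> int list list list" where
  "dominant_paths 0 = [[]]"
| "dominant_paths (Suc n) =
     [p @ [\<mu>]. p \<leftarrow> dominant_paths n, \<mu> \<leftarrow> e7_weights, list_all (\<lambda>x. 0 \<le> x) (wtotal (p @ [\<mu>]))]"

lemma wtotal: "set p \<subseteq> set e7_weights \<Longrightarrow> length (wtotal p) = 7 \<and> (\<forall>i<7. wtotal p ! i = (\<Sum>\<mu>\<leftarrow>p. \<mu> ! i))"
  by (induction p) (auto simp: wtotal_def length_wplus wplus_def e7_weightD(1))

lemma dominant_paths_iff:
  "p \<in> set (dominant_paths n) \<longleftrightarrow> length p = n \<and> set p \<subseteq> set e7_weights \<and>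
     (\<forall>k\<le>n. \<forall>i<7. 0 \<le> (\<Sum>\<mu>\<leftarrow>take k p. \<mu> ! i))"
proof (induction n arbitrary: p)
  case (Suc n)
  have dom: "list_all (\<lambda>x. 0 \<le> x) (wtotal q) \<longleftrightarrow> (\<forall>i<7. 0 \<le> (\<Sum>\<mu>\<leftarrow>q. \<mu> ! i))"
    if "set q \<subseteq> set e7_weights" for q
    using wtotal[OF that] by (simp add: list_all_length)
  show ?case
  proof (cases p rule: rev_cases)
    case (snoc q \<mu>)
    have *: "p \<in> set (dominant_paths (Suc n)) \<longleftrightarrow>
        q \<in> set (dominant_paths n) \<and> \<mu> \<in> set e7_weights \<and> list_all (\<lambda>x. 0 \<le> x) (wtotal p)"
      by (auto simp: snoc)
    show ?thesis unfolding * Suc.IH using dom[of p] snoc by (auto simp: le_Suc_eq)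
  qed auto
qed auto

lemma sum_nth_shift:
  fixes q :: "int list list"
  assumes "length q = n"
  shows "(\<Sum>j\<in>{1..n}. q ! (j - 1) ! i) = (\<Sum>\<mu>\<leftarrow>q. \<mu> ! i)"
proof -
  have "(\<Sum>j\<in>{1..n}. q ! (j - 1) ! i) = (\<Sum>j\<in>{0..<n}. q ! j ! i)"
    by (rule sum.reindex_bij_witness[of _ Suc "\<lambda>j. j - 1"]) auto
  thus ?thesis using assms by (simp add: sum_list_sum_nth)
qed

text \<open>Pairing paths of half the length by their end points keeps the enumeration small and
  exhibits the count as a sum of squares.\<close>

definition closed_paths :: "nat \<Rightarrow> int list list list" where
  "closed_paths m =
     [p @ rev (map (map uminus) q). p \<leftarrow> dominant_paths m, q \<leftarrow> dominant_paths m, wtotal p = wtotal q]"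

text \<open>The second half of a closed path, reversed and negated, is again a dominant path.\<close>

lemma dominant_closed_path:
  assumes p: "p \<in> set (dominant_paths (m + m))" and 0: "\<And>i. i < 7 \<Longrightarrow> (\<Sum>\<mu>\<leftarrow>p. \<mu> ! i) = 0"
  shows "p \<in> set (closed_paths m)"
proof -
  have P: "length p = m + m" "set p \<subseteq> set e7_weights"
    and dom: "\<And>k i. k \<le> m + m \<Longrightarrow> i < 7 \<Longrightarrow> 0 \<le> (\<Sum>\<mu>\<leftarrow>take k p. \<mu> ! i)"
    using p by (auto simp: dominant_paths_iff)
  define q where "q = rev (map (map uminus) (drop m p))"
  have sum_neg: "(\<Sum>\<mu>\<leftarrow>map (map uminus) xs. \<mu> ! i) = - (\<Sum>\<mu>\<leftarrow>xs. \<mu> ! i)"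
    if "set xs \<subseteq> set e7_weights" "i < 7" for xs i
    using that by (induction xs) (auto simp: e7_weightD(1))
  have split: "(\<Sum>\<mu>\<leftarrow>take k p. \<mu> ! i) = - (\<Sum>\<mu>\<leftarrow>drop k p. \<mu> ! i)" if "i < 7" for k i
    using 0[OF that] arg_cong[OF append_take_drop_id[of k p], of "\<lambda>p. \<Sum>\<mu>\<leftarrow>p. \<mu> ! i"]
    by (simp del: append_take_drop_id)
  have takeq: "(\<Sum>\<mu>\<leftarrow>take k q. \<mu> ! i) = (\<Sum>\<mu>\<leftarrow>take (m + m - k) p. \<mu> ! i)" if "i < 7" "k \<le> m" for k i
  proof -
    have "take k q = rev (map (map uminus) (drop (m + m - k) p))"
      using that P by (simp add: q_def take_rev drop_map)
    moreover have "set (drop (m + m - k) p) \<subseteq> set e7_weights" using P(2) set_drop_subset by fast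
    ultimately show ?thesis using split[OF that(1)] that(1)
      by (simp add: sum_neg rev_map[symmetric] del: map_map)
  qed
  have mem: "take m p \<in> set (dominant_paths m)" "q \<in> set (dominant_paths m)"
  proof -
    show "take m p \<in> set (dominant_paths m)"
      unfolding dominant_paths_iff using P dom set_take_subset[of m p] by (auto simp: min_def)
    have "set q \<subseteq> set e7_weights" using P(2) set_drop_subset[of m p] by (auto simp: q_def e7_weightD(2))
    thus "q \<in> set (dominant_paths m)"
      unfolding dominant_paths_iff using P dom takeq by (auto simp: q_def)
  qed
  have "wtotal (take m p) = wtotal q"
  proof (rule nth_equalityI)
    have s: "set (take m p) \<subseteq> set e7_weights" "set q \<subseteq> set e7_weights" "length q = m"
      using mem by (auto simp: dominant_paths_iff)
    show "length (wtotal (take m p)) = length (wtotal q)" using s wtotal by simp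
    fix i assume "i < length (wtotal (take m p))"
    thus "wtotal (take m p) ! i = wtotal q ! i"
      using s wtotal[of "take m p"] wtotal[of q] takeq[of i m] by simp
  qed
  moreover have "p = take m p @ rev (map (map uminus) q)"
  proof -
    have "map (map uminus) (map (map uminus) xs) = (xs :: int list list)" for xs by (simp add: comp_def)
    thus ?thesis by (simp add: q_def rev_map)
  qed
  ultimately show ?thesis using mem unfolding closed_paths_def by force
qed

lemma length_closed_paths: "length (closed_paths 3) = 35"
  by code_simp

context e7_minuscule
begin

text \<open>
  A form killed by the lowering operators vanishes on all tensors of non-dominant weight. Fixing the
  last argument \<open>v \<mu>\<close> gives a form of the same kind as soon as the form vanishes whenever the last
  argument has lower weight, so one can proceed from the lowest weight upwards.
\<close>

lemma lowering_invariant_determined: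
  assumes "multilinear k G" "\<And>i w. i < 7 \<Longrightarrow> derivation k (F i) G w = 0"
    and "\<And>p w. p \<in> set (dominant_paths k) \<Longrightarrow> (\<And>j. j \<in> {1..k} \<Longrightarrow> w j = v (p ! (j - 1))) \<Longrightarrow> G w = 0"
  shows "G w = 0"
  using assms
proof (induction k arbitrary: G w)
  case 0
  show ?case by (rule "0.prems"(3)[of "[]"]) auto
next
  case (Suc k)
  note G = Suc.prems(1) and inv = Suc.prems(2) and van = Suc.prems(3)
  have k: "Suc k \<in> {1..Suc k}" by simp
  have last: "G (w(Suc k := v \<mu>)) = 0" if "\<mu> \<in> set e7_weights" for \<mu> w
    using that
  proof (induction "27 - depth \<mu>" arbitrary: \<mu> w rule: less_induct)
    case less
    define G' where "G' w = G (w(Suc k := v \<mu>))" for w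
    have "G' w = 0" for w
    proof (rule Suc.IH)
      show "multilinear k G'"
        unfolding multilinear_def
      proof (intro ballI allI)
        fix i w assume "i \<in> {1..k}"
        hence "linear_form (\<lambda>x. G ((w(Suc k := v \<mu>))(i := x)))" using G by (simp add: multilinear_def)
        moreover have "(w(Suc k := v \<mu>))(i := x) = (w(i := x))(Suc k := v \<mu>)" for x
          using \<open>i \<in> {1..k}\<close> by (intro fun_upd_twist) auto
        ultimately show "linear_form (\<lambda>x. G' (w(i := x)))" by (simp add: G'_def)
      qed
      show "derivation k (F i) G' w = 0" if i: "i < 7" for i w
      proof -
        let ?w = "w(Suc k := v \<mu>)"
        have "derivation (Suc k) (F i) G ?w = (\<Sum>j\<in>{1..k}. G (?w(j := F i *v ?w j))) + G (?w(Suc k := F i *v v \<mu>))"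
          by (simp add: derivation_def)
        also have "(\<Sum>j\<in>{1..k}. G (?w(j := F i *v ?w j))) = derivation k (F i) G' w"
          unfolding derivation_def G'_def
          by (intro sum.cong refl arg_cong[of _ _ G]) (auto simp: fun_upd_twist)
        also have "G (?w(Suc k := F i *v v \<mu>)) = 0"
        proof (cases "\<mu> ! i = 1")
          case True
          have "depth (wminus \<mu> (e7_roots ! i)) = Suc (depth \<mu>)"
            "wminus \<mu> (e7_roots ! i) \<in> set e7_weights"
            using depth_lower[OF less.prems i True] e7_weight_lower[OF less.prems i True] by auto
          moreover from this e7_weightD(3) have "Suc (depth \<mu>) \<le> 27" by metis
          ultimately show ?thesis
            using less.hyps[of "wminus \<mu> (e7_roots ! i)" ?w] F_v[OF less.prems i] True by simp
        next
          case False
          hence "F i *v v \<mu> = 0" using F_v[OF less.prems i] by simp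
          thus ?thesis by (simp only: multilinear_zero[OF G k])
        qed
        finally show ?thesis using inv[OF i] by simp
      qed
      fix p w assume p: "p \<in> set (dominant_paths k)" and w: "\<And>j. j \<in> {1..k} \<Longrightarrow> w j = v (p ! (j - 1))"
      have len: "length p = k" "set p \<subseteq> set e7_weights" using p by (auto simp: dominant_paths_iff)
      define q where "q = p @ [\<mu>]"
      have w': "(w(Suc k := v \<mu>)) j = v (q ! (j - 1))" if "j \<in> {1..Suc k}" for j
        using that len w by (auto simp: q_def nth_append)
      have sum_q: "(\<Sum>j\<in>{1..Suc k}. q ! (j - 1) ! i) = (\<Sum>\<mu>\<leftarrow>q. \<mu> ! i)" for i
        by (rule sum_nth_shift) (simp add: q_def len)
      show "G' w = 0"
      proof (cases "\<forall>i<7. 0 \<le> (\<Sum>\<mu>\<leftarrow>q. \<mu> ! i)")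
        case True
        have "q \<in> set (dominant_paths (Suc k))"
          using p True less.prems unfolding dominant_paths_iff by (auto simp: q_def le_Suc_eq)
        from van[OF this w'] show ?thesis unfolding G'_def .
      next
        case False
        then obtain i where i: "i < 7" "(\<Sum>\<mu>\<leftarrow>q. \<mu> ! i) < 0" by force
        show ?thesis unfolding G'_def
        proof (rule lowering_invariant_negative[OF G inv[OF i(1)] i(1), where p = "\<lambda>j. q ! (j - 1)"])
          show "q ! (j - 1) \<in> set e7_weights" if "j \<in> {1..Suc k}" for j
          proof -
            have "q ! (j - 1) \<in> set q" using that len by (intro nth_mem) (auto simp: q_def)
            thus ?thesis using len less.prems by (auto simp: q_def)
          qed
        qed (use w' i sum_q in auto)
      qed
    qed
    from this[of w] show ?case unfolding G'_def .
  qed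
  obtain c where c: "w (Suc k) = (\<Sum>\<mu>\<in>set e7_weights. c \<mu> *s v \<mu>)" using v_spans by blast
  have "linear_form (\<lambda>x. G (w(Suc k := x)))" using G k unfolding multilinear_def by blast
  from linear_form_sum[OF this, of c v "set e7_weights"] show "G w = 0"
    unfolding c[symmetric] using last by simp
qed

text \<open>Torus invariance disposes of the dominant paths that do not end at 0; the others split
  in the middle into two dominant paths with the same end point.\<close>

lemma invariant_determined:
  assumes G: "multilinear (m + m) G"
    and F: "\<And>i w. i < 7 \<Longrightarrow> derivation (m + m) (F i) G w = 0"
    and H: "\<And>i w. i < 7 \<Longrightarrow> derivation (m + m) (H i) G w = 0"
    and van: "\<And>p w. p \<in> set (closed_paths m) \<Longrightarrow> (\<And>j. j \<in> {1..m + m} \<Longrightarrow> w j = v (p ! (j - 1))) \<Longrightarrow> G w = 0"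
  shows "G w = 0"
proof (rule lowering_invariant_determined[OF G F])
  fix p w assume p: "p \<in> set (dominant_paths (m + m))" and w: "\<And>j. j \<in> {1..m + m} \<Longrightarrow> w j = v (p ! (j - 1))"
  have len: "length p = m + m" "set p \<subseteq> set e7_weights" using p by (auto simp: dominant_paths_iff)
  have sum_p: "(\<Sum>j\<in>{1..m + m}. p ! (j - 1) ! i) = (\<Sum>\<mu>\<leftarrow>p. \<mu> ! i)" for i
    by (rule sum_nth_shift) (simp add: len)
  show "G w = 0"
  proof (cases "\<forall>i<7. (\<Sum>\<mu>\<leftarrow>p. \<mu> ! i) = 0")
    case True
    show ?thesis by (rule van[OF dominant_closed_path[OF p] w]) (use True in auto)
  next
    case False
    then obtain i where i: "i < 7" "(\<Sum>\<mu>\<leftarrow>p. \<mu> ! i) \<noteq> 0" by blast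
    show ?thesis
    proof (rule torus_invariant_nonzero[OF G H[OF i(1)] i(1) _ w])
      show "p ! (j - 1) \<in> set e7_weights" if "j \<in> {1..m + m}" for j
        using that len nth_mem[of "j - 1" p] by auto
    qed (use i sum_p in auto)
  qed
qed

end

section \<open>The restriction to a tensor product of three planes\<close>

lemma sympl_linear:
  assumes "symplectic_form \<omega>"
  shows "linear_form (\<omega> x)" "linear_form (\<lambda>x. \<omega> x y)"
    "\<omega> (x + x') y = \<omega> x y + \<omega> x' y" "\<omega> x (y + y') = \<omega> x y + \<omega> x y'"
    "\<omega> (c *s x) y = c * \<omega> x y" "\<omega> x (c *s y) = c * \<omega> x y" "\<omega> 0 y = 0" "\<omega> x 0 = 0" "\<omega> x x = 0"
proof -
  show l: "linear_form (\<omega> x)" "linear_form (\<lambda>x. \<omega> x y)" for x y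
    using assms by (simp_all add: symplectic_form_def)
  show "\<omega> 0 y = 0" "\<omega> x 0 = 0" using l linear_form_zero by blast+
qed (use assms in \<open>simp_all add: symplectic_form_def linear_form_iff\<close>)

lemma sympl_antisym:
  assumes "symplectic_form \<omega>"
  shows "\<omega> x y = - \<omega> y x"
proof -
  have "\<omega> (x + y) (x + y) = 0" using assms by (rule sympl_linear)
  moreover have "\<omega> (x + y) (x + y) = \<omega> x y + \<omega> y x"
    by (simp only: sympl_linear(3,4)[OF assms]) (simp add: sympl_linear(9)[OF assms])
  ultimately have "\<omega> x y + \<omega> y x = 0" by simp
  thus ?thesis by (simp only: eq_neg_iff_add_eq_0)
qed

lemma sympl_eqI:
  assumes "symplectic_form \<omega>" "\<And>y. \<omega> x y = \<omega> x' y"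
  shows "x = x'"
proof -
  have "\<omega> (x + (-1) *s x') y = 0" for y by (simp only: sympl_linear[OF assms(1)] assms(2)) simp
  hence "x + (-1) *s x' = 0" using assms(1) unfolding symplectic_form_def by blast
  thus ?thesis by simp
qed

lemma sympl_represents:
  assumes \<omega>: "symplectic_form (\<omega> :: complex ^ 'n \<Rightarrow> complex ^ 'n \<Rightarrow> complex)" and \<phi>: "linear_form \<phi>"
  shows "\<exists>x. \<forall>y. \<omega> x y = \<phi> y"
proof -
  obtain J where J: "J ** gram \<omega> = mat 1" using gram_left_inverse[OF \<omega>] by metis
  define x :: "complex ^ 'n" where "x = (\<chi> i. \<Sum>j\<in>UNIV. \<phi> (axis j 1) * J $ j $ i)"
  have "\<omega> x y = \<phi> y" for y
  proof -
    have "\<omega> x y = (\<Sum>i\<in>UNIV. \<Sum>j\<in>UNIV. \<phi> (axis j 1) * (J $ j $ i * (gram \<omega> *v y) $ i))"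
      by (simp add: symplectic_gram[OF \<omega>] x_def sum_distrib_right mult.assoc)
    also have "\<dots> = (\<Sum>j\<in>UNIV. \<phi> (axis j 1) * (J *v (gram \<omega> *v y)) $ j)"
      by (subst sum.swap) (simp add: matrix_vector_mult_def sum_distrib_left)
    also have "\<dots> = (\<Sum>j\<in>UNIV. y $ j * \<phi> (axis j 1))" by (simp add: matrix_vector_mul_assoc J mult.commute)
    also have "\<dots> = \<phi> y" by (rule linear_form_coordinates[OF \<phi>, symmetric])
    finally show ?thesis .
  qed
  thus ?thesis by blast
qed

text \<open>Freudenthal's triple product up to a scalar: the vector that represents the linear form
  \<open>d a b c\<close> through \<open>\<omega>\<close>. It frees the forms of order two from the
  choice of a basis.\<close>

definition dual3 ::
  "(complex ^ 'n \<Rightarrow> complex ^ 'n \<Rightarrow> complex) \<Rightarrow>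
   (complex ^ 'n \<Rightarrow> complex ^ 'n \<Rightarrow> complex ^ 'n \<Rightarrow> complex ^ 'n \<Rightarrow> complex) \<Rightarrow>
   complex ^ 'n \<Rightarrow> complex ^ 'n \<Rightarrow> complex ^ 'n \<Rightarrow> complex ^ 'n" where
  "dual3 \<omega> d a b c = (SOME x. \<forall>y. \<omega> x y = d a b c y)"

lemma quartic_linear:
  assumes "symmetric_quartic_form d"
  shows "linear_form (\<lambda>x. d x b c e)" "linear_form (\<lambda>x. d a x c e)" "linear_form (\<lambda>x. d a b x e)" "linear_form (d a b c)"
proof -
  show 1: "linear_form (\<lambda>x. d x b c e)" for b c e using assms by (simp add: symmetric_quartic_form_def)
  have "(\<lambda>x. d a x c e) = (\<lambda>x. d x a c e)" for a c e using assms by (auto simp: symmetric_quartic_form_def)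
  thus 2: "linear_form (\<lambda>x. d a x c e)" for a c e using 1[of a c e] by simp
  have "(\<lambda>x. d a b x e) = (\<lambda>x. d a x b e)" for a b e using assms by (auto simp: symmetric_quartic_form_def)
  thus 3: "linear_form (\<lambda>x. d a b x e)" for a b e using 2[of a b e] by simp
  have "(\<lambda>x. d a b c x) = (\<lambda>x. d a b x c)" using assms by (auto simp: symmetric_quartic_form_def)
  thus "linear_form (d a b c)" using 3[of a b c] by simp
qed

lemma dual3:
  assumes "symplectic_form \<omega>" "symmetric_quartic_form d"
  shows "\<omega> (dual3 \<omega> d a b c) y = d a b c y"
  using someI_ex[OF sympl_represents[OF assms(1) quartic_linear(4)[OF assms(2), of a b c]]]
  by (simp add: dual3_def)

text \<open>Expanding the triple product in the basis b contracts the Gram matrix with its inverse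
  and leaves the coordinates of the triple product.\<close>

lemma order_two_form_dual3:
  assumes \<omega>: "symplectic_form \<omega>" and d: "symmetric_quartic_form d" and b: "is_basis b"
  shows "order_two_form \<omega> d b i j k l p q w = d (dual3 \<omega> d (w i) (w j) (w k)) (w l) (w p) (w q)"
proof -
  define G where "G = (\<chi> r s. \<omega> (b r) (b s))"
  have inj: "inj b" using b by (simp add: is_basis_def)
  have "\<exists>c. x = (\<Sum>r\<in>UNIV. c r *s b r)" for x
  proof -
    have "x \<in> vec.span (range b)" using b by (simp add: is_basis_def)
    then obtain u where "x = (\<Sum>y\<in>range b. u y *s y)" by (auto simp: vec.span_finite)
    thus ?thesis using inj by (intro exI[of _ "u \<circ> b"]) (simp add: sum.reindex)
  qed
  note spans = this
  \<comment> \<open>A vector killed by the Gram matrix consists of the coordinates of an element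
    orthogonal to the whole basis, so the matrix is invertible.\<close>
  have "y = 0" if y: "G *v y = 0" for y
  proof -
    define z where "z = (\<Sum>s\<in>UNIV. y $ s *s b s)"
    have bz: "\<omega> (b r) z = 0" for r
    proof -
      have "\<omega> (b r) z = (G *v y) $ r"
        unfolding z_def linear_form_sum[OF sympl_linear(1)[OF \<omega>]]
        by (simp add: G_def matrix_vector_mult_def mult.commute)
      thus ?thesis using y by simp
    qed
    have "\<omega> x z = 0" for x
    proof -
      obtain c where "x = (\<Sum>r\<in>UNIV. c r *s b r)" using spans by blast
      thus ?thesis using linear_form_sum[OF sympl_linear(2)[OF \<omega>, of z], of c b UNIV] bz by simp
    qed
    hence "\<omega> z x = \<omega> 0 x" for x using sympl_antisym[OF \<omega>, of z x] by (simp add: sympl_linear[OF \<omega>])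
    hence z0: "z = 0" by (rule sympl_eqI[OF \<omega>])
    have "(\<Sum>v\<in>range b. y $ (inv b v) *s v) = z"
      using inj by (simp add: z_def sum.reindex)
    hence "\<forall>v\<in>range b. y $ (inv b v) = 0"
      using vec.independentD[of "range b" "range b" "\<lambda>v. y $ (inv b v)"] b z0 by (auto simp: is_basis_def)
    thus "y = 0" using inj by (simp add: vec_eq_iff)
  qed
  then obtain J where "J ** G = mat 1" using matrix_left_invertible_ker[of G] by blast
  hence "invertible G" using matrix_left_right_inverse[of J G] by (auto simp: invertible_def)
  hence inv: "G ** matrix_inv G = mat 1"
    unfolding invertible_def matrix_inv_def by (metis (mono_tags, lifting) someI_ex)
  define x where "x = dual3 \<omega> d (w i) (w j) (w k)"
  obtain c where c: "x = (\<Sum>r\<in>UNIV. c r *s b r)" using spans by blast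
  have dx: "d (w i) (w j) (w k) (b r) = (\<Sum>t\<in>UNIV. c t * G $ t $ r)" for r
    using linear_form_sum[OF sympl_linear(2)[OF \<omega>, of "b r"], of c b UNIV]
    by (simp add: dual3[OF \<omega> d, symmetric] x_def[symmetric] c[symmetric] G_def)
  have "order_two_form \<omega> d b i j k l p q w
      = (\<Sum>r\<in>UNIV. \<Sum>s\<in>UNIV. \<Sum>t\<in>UNIV. c t * (G $ t $ r * matrix_inv G $ r $ s) * d (b s) (w l) (w p) (w q))"
    unfolding order_two_form_def dx inverse_gram_def G_def[symmetric] sum_distrib_right
    by (simp only: mult.assoc)
  also have "\<dots> = (\<Sum>s\<in>UNIV. \<Sum>t\<in>UNIV. \<Sum>r\<in>UNIV. c t * (G $ t $ r * matrix_inv G $ r $ s) * d (b s) (w l) (w p) (w q))"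
    by (subst sum.swap) (intro sum.cong refl sum.swap)
  also have "\<dots> = (\<Sum>s\<in>UNIV. \<Sum>t\<in>UNIV. c t * (G ** matrix_inv G) $ t $ s * d (b s) (w l) (w p) (w q))"
    by (simp add: matrix_matrix_mult_def sum_distrib_left sum_distrib_right mult_ac)
  also have "\<dots> = (\<Sum>s\<in>UNIV. c s * d (b s) (w l) (w p) (w q))"
    unfolding inv by (simp add: mat_def if_distrib[of "\<lambda>x. _ * x"] if_distrib[of "\<lambda>x. x * _"] cong: if_cong)
  also have "\<dots> = d x (w l) (w p) (w q)"
    unfolding c using linear_form_sum[OF quartic_linear(1)[OF d], of c b UNIV] by simp
  finally show ?thesis by (simp add: x_def)
qed

lemma dual3_linear:
  assumes \<omega>: "symplectic_form \<omega>" and d: "symmetric_quartic_form d"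
  shows "dual3 \<omega> d (a + a') b c = dual3 \<omega> d a b c + dual3 \<omega> d a' b c"
    "dual3 \<omega> d a (b + b') c = dual3 \<omega> d a b c + dual3 \<omega> d a b' c"
    "dual3 \<omega> d a b (c + c') = dual3 \<omega> d a b c + dual3 \<omega> d a b c'"
    "dual3 \<omega> d (z *s a) b c = z *s dual3 \<omega> d a b c"
    "dual3 \<omega> d a (z *s b) c = z *s dual3 \<omega> d a b c"
    "dual3 \<omega> d a b (z *s c) = z *s dual3 \<omega> d a b c"
  by (rule sympl_eqI[OF \<omega>]; use quartic_linear[OF d] in
      \<open>simp add: sympl_linear[OF \<omega>] dual3[OF \<omega> d] linear_form_iff\<close>)+

text \<open>
  Twice the coordinates of the weights spanned by the pairwise orthogonal simple roots of the nodes
  2, 5 and 7 are sign triples \<open>(a, b, c)\<close>, encoded as \<open>9 a + 3 b + c\<close>. On this eight-dimensional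
  subspace, a tensor product of three planes, \<open>\<omega>\<close> and \<open>d\<close> are the invariants of \<open>SL\<^sub>2 \<times> SL\<^sub>2 \<times> SL\<^sub>2\<close>:
  up to scalars, \<open>wval\<close> and \<open>dval\<close>, the polarisation of Cayley's hyperdeterminant.
\<close>

definition cube :: "int list" where
  "cube = [13, 11, 7, 5, -5, -7, -11, -13]"

text \<open>Half of a, b and c times the simple roots of the nodes 2, 5 and 7, decoded from s. The
  halved entries are the values at the nodes 4 and 6, which lie between these.\<close>

definition cube_weight :: "int \<Rightarrow> int list" where
  "cube_weight s = (let a = sgn s; b = sgn (s - 9 * a); c = s - 9 * a - 3 * b in
     [0, a, 0, - ((a + b) div 2), b, - ((b + c) div 2), c])"

text \<open>The product a b c of the three signs, since \<open>\<omega>\<close> restricts to a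
  multiple of the tensor product of the area forms of the three planes.\<close>

definition cube_sign :: "int \<Rightarrow> int" where
  "cube_sign s = (if s \<in> {13, 5, -7, -11} then 1 else -1)"

definition wval :: "int \<Rightarrow> int \<Rightarrow> int" where
  "wval s t = (if s + t = 0 then cube_sign s else 0)"

text \<open>Four cube vertices with sum zero are two antipodal pairs or an inscribed tetrahedron.
  The hyperdeterminant has the coefficients 1 for a repeated pair, -2 for two different pairs and 4
  for a tetrahedron; polarisation divides them by 6, 24 and 24, which gives the ratio 2 : -1 :
  2.\<close>

definition dval :: "int \<Rightarrow> int \<Rightarrow> int \<Rightarrow> int \<Rightarrow> int" where
  "dval s t x y = (if s + t + x + y \<noteq> 0 then 0
     else if distinct [s, t, x, y] \<and> (s + t = 0 \<or> s + x = 0 \<or> s + y = 0) then -1 else 2)"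

lemma cube_weight_check:
  "\<forall>s\<in>set cube. cube_weight s \<in> set e7_weights \<and> -s \<in> set cube \<and> map uminus (cube_weight s) = cube_weight (-s)"
  by code_simp

text \<open>This makes the cube subspace closed under the triple product, so that the forms of order
  two can be evaluated inside it.\<close>

lemma cube_sum_check:
  "\<forall>s\<in>set cube. \<forall>t\<in>set cube. \<forall>x\<in>set cube.
     if s + t + x \<in> set cube then map uminus (wtotal [cube_weight s, cube_weight t, cube_weight x]) = cube_weight (- (s + t + x))
     else map uminus (wtotal [cube_weight s, cube_weight t, cube_weight x]) \<notin> set e7_weights"
  by code_simp

lemma cube_sum_check4:
  "\<forall>s\<in>set cube. \<forall>t\<in>set cube. \<forall>x\<in>set cube. \<forall>y\<in>set cube.
     if s + t + x + y = 0 then True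
     else \<exists>i\<in>set [1, 4, 6]. wtotal [cube_weight s, cube_weight t, cube_weight x, cube_weight y] ! i \<noteq> 0"
  by code_simp

lemma dval_check:
  "\<forall>s\<in>set cube. \<forall>t\<in>set cube. \<forall>x\<in>set cube. \<forall>y\<in>set cube. if s + t + x + y \<noteq> 0 then True else
     (sort [s, t, x, y], dval s t x y) \<in> set
      ([([-13, -13, 13, 13], 2), ([-11, -11, 11, 11], 2), ([-7, -7, 7, 7], 2), ([-5, -5, 5, 5], 2),
        ([-13, -11, 11, 13], -1), ([-13, -7, 7, 13], -1), ([-13, -5, 5, 13], -1),
        ([-11, -7, 7, 11], -1), ([-11, -5, 5, 11], -1), ([-7, -5, 5, 7], -1),
        ([-11, -7, 5, 13], 2), ([-13, -5, 7, 11], 2)])"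
  by code_simp

definition reflect :: "nat \<Rightarrow> int list \<Rightarrow> int list" where
  "reflect i \<mu> = (if \<mu> ! i = 1 then wminus \<mu> (e7_roots ! i)
     else if \<mu> ! i = -1 then wplus \<mu> (e7_roots ! i) else \<mu>)"

text \<open>The words carry the weights of the closed paths of length four into the cube.\<close>

lemma closed_paths_2_check:
  "\<forall>p\<in>set (closed_paths 2). p = [p ! 0, p ! 1, map uminus (p ! 1), map uminus (p ! 0)] \<and>
     (\<exists>r\<in>set [[6, 5, 4, 3, 1, 2, 0, 3, 2, 4, 3, 5],
        [5, 4, 3, 1, 2, 0, 3, 2, 6, 5, 4, 3, 1, 2, 0, 3, 2, 4, 3, 5],
        [0, 2, 3, 1, 4, 3, 2, 0, 6, 5, 4, 3, 1, 2, 0, 3, 2, 4, 3, 5]].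
        (\<forall>i\<in>set r. i < 7) \<and> fold reflect r (p ! 0) \<in> cube_weight ` set cube \<and> fold reflect r (p ! 1) \<in> cube_weight ` set cube)"
  by code_simp

section \<open>Values of the invariant forms\<close>

locale e7_forms = e7_minuscule F H v
  for F H :: "nat \<Rightarrow> complex ^ 'n ^ 'n" and v +
  fixes \<omega> :: "complex ^ 'n \<Rightarrow> complex ^ 'n \<Rightarrow> complex"
    and d :: "complex ^ 'n \<Rightarrow> complex ^ 'n \<Rightarrow> complex ^ 'n \<Rightarrow> complex ^ 'n \<Rightarrow> complex"
  assumes sympl: "symplectic_form \<omega>" and quartic: "symmetric_quartic_form d"
    and \<omega>_F: "i < 7 \<Longrightarrow> \<omega> (F i *v x) y + \<omega> x (F i *v y) = 0"
    and \<omega>_H: "i < 7 \<Longrightarrow> \<omega> (H i *v x) y + \<omega> x (H i *v y) = 0"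
    and d_F: "i < 7 \<Longrightarrow> d (F i *v x) y z w + d x (F i *v y) z w + d x y (F i *v z) w + d x y z (F i *v w) = 0"
    and d_H: "i < 7 \<Longrightarrow> d (H i *v x) y z w + d x (H i *v y) z w + d x y (H i *v z) w + d x y z (H i *v w) = 0"
    and d_nonzero: "\<exists>x y z w. d x y z w \<noteq> 0"
begin

lemmas \<omega>_linear = sympl_linear[OF sympl]
lemmas \<omega>_antisym = sympl_antisym[OF sympl]
lemmas d_linear = quartic_linear[OF quartic]

lemma d_sym: "d y x z w = d x y z w" "d x z y w = d x y z w" "d x y w z = d x y z w"
  using quartic by (simp_all add: symmetric_quartic_form_def)

lemma d_zero: "d 0 y z w = 0" "d x 0 z w = 0" "d x y 0 w = 0" "d x y z 0 = 0"
  by (simp_all add: linear_form_zero[OF d_linear(1)] linear_form_zero[OF d_linear(2)]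
    linear_form_zero[OF d_linear(3)] linear_form_zero[OF d_linear(4)])

lemma d_scale: "d (c *s x) y z w = c * d x y z w" "d x (c *s y) z w = c * d x y z w"
  "d x y (c *s z) w = c * d x y z w" "d x y z (c *s w) = c * d x y z w"
  by (simp_all add: d_linear[unfolded linear_form_iff])

lemma \<omega>_weights:
  assumes "\<mu> \<in> set e7_weights" "\<nu> \<in> set e7_weights" "\<nu> \<noteq> map uminus \<mu>"
  shows "\<omega> (v \<mu>) (v \<nu>) = 0"
proof -
  have "\<exists>i<7. \<mu> ! i + \<nu> ! i \<noteq> 0"
  proof (rule ccontr)
    assume "\<not> ?thesis"
    hence "\<nu> = map uminus \<mu>" using e7_weightD(1)[OF assms(1)] e7_weightD(1)[OF assms(2)]
      by (intro nth_equalityI) (auto simp: eq_neg_iff_add_eq_0 add.commute)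
    thus False using assms(3) by simp
  qed
  then obtain i where i: "i < 7" "\<mu> ! i + \<nu> ! i \<noteq> 0" by blast
  have "of_int (\<mu> ! i + \<nu> ! i) * \<omega> (v \<mu>) (v \<nu>) = 0"
    using \<omega>_H[OF i(1), of "v \<mu>" "v \<nu>"] assms i(1) by (simp add: H_v \<omega>_linear distrib_right)
  thus ?thesis using i(2) by (simp del: of_int_add)
qed

lemma d_weights:
  assumes "\<mu> \<in> set e7_weights" "\<nu> \<in> set e7_weights" "\<xi> \<in> set e7_weights" "\<zeta> \<in> set e7_weights"
    and i: "i < 7" and ne: "wtotal [\<mu>, \<nu>, \<xi>, \<zeta>] ! i \<noteq> 0"
  shows "d (v \<mu>) (v \<nu>) (v \<xi>) (v \<zeta>) = 0"
proof -
  have "of_int (wtotal [\<mu>, \<nu>, \<xi>, \<zeta>] ! i) * d (v \<mu>) (v \<nu>) (v \<xi>) (v \<zeta>) = 0"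
    using d_H[OF i, of "v \<mu>" "v \<nu>" "v \<xi>" "v \<zeta>"] assms wtotal[of "[\<mu>, \<nu>, \<xi>, \<zeta>]"]
    by (simp add: H_v d_scale algebra_simps)
  thus ?thesis using ne by simp
qed

lemma \<omega>_opposite:
  assumes "\<mu> \<in> set e7_weights"
  shows "\<omega> (v \<mu>) (v (map uminus \<mu>)) \<noteq> 0"
proof
  assume 0: "\<omega> (v \<mu>) (v (map uminus \<mu>)) = 0"
  have "\<omega> (v \<mu>) y = 0" for y
  proof -
    obtain c where c: "y = (\<Sum>\<nu>\<in>set e7_weights. c \<nu> *s v \<nu>)" using v_spans by blast
    have "\<omega> (v \<mu>) (v \<nu>) = 0" if "\<nu> \<in> set e7_weights" for \<nu>
      using 0 \<omega>_weights[OF assms that] by blast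
    thus ?thesis unfolding c linear_form_sum[OF \<omega>_linear(1)] by simp
  qed
  hence "v \<mu> = 0" using sympl by (simp add: symplectic_form_def)
  thus False using v_nonzero[OF assms] by simp
qed

definition u :: "int \<Rightarrow> complex ^ 'n" where
  "u s = v (cube_weight s)"

text \<open>Lowering at the index 1, 4 or 6 turns one of the signs from plus to minus; its place
  value in the code is r = 9, 3 or 1, so the code drops by 2 r.\<close>

lemma F_u_check:
  "\<forall>s\<in>set cube. \<forall>(i, r)\<in>set [(1, 9), (4, 3), (6, 1)].
     cube_weight s ! i = (if s - 2 * r \<in> set cube then 1 else -1) \<and>
     (if s - 2 * r \<in> set cube then wminus (cube_weight s) (e7_roots ! i) = cube_weight (s - 2 * r) else True)"
  by code_simp

lemma F_u:
  assumes "s \<in> set cube" "(i, r) \<in> set [(1, 9), (4, 3), (6, 1)]"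
  shows "F i *v u s = (if s - 2 * r \<in> set cube then u (s - 2 * r) else 0)"
proof -
  have i: "i < 7" using assms(2) by auto
  have s: "cube_weight s \<in> set e7_weights" using cube_weight_check assms(1) by blast
  have *: "cube_weight s ! i = (if s - 2 * r \<in> set cube then 1 else -1) \<and>
     (if s - 2 * r \<in> set cube then wminus (cube_weight s) (e7_roots ! i) = cube_weight (s - 2 * r) else True)"
    using bspec[OF bspec[OF F_u_check assms(1)] assms(2)] by simp
  show ?thesis unfolding u_def F_v[OF s i] using * by (auto split: if_splits)
qed

lemma F_cube:
  "F 1 *v u 13 = u (-5)" "F 1 *v u 11 = u (-7)" "F 1 *v u 7 = u (-11)" "F 1 *v u 5 = u (-13)"
  "F 1 *v u (-5) = 0" "F 1 *v u (-7) = 0" "F 1 *v u (-11) = 0" "F 1 *v u (-13) = 0"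
  "F 4 *v u 13 = u 7" "F 4 *v u 11 = u 5" "F 4 *v u (-5) = u (-11)" "F 4 *v u (-7) = u (-13)"
  "F 4 *v u 7 = 0" "F 4 *v u 5 = 0" "F 4 *v u (-11) = 0" "F 4 *v u (-13) = 0"
  "F 6 *v u 13 = u 11" "F 6 *v u 7 = u 5" "F 6 *v u (-5) = u (-7)" "F 6 *v u (-11) = u (-13)"
  "F 6 *v u 11 = 0" "F 6 *v u 5 = 0" "F 6 *v u (-7) = 0" "F 6 *v u (-13) = 0"
  using F_u[of _ 1 9] F_u[of _ 4 3] F_u[of _ 6 1] by (simp_all add: cube_def)

lemma cube_weight_inj: "s \<in> set cube \<Longrightarrow> t \<in> set cube \<Longrightarrow> cube_weight s = cube_weight t \<Longrightarrow> s = t"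
proof -
  have "\<forall>s\<in>set cube. \<forall>t\<in>set cube. if s = t then True else cube_weight s \<noteq> cube_weight t" by code_simp
  thus "s \<in> set cube \<Longrightarrow> t \<in> set cube \<Longrightarrow> cube_weight s = cube_weight t \<Longrightarrow> s = t" by metis
qed

definition \<omega>\<^sub>0 :: complex where "\<omega>\<^sub>0 = \<omega> (u 13) (u (-13))"

text \<open>The sign makes \<open>d_cube\<close> hold with \<open>dval\<close>, which is -1 on two
  different antipodal pairs.\<close>

definition \<kappa> :: complex where "\<kappa> = - d (u (-13)) (u (-5)) (u 5) (u 13)"

lemma \<omega>\<^sub>0_nonzero: "\<omega>\<^sub>0 \<noteq> 0"
  using \<omega>_opposite[of "cube_weight 13"] cube_weight_check
  by (simp add: \<omega>\<^sub>0_def u_def cube_def)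

text \<open>Moving a lowering operator across \<open>\<omega>\<close> relates the antipodal pairs at
  the two ends of an edge of the cube, with a change of sign.\<close>

lemma \<omega>_cube:
  assumes "s \<in> set cube" "t \<in> set cube"
  shows "\<omega> (u s) (u t) = \<omega>\<^sub>0 * of_int (wval s t)"
proof (cases "t = - s")
  case True
  have "\<omega> (u (-5)) (u 5) = - \<omega>\<^sub>0" "\<omega> (u 7) (u (-7)) = - \<omega>\<^sub>0" "\<omega> (u 11) (u (-11)) = - \<omega>\<^sub>0"
    using \<omega>_F[of 1 "u 13" "u 5"] \<omega>_F[of 4 "u 13" "u (-7)"] \<omega>_F[of 6 "u 13" "u (-11)"]
    by (simp_all add: F_cube \<omega>\<^sub>0_def eq_neg_iff_add_eq_0 del: One_nat_def)
  moreover have "\<omega> (u 13) (u (-13)) = \<omega>\<^sub>0" by (simp add: \<omega>\<^sub>0_def)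
  ultimately show ?thesis
    using assms(1) True \<omega>_antisym[of "u 5" "u (-5)"] \<omega>_antisym[of "u (-7)" "u 7"]
      \<omega>_antisym[of "u (-11)" "u 11"] \<omega>_antisym[of "u (-13)" "u 13"]
    by (auto simp: cube_def wval_def cube_sign_def)
next
  case False
  have "cube_weight t \<noteq> map uminus (cube_weight s)"
    using False assms cube_weight_check cube_weight_inj[of t "-s"] by auto
  hence "\<omega> (u s) (u t) = 0" unfolding u_def using assms cube_weight_check by (intro \<omega>_weights) auto
  moreover have "s + t \<noteq> 0" using False by (simp add: eq_neg_iff_add_eq_0 add.commute)
  ultimately show ?thesis by (simp add: wval_def)
qed

lemma d_sort: "sort [s, t, x, y] = [s', t', x', y'] \<Longrightarrow> d (u s) (u t) (u x) (u y) = d (u s') (u t') (u x') (u y')"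
  by (auto simp: d_sym split: if_splits)

lemma d_table:
  "d (u (-13)) (u (-5)) (u 5) (u 13) = - \<kappa>" "d (u (-13)) (u (-13)) (u 13) (u 13) = 2 * \<kappa>"
  "d (u (-5)) (u (-5)) (u 5) (u 5) = 2 * \<kappa>" "d (u (-13)) (u (-7)) (u 7) (u 13) = - \<kappa>"
  "d (u (-7)) (u (-7)) (u 7) (u 7) = 2 * \<kappa>" "d (u (-13)) (u (-11)) (u 11) (u 13) = - \<kappa>"
  "d (u (-11)) (u (-11)) (u 11) (u 11) = 2 * \<kappa>" "d (u (-11)) (u (-5)) (u 5) (u 11) = - \<kappa>"
  "d (u (-7)) (u (-5)) (u 5) (u 7) = - \<kappa>" "d (u (-11)) (u (-7)) (u 7) (u 11) = - \<kappa>"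
  "d (u (-11)) (u (-7)) (u 5) (u 13) = 2 * \<kappa>" "d (u (-13)) (u (-5)) (u 7) (u 11) = 2 * \<kappa>"
proof -
  let ?D = "\<lambda>s t x y. d (u s) (u t) (u x) (u y)"
  show a: "?D (-13) (-5) 5 13 = - \<kappa>" by (simp add: \<kappa>_def)
  \<comment> \<open>Each relation is the invariance of \<open>d\<close> under one of the three
    lowering operators at a quadruple whose total weight is the corresponding simple root. Together
    they express all twelve values by \<open>\<kappa>\<close>.\<close>
  have r: "2 * ?D (-13) (-5) 5 13 + ?D (-13) (-13) 13 13 = 0" "2 * ?D (-13) (-5) 5 13 + ?D (-5) (-5) 5 5 = 0"
    "2 * ?D (-13) (-7) 7 13 + ?D (-13) (-13) 13 13 = 0" "2 * ?D (-13) (-7) 7 13 + ?D (-7) (-7) 7 7 = 0"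
    "2 * ?D (-13) (-11) 11 13 + ?D (-13) (-13) 13 13 = 0" "2 * ?D (-13) (-11) 11 13 + ?D (-11) (-11) 11 11 = 0"
    "2 * ?D (-11) (-5) 5 11 + ?D (-5) (-5) 5 5 = 0" "2 * ?D (-7) (-5) 5 7 + ?D (-5) (-5) 5 5 = 0"
    "2 * ?D (-11) (-7) 7 11 + ?D (-11) (-11) 11 11 = 0"
    "?D (-11) (-7) 5 13 + ?D (-11) (-5) 5 11 + ?D (-13) (-11) 11 13 = 0"
    "?D (-13) (-5) 7 11 + ?D (-11) (-5) 5 11 + ?D (-7) (-5) 5 7 = 0"
    using d_F[of 1 "u 13" "u 13" "u 5" "u (-13)"] d_F[of 1 "u 5" "u 5" "u 13" "u (-5)"]
      d_F[of 4 "u 13" "u 13" "u (-7)" "u (-13)"] d_F[of 4 "u (-7)" "u (-7)" "u 13" "u 7"]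
      d_F[of 6 "u 13" "u 13" "u (-11)" "u (-13)"] d_F[of 6 "u (-11)" "u (-11)" "u 13" "u 11"]
      d_F[of 4 "u (-5)" "u (-5)" "u 11" "u 5"] d_F[of 6 "u (-5)" "u (-5)" "u 7" "u 5"]
      d_F[of 1 "u 11" "u 11" "u 7" "u (-11)"] d_F[of 1 "u 13" "u 5" "u 11" "u (-11)"]
      d_F[of 1 "u 5" "u (-5)" "u 7" "u 11"]
    by (simp_all add: F_cube d_zero d_sym algebra_simps del: One_nat_def)
  show b: "?D (-13) (-13) 13 13 = 2 * \<kappa>" "?D (-5) (-5) 5 5 = 2 * \<kappa>" using r(1,2) a by algebra+
  show c: "?D (-13) (-7) 7 13 = - \<kappa>" "?D (-13) (-11) 11 13 = - \<kappa>" "?D (-11) (-5) 5 11 = - \<kappa>"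
    "?D (-7) (-5) 5 7 = - \<kappa>" using r(3,5,7,8) b by algebra+
  show e: "?D (-7) (-7) 7 7 = 2 * \<kappa>" "?D (-11) (-11) 11 11 = 2 * \<kappa>" using r(4,6) c by algebra+
  show "?D (-11) (-7) 7 11 = - \<kappa>" using r(9) e by algebra
  show "?D (-11) (-7) 5 13 = 2 * \<kappa>" "?D (-13) (-5) 7 11 = 2 * \<kappa>" using r(10,11) c by algebra+
qed

lemma d_cube:
  assumes "s \<in> set cube" "t \<in> set cube" "x \<in> set cube" "y \<in> set cube"
  shows "d (u s) (u t) (u x) (u y) = \<kappa> * of_int (dval s t x y)"
proof (cases "s + t + x + y = 0")
  case False
  then obtain i where i: "i \<in> set [1, 4, 6]"
    "wtotal [cube_weight s, cube_weight t, cube_weight x, cube_weight y] ! i \<noteq> 0"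
    using bspec[OF bspec[OF bspec[OF bspec[OF cube_sum_check4 assms(1)] assms(2)] assms(3)] assms(4)] by auto
  have "d (u s) (u t) (u x) (u y) = 0"
    unfolding u_def by (rule d_weights[of _ _ _ _ i]) (use i assms cube_weight_check in auto)
  thus ?thesis using False by (simp add: dval_def)
next
  case True
  have *: "(sort [s, t, x, y], dval s t x y) \<in> set
      ([([-13, -13, 13, 13], 2), ([-11, -11, 11, 11], 2), ([-7, -7, 7, 7], 2), ([-5, -5, 5, 5], 2),
        ([-13, -11, 11, 13], -1), ([-13, -7, 7, 13], -1), ([-13, -5, 5, 13], -1),
        ([-11, -7, 7, 11], -1), ([-11, -5, 5, 11], -1), ([-7, -5, 5, 7], -1),
        ([-11, -7, 5, 13], 2), ([-13, -5, 7, 11], 2)])"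
    using bspec[OF bspec[OF bspec[OF bspec[OF dval_check assms(1)] assms(2)] assms(3)] assms(4)] True
    by (simp only: if_not_P not_not)
  show ?thesis
    using * unfolding list.set insert_iff empty_iff prod.inject
    by (elim disjE conjE FalseE; simp only: d_sort d_table; simp)
qed


section \<open>Transport of the values of \<open>d\<close> by simple reflections\<close>

definition opposite_pairs :: "int list \<Rightarrow> int list \<Rightarrow> complex" where
  "opposite_pairs x y = d (v x) (v y) (v (map uminus y)) (v (map uminus x))"

lemma map_uminus_uminus: "map uminus (map uminus x) = (x :: int list)"
  by (simp add: comp_def)

lemma opposite_pairs_sym:
  "opposite_pairs y x = opposite_pairs x y" "opposite_pairs (map uminus x) y = opposite_pairs x y"
  "opposite_pairs x (map uminus y) = opposite_pairs x y"
  unfolding opposite_pairs_def map_uminus_uminus by (simp_all only: d_sym)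

lemma reflect_neg:
  assumes "x \<in> set e7_weights" "i < 7"
  shows "reflect i (map uminus x) = map uminus (reflect i x)"
  using e7_weightD(1)[OF assms(1)] assms(2)
  by (auto simp: reflect_def wplus_def wminus_def e7_roots_length intro!: nth_equalityI)

lemma reflect_mem: "x \<in> set e7_weights \<Longrightarrow> i < 7 \<Longrightarrow> reflect i x \<in> set e7_weights"
  by (simp add: reflect_def e7_weight_lower e7_weightD(7))

lemma F_reflect:
  assumes x: "x \<in> set e7_weights" "i < 7" "x ! i = 1"
  shows "F i *v v x = v (reflect i x)" "F i *v v (map uminus (reflect i x)) = v (map uminus x)"
    "F i *v v (reflect i x) = 0" "F i *v v (map uminus x) = 0"
proof -
  have l: "length x = 7" using x e7_weightD(1) by blast
  show "F i *v v x = v (reflect i x)" using F_v x by (simp add: reflect_def)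
  have m: "reflect i x \<in> set e7_weights" "map uminus (reflect i x) \<in> set e7_weights" "map uminus x \<in> set e7_weights"
    using reflect_mem x e7_weightD(2) by auto
  have n: "reflect i x ! i = -1" "map uminus (reflect i x) ! i = 1" "map uminus x ! i = -1"
    using x l by (auto simp: reflect_def wminus_nth e7_roots_length e7_roots_diag wminus_def)
  have "wminus (map uminus (reflect i x)) (e7_roots ! i) = map uminus x"
    using x l by (intro nth_equalityI) (auto simp: reflect_def wminus_def e7_roots_length)
  thus "F i *v v (map uminus (reflect i x)) = v (map uminus x)"
    "F i *v v (reflect i x) = 0" "F i *v v (map uminus x) = 0"
    using F_v m n x(2) by auto
qed

lemma F_weight_zero: "x \<in> set e7_weights \<Longrightarrow> i < 7 \<Longrightarrow> x ! i = 0 \<Longrightarrow> F i *v v x = 0 \<and> F i *v v (map uminus x) = 0"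
  using F_v e7_weightD(1,2) by auto

text \<open>Invariance under the lowering operator of the simple root makes the reflection act on
  these values by a sign: -1 if it moves exactly one of the two pairs, +1 otherwise.\<close>

lemma opposite_pairs_reflect_nonneg:
  assumes x: "x \<in> set e7_weights" and y: "y \<in> set e7_weights" and i: "i < 7"
    and "x ! i \<noteq> -1" "y ! i \<noteq> -1"
  shows "opposite_pairs (reflect i x) (reflect i y) = opposite_pairs x y \<or>
         opposite_pairs (reflect i x) (reflect i y) = - opposite_pairs x y"
proof -
  have one: "opposite_pairs (reflect i x) y = - opposite_pairs x y"
    if "x \<in> set e7_weights" "y \<in> set e7_weights" "x ! i = 1" "y ! i = 0" for x y
    using d_F[OF i, of "v x" "v y" "v (map uminus y)" "v (map uminus (reflect i x))"]
      F_reflect[OF that(1) i that(3)] F_weight_zero[OF that(2) i that(4)]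
    by (simp add: opposite_pairs_def d_zero eq_neg_iff_add_eq_0)
  have two: "opposite_pairs (reflect i x) (reflect i y) = opposite_pairs x y" if "x ! i = 1" "y ! i = 1"
  proof -
    let ?x = "v x" and ?X = "v (map uminus x)" and ?y = "v y" and ?Y = "v (map uminus y)"
    let ?x' = "v (reflect i x)" and ?X' = "v (map uminus (reflect i x))"
      and ?y' = "v (reflect i y)" and ?Y' = "v (map uminus (reflect i y))"
    note F = F_reflect[OF x i that(1)] F_reflect[OF y i that(2)]
    \<comment> \<open>Invariance at four quadruples with total value 2 at coroot i; eliminating the
      four mixed values leaves the claim.\<close>
    have "d ?x' ?X' ?y ?Y + d ?x ?X ?y ?Y + d ?x ?X' ?y' ?Y = 0"
      "d ?x' ?X' ?y' ?Y' + d ?x ?X ?y' ?Y' + d ?x ?X' ?y' ?Y = 0"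
      "d ?x' ?X ?y ?Y' + d ?x ?X ?y' ?Y' + d ?x ?X ?y ?Y = 0"
      "d ?x' ?X ?y ?Y' + d ?x' ?X' ?y' ?Y' + d ?x' ?X' ?y ?Y = 0"
      using d_F[OF i, of ?x ?X' ?y ?Y] d_F[OF i, of ?x ?X' ?y' ?Y'] d_F[OF i, of ?x ?X ?y ?Y'] d_F[OF i, of ?x' ?X' ?y ?Y']
      by (simp_all add: F d_zero)
    hence "d ?x' ?X' ?y' ?Y' = d ?x ?X ?y ?Y" by algebra
    thus ?thesis unfolding opposite_pairs_def by (simp only: d_sym)
  qed
  have "x ! i = 0 \<or> x ! i = 1" "y ! i = 0 \<or> y ! i = 1" using e7_weightD(5)[OF x i] e7_weightD(5)[OF y i] assms by auto
  moreover have "reflect i z = z" if "z ! i = 0" for z using that by (simp add: reflect_def)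
  ultimately show ?thesis
    using two one[OF x y] one[OF y x] opposite_pairs_sym(1) by metis
qed

lemma opposite_pairs_reflect:
  assumes x: "x \<in> set e7_weights" and y: "y \<in> set e7_weights" and i: "i < 7"
    and 0: "opposite_pairs (reflect i x) (reflect i y) = 0"
  shows "opposite_pairs x y = 0"
proof -
  \<comment> \<open>The value does not change when x or y is replaced by its negative, so the value
    -1 at coroot i can be avoided.\<close>
  define nn where "nn z = (if z ! i = -1 then map uminus z else z)" for z :: "int list"
  have nn: "nn z \<in> set e7_weights \<and> nn z ! i \<noteq> -1" if "z \<in> set e7_weights" for z
    using that e7_weightD(1,2) i by (auto simp: nn_def)
  have "opposite_pairs (reflect i (nn x)) (reflect i (nn y)) = opposite_pairs (reflect i x) (reflect i y)"
    "opposite_pairs (nn x) (nn y) = opposite_pairs x y"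
    using reflect_neg[OF x i] reflect_neg[OF y i] by (auto simp: nn_def opposite_pairs_sym simp del: list.map)
  thus ?thesis using opposite_pairs_reflect_nonneg[of "nn x" "nn y" i] nn x y i 0 by auto
qed

lemma opposite_pairs_fold_reflect:
  "x \<in> set e7_weights \<Longrightarrow> y \<in> set e7_weights \<Longrightarrow> \<forall>i\<in>set r. i < 7 \<Longrightarrow>
     opposite_pairs (fold reflect r x) (fold reflect r y) = 0 \<Longrightarrow> opposite_pairs x y = 0"
  by (induction r arbitrary: x y) (auto intro: opposite_pairs_reflect reflect_mem)

lemma sum_1_4: "(\<Sum>j\<in>{1..4::nat}. f j) = f 1 + f 2 + f 3 + (f 4 :: complex)"
proof -
  have "{1..4::nat} = {1, 2, 3, 4}" by auto
  thus ?thesis by simp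
qed

lemma \<kappa>_nonzero: "\<kappa> \<noteq> 0"
proof
  assume \<kappa>: "\<kappa> = 0"
  define G where "G w = d (w 1) (w 2) (w 3) (w (4::nat))" for w
  have der: "derivation 4 A G w = d (A *v w 1) (w 2) (w 3) (w 4) + d (w 1) (A *v w 2) (w 3) (w 4)
      + d (w 1) (w 2) (A *v w 3) (w 4) + d (w 1) (w 2) (w 3) (A *v w 4)" for A w
    unfolding derivation_def sum_1_4 G_def by simp
  have "G w = 0" for w
  proof (rule invariant_determined[of 2])
    have "linear_form (\<lambda>x. G (w(i := x)))" if "i \<in> {1..4}" for i w
    proof -
      from that have "i = 1 \<or> i = 2 \<or> i = 3 \<or> i = 4" by auto
      thus ?thesis by (elim disjE) (simp_all add: G_def d_linear)
    qed
    thus "multilinear (2 + 2) G" by (simp add: multilinear_def)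
    show "derivation (2 + 2) (F i) G w = 0" if "i < 7" for i w using d_F[OF that] by (simp add: der)
    show "derivation (2 + 2) (H i) G w = 0" if "i < 7" for i w using d_H[OF that] by (simp add: der)
    fix p w assume p: "p \<in> set (closed_paths 2)" and w: "\<And>j. j \<in> {1..2 + 2} \<Longrightarrow> w j = v (p ! (j - 1))"
    obtain r where r: "p = [p ! 0, p ! 1, map uminus (p ! 1), map uminus (p ! 0)]" "\<forall>i\<in>set r. i < 7"
      "fold reflect r (p ! 0) \<in> cube_weight ` set cube" "fold reflect r (p ! 1) \<in> cube_weight ` set cube"
      using bspec[OF closed_paths_2_check p] by blast
    have mem: "p ! 0 \<in> set e7_weights" "p ! 1 \<in> set e7_weights"
    proof -
      obtain p1 p2 where p12: "p = p1 @ rev (map (map uminus) p2)" "p1 \<in> set (dominant_paths 2)" "p2 \<in> set (dominant_paths 2)"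
        using p by (auto simp: closed_paths_def)
      have "set p1 \<subseteq> set e7_weights" "set p2 \<subseteq> set e7_weights"
        using p12 unfolding dominant_paths_iff by blast+
      hence "set p \<subseteq> set e7_weights" unfolding p12(1) by (auto intro: e7_weightD(2))
      thus "p ! 0 \<in> set e7_weights" "p ! 1 \<in> set e7_weights" using arg_cong[OF r(1), of set] by auto
    qed
    obtain s t where st: "s \<in> set cube" "t \<in> set cube" "fold reflect r (p ! 0) = cube_weight s" "fold reflect r (p ! 1) = cube_weight t"
      using r(3,4) by blast
    have "opposite_pairs (cube_weight s) (cube_weight t) = d (u s) (u t) (u (-t)) (u (-s))"
      using cube_weight_check st(1,2) by (simp add: opposite_pairs_def u_def)
    also have "\<dots> = 0" using d_cube[of s t "-t" "-s"] cube_weight_check st(1,2) \<kappa> by simp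
    finally have "opposite_pairs (p ! 0) (p ! 1) = 0"
      using opposite_pairs_fold_reflect[OF mem r(2)] st by simp
    moreover have "p ! 2 = map uminus (p ! 1)" "p ! 3 = map uminus (p ! 0)"
      using arg_cong[OF r(1), of "\<lambda>p. p ! 2"] arg_cong[OF r(1), of "\<lambda>p. p ! 3"] by simp_all
    ultimately show "G w = 0" using w[of 1] w[of 2] w[of 3] w[of 4] by (simp add: G_def opposite_pairs_def)
  qed
  hence "d x y z w = 0" for x y z w
    using spec[of "\<lambda>w. G w = 0" "\<lambda>i. if i = 1 then x else if i = 2 then y else if i = 3 then z else w"]
    by (simp add: G_def)
  thus False using d_nonzero by blast
qed

text \<open>The weight of a triple product is the sum of the three weights, so the product is a
  multiple of a cube vector or zero. Pairing with the opposite cube vector gives the coefficient;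
  \<open>cube_sign\<close>, being 1 or -1, is its own inverse.\<close>

lemma dual3_cube:
  assumes s: "s \<in> set cube" "t \<in> set cube" "x \<in> set cube"
  shows "dual3 \<omega> d (u s) (u t) (u x) = (if s + t + x \<in> set cube
    then (\<kappa> / \<omega>\<^sub>0 * of_int (dval s t x (- (s + t + x)) * cube_sign (s + t + x))) *s u (s + t + x) else 0)"
proof (rule sympl_eqI[OF sympl])
  fix y
  let ?W = "map uminus (wtotal [cube_weight s, cube_weight t, cube_weight x])"
  let ?c = "\<kappa> / \<omega>\<^sub>0 * of_int (dval s t x (- (s + t + x)) * cube_sign (s + t + x))"
  let ?z = "if s + t + x \<in> set cube then ?c *s u (s + t + x) else 0"
  have mem: "cube_weight s \<in> set e7_weights" "cube_weight t \<in> set e7_weights" "cube_weight x \<in> set e7_weights"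
    using s cube_weight_check by auto
  have chk: "if s + t + x \<in> set cube then ?W = cube_weight (- (s + t + x)) else ?W \<notin> set e7_weights"
    using cube_sum_check s by blast
  have zero: "d (u s) (u t) (u x) (v \<nu>) = 0" if \<nu>: "\<nu> \<in> set e7_weights" "\<nu> \<noteq> ?W" for \<nu>
  proof -
    have W: "length (wtotal [cube_weight s, cube_weight t, cube_weight x]) = 7" using wtotal mem by simp
    have "\<exists>i<7. wtotal [cube_weight s, cube_weight t, cube_weight x, \<nu>] ! i \<noteq> 0"
    proof (rule ccontr)
      assume n: "\<not> ?thesis"
      have "\<nu> = ?W"
      proof (rule nth_equalityI)
        fix i assume "i < length \<nu>"
        hence i: "i < 7" using e7_weightD(1)[OF \<nu>(1)] by simp
        thus "\<nu> ! i = ?W ! i" using n W wtotal[of "[cube_weight s, cube_weight t, cube_weight x, \<nu>]"]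
            wtotal[of "[cube_weight s, cube_weight t, cube_weight x]"] mem \<nu>(1) by fastforce
      qed (use W e7_weightD(1)[OF \<nu>(1)] in simp)
      thus False using \<nu>(2) by simp
    qed
    thus ?thesis unfolding u_def using d_weights mem \<nu>(1) by blast
  qed
  have "d (u s) (u t) (u x) (v \<nu>) = \<omega> ?z (v \<nu>)" if \<nu>: "\<nu> \<in> set e7_weights" for \<nu>
  proof (cases "s + t + x \<in> set cube")
    case False
    hence "\<nu> \<noteq> ?W" using chk \<nu> by auto
    thus ?thesis using False zero \<nu> by (simp add: \<omega>_linear)
  next
    case True
    have m: "- (s + t + x) \<in> set cube" "map uminus (cube_weight (s + t + x)) = cube_weight (- (s + t + x))"
      "cube_weight (s + t + x) \<in> set e7_weights" using cube_weight_check True by blast+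
    show ?thesis
    proof (cases "\<nu> = ?W")
      case W: True
      hence "v \<nu> = u (- (s + t + x))" using chk True by (simp add: u_def)
      thus ?thesis using True d_cube[OF s m(1)] \<omega>_cube[OF True m(1)] \<omega>\<^sub>0_nonzero
        by (simp add: \<omega>_linear wval_def cube_sign_def)
    next
      case False
      hence "\<omega> (u (s + t + x)) (v \<nu>) = 0"
        unfolding u_def using \<omega>_weights[OF m(3) \<nu>] chk True m(2) by simp
      thus ?thesis using zero[OF \<nu> False] True by (simp add: \<omega>_linear)
    qed
  qed
  moreover obtain c where c: "y = (\<Sum>\<nu>\<in>set e7_weights. c \<nu> *s v \<nu>)" using v_spans by blast
  ultimately have "d (u s) (u t) (u x) y = \<omega> ?z y"
    unfolding c linear_form_sum[OF d_linear(4)] linear_form_sum[OF \<omega>_linear(1)] by (intro sum.cong refl) simp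
  thus "\<omega> (dual3 \<omega> d (u s) (u t) (u x)) y = \<omega> ?z y" by (simp only: dual3[OF sympl quartic])
qed

end

section \<open>A basis of the invariant six-linear forms\<close>

type_synonym sextuple = "nat \<times> nat \<times> nat \<times> nat \<times> nat \<times> nat"

definition pairing_list :: "sextuple list" where
  "pairing_list =
    [(1, 2, 3, 4, 5, 6), (1, 2, 3, 5, 4, 6), (1, 2, 3, 6, 4, 5), (1, 3, 2, 4, 5, 6), (1, 3, 2, 5, 4,
    6), (1, 3, 2, 6, 4, 5), (1, 4, 2, 3, 5, 6), (1, 4, 2, 5, 3, 6), (1, 4, 2, 6, 3, 5), (1, 5, 2, 3,
    4, 6), (1, 5, 2, 4, 3, 6), (1, 5, 2, 6, 3, 4), (1, 6, 2, 3, 4, 5), (1, 6, 2, 4, 3, 5), (1, 6, 2,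
    5, 3, 4)]"

definition quadruple_list :: "sextuple list" where
  "quadruple_list =
    [(1, 2, 3, 4, 5, 6), (1, 3, 2, 4, 5, 6), (1, 4, 2, 3, 5, 6), (1, 5, 2, 3, 4, 6), (1, 6, 2, 3, 4,
    5), (2, 3, 1, 4, 5, 6), (2, 4, 1, 3, 5, 6), (2, 5, 1, 3, 4, 6), (2, 6, 1, 3, 4, 5), (3, 4, 1, 2,
    5, 6), (3, 5, 1, 2, 4, 6), (3, 6, 1, 2, 4, 5), (4, 5, 1, 2, 3, 6), (4, 6, 1, 2, 3, 5), (5, 6, 1,
    2, 3, 4)]"

text \<open>
  The other five forms of order two depend on these and the 30 forms of order zero and one. The
  sample points below come from a computer search.
\<close>

definition triple_list :: "sextuple list" where
  "triple_list = [(1, 2, 3, 4, 5, 6), (1, 2, 4, 3, 5, 6), (1, 2, 6, 3, 4, 5), (1, 3, 5, 2, 4, 6), (1, 3, 6, 2, 4,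
    5)]"

definition sample_points :: "int list list" where
  "sample_points =
    [[11, -13, 5, -11, -5, -13], [11, 5, -13, -13, -11, -5], [11, 5, -7, -11, -13, -11], [5, 11, -7,
    -11, -13, -11], [11, -13, 5, -11, -13, -5], [5, -7, -11, 7, -7, -13], [5, -7, -11, -7, -13, 7],
    [-13, 11, -13, -11, 7, -7], [5, -7, -11, -13, -11, 11], [11, 5, -11, -7, -11, -13], [11, 5, -13,
    -11, -5, -13], [-13, 11, -13, 5, -5, -11], [11, -13, 7, -13, -11, -7], [5, -7, -11, -11, -13,
    11], [5, 5, -7, -11, -13, -5], [11, 7, -7, -11, -13, -13], [-13, 11, 7, -7, -11, -13], [11, 5,
    -13, -5, -11, -13], [5, -7, -13, -11, 11, -11], [11, -11, 5, -13, -13, -5]]"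

definition sample_inverse :: "int list list" where
  "sample_inverse =
    [[0, 1, 1, 1, 1, -1, -2, 0, 2, 0, 0, 3, 1, 2, 1, 0, 0, -2, 2, 4], [0, -2, -2, -1, -2, 2, 0, -1,
    2, -4, 0, -1, -4, 0, -2, 0, 0, 2, 1, 0], [0, -1, -4, -2, 0, 1, 1, -1, 2, 0, 0, 0, -1, -1, -4, 0,
    0, 2, 1, 0], [0, 1, 0, -1, 0, 0, 0, 1, -1, 0, 0, 0, 1, 0, 0, 0, 0, 2, 0, 0], [0, -1, -3, 1, -3,
    2, 1, 1, -1, 0, 0, -2, -1, -1, 1, 0, 0, 2, 0, 0], [0, -1, 1, 0, -3, -1, 0, 1, -4, 0, 0, -2, 1,
    0, 1, 4, 0, 0, -3, 0], [0, 0, -1, -1, -1, 2, 1, 1, 0, 0, 0, -1, 0, -1, -1, 0, 0, 0, 1, 0], [0,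
    -2, -5, -4, -1, 1, 0, -1, 1, 0, -4, -1, -2, 0, -5, 0, 0, 4, 0, 0], [0, 0, 0, -2, 0, -1, 1, -1,
    1, 0, 0, 1, 0, -1, 0, 0, 0, 0, 0, 0], [0, 3, 6, 5, 2, -1, -1, 2, 0, 0, 4, 3, 1, 1, 6, 0, 4, -4,
    2, 0], [-4, -3, -6, -2, -2, 2, 2, 0, 1, 0, 0, -1, -1, -2, -6, 0, 0, 4, 1, 0], [0, -1, -1, 0, -1,
    0, -1, 0, 1, 0, 0, 1, 1, 1, -1, 0, 0, 0, 1, 0], [0, 0, 0, -1, 0, -1, 1, 0, 1, 0, 0, -2, 0, -1,
    0, 0, 0, 0, 1, 0], [0, 2, 1, 1, 1, 1, 2, 0, 1, 0, 0, 0, -2, 2, 1, 0, 0, 0, 1, 0], [0, 0, 1, 0,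
    1, -2, -1, 2, 0, 0, 0, 0, 0, 1, 1, 0, 0, 0, -2, 0], [0, 1, 1, 0, 1, -1, 0, -1, 0, 0, 0, 0, 1, 0,
    1, 0, 0, -2, -1, 0], [0, -1, 0, 0, 0, -1, -1, 1, -2, 0, 0, 0, 1, 1, 0, 0, 0, 0, -1, 0], [0, 1,
    2, 1, 2, -1, -1, 0, 0, 0, 0, 1, 1, 1, 2, 0, 0, -2, 0, 0], [0, 1, 0, -1, 0, 0, 0, -1, 1, 0, 0, 0,
    -1, 0, 0, 0, 0, 0, 0, 0], [0, 2, 1, 0, 1, -1, 0, -1, 1, 0, 0, 1, 0, 0, 1, 0, 0, -2, 0, 0]]"

definition sample_matrix :: "int list list" where
  "sample_matrix =
    [[0, 0, 2, 0, 0, 0, 0, 0, 0, 0, -2, 0, 0, 0, 0, 0, 0, -2, -2, 0], [0, 0, 0, 2, 0, 0, 0, 0, -2,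
    0, 0, 0, 0, 0, 0, 0, 0, -2, 0, 4], [0, 0, -2, 0, -2, 0, 0, 0, 0, 0, 0, 0, 0, 0, 0, 0, -2, -2, 0,
    -2], [0, 0, 0, 0, 0, 0, -2, 0, -2, 0, 0, 0, 0, 0, 0, 0, -2, -2, -4, 2], [0, 0, 2, 0, 0, 0, 0, 0,
    0, 0, 0, -2, 0, 0, 0, 0, 0, 4, 0, -2], [0, 0, 0, 0, 0, 0, 2, 0, 0, 0, 0, 0, -2, 0, 0, 2, -2, 2,
    2, -4], [0, 0, 0, 0, 0, 0, 0, 0, 2, 0, 0, 0, 0, 2, 0, 2, 0, -2, -4, 0], [0, 0, 0, 0, 0, 0, 2, 0,
    0, 0, 0, 0, 0, 0, 2, -2, 0, 0, -2, 2], [0, 0, 0, 0, 0, 0, 0, 0, 0, 0, 0, 2, 0, 0, 2, 2, -4, 0,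
    0, -2], [0, -2, 0, -2, 0, 0, 0, 0, 0, 0, 0, 0, 0, 0, 0, -2, 0, 0, 4, -2], [0, 0, 2, 0, 0, 0, 0,
    -2, 0, 0, 0, 0, 0, 0, 0, 0, 2, 0, 4, -2], [0, 0, 0, 0, 0, 0, 0, 0, 2, 0, 0, 0, -2, 0, 0, -2, 0,
    0, -2, 2], [0, 0, 0, 2, 0, 0, 0, 0, 0, 0, 0, 2, 0, 0, 0, 4, -2, 0, -2, -2], [0, 0, 0, 0, 0, 0,
    0, 0, 0, 0, 0, 2, 0, 2, 0, 2, 2, 0, 2, -2], [0, 0, 0, 0, 2, 0, 0, 0, 2, 0, 0, 0, 0, 0, 0, 0, 0,
    4, 2, -2], [0, 0, 2, 0, 0, 2, 0, 0, 0, 0, 0, 0, 0, 0, 0, -2, -2, 4, 0, 0], [0, 0, 0, 0, 0, 0, 0,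
    2, 0, 2, 0, 0, 0, 0, 0, 4, 0, -2, 0, -2], [0, 0, 0, 2, 0, 0, -2, 0, 0, 0, 0, 0, 0, 0, 0, 0, -2,
    0, 0, -2], [0, 0, 0, 0, 0, 0, 0, 0, 0, 0, 0, 0, 2, 0, -2, -4, 2, 2, 0, 2], [2, 0, 0, 0, 0, 0, 0,
    0, 0, 0, 0, -2, 0, 0, 0, 2, 0, -2, 0, -2]]"

definition cube_point :: "int list \<Rightarrow> nat \<Rightarrow> int" where
  "cube_point T j = T ! (j - 1)"

text \<open>An antipodal pair on each block: since \<open>\<omega>\<close> vanishes on all other
  pairs of cube vectors, only the form of the same pairing survives. The signs 1, -1, -1 of 13, 11,
  7 multiply to 1.\<close>

definition pairing_point :: "sextuple \<Rightarrow> nat \<Rightarrow> int" where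
  "pairing_point = (\<lambda>(i, j, k, l, p, q). (\<lambda>_. 0)(i := 13, j := -13, k := 11, l := -11, p := 7, q := -7))"

definition val0 :: "sextuple \<Rightarrow> (nat \<Rightarrow> int) \<Rightarrow> int" where
  "val0 = (\<lambda>(i, j, k, l, p, q) t. wval (t i) (t j) * wval (t k) (t l) * wval (t p) (t q))"

definition val1 :: "sextuple \<Rightarrow> (nat \<Rightarrow> int) \<Rightarrow> int" where
  "val1 = (\<lambda>(i, j, k, l, p, q) t. wval (t i) (t j) * dval (t k) (t l) (t p) (t q))"

text \<open>By \<open>dual3_cube\<close>: s is the code of the triple product of the first three
  vectors.\<close>

definition val2 :: "sextuple \<Rightarrow> (nat \<Rightarrow> int) \<Rightarrow> int" where
  "val2 = (\<lambda>(i, j, k, l, p, q) t. let s = t i + t j + t k in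
     if s \<in> set cube then dval (t i) (t j) (t k) (- s) * cube_sign s * dval s (t l) (t p) (t q) else 0)"

definition higher_val :: "nat \<Rightarrow> (nat \<Rightarrow> int) \<Rightarrow> int" where
  "higher_val k = (if k < 15 then val1 (quadruple_list ! k) else val2 (triple_list ! (k - 15)))"

text \<open>
  Rows belong to the sample points, columns to the last twenty basis forms; an entry is, up to a
  scalar, the value at the point of the image of the form under the transvection \<open>y \<mapsto> \<omega> y x x\<close>,
  where \<open>x\<close> is the vector of weight \<open>13\<close>. This element of \<open>sp\<close> kills the forms of order zero.
\<close>

lemma sample_matrix_check:
  "\<forall>r\<in>set [0..<20]. \<forall>k\<in>set [0..<20]. sample_matrix ! r ! k =
     (\<Sum>j\<leftarrow>[1..<7]. if cube_point (sample_points ! r) j = -13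
        then higher_val k ((cube_point (sample_points ! r))(j := 13)) else 0)"
  by code_simp

text \<open>The factor 8 clears the denominators of the inverse; a left inverse suffices to isolate
  the coefficients.\<close>

lemma sample_inverse_check:
  "\<forall>l\<in>set [0..<20]. \<forall>k\<in>set [0..<20].
     (\<Sum>r\<leftarrow>[0..<20]. sample_inverse ! l ! r * sample_matrix ! r ! k) = (if l = k then 8 else 0)"
  by code_simp

lemma sample_points_check: "\<forall>r\<in>set [0..<20]. \<forall>j\<in>set [1..<7]. cube_point (sample_points ! r) j \<in> set cube"
  by code_simp

lemma pairing_point_check:
  "\<forall>k\<in>set [0..<15]. (\<forall>j\<in>set [1..<7]. pairing_point (pairing_list ! k) j \<in> set cube) \<and>
     (\<forall>l\<in>set [0..<15]. val0 (pairing_list ! l) (pairing_point (pairing_list ! k)) = (if k = l then 1 else 0))"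
  by code_simp

lemma sextuple_lists_check:
  "\<forall>(i, j, k, l, p, q)\<in>set pairing_list. set [i, j, k, l, p, q] = set [1..<7] \<and> i < j \<and> k < l \<and> p < q \<and> i < k \<and> k < p"
  "\<forall>(i, j, k, l, p, q)\<in>set quadruple_list. set [i, j, k, l, p, q] = set [1..<7] \<and> i < j \<and> k < l \<and> l < p \<and> p < q"
  "\<forall>(i, j, k, l, p, q)\<in>set triple_list. set [i, j, k, l, p, q] = set [1..<7] \<and> i < j \<and> j < k \<and> l < p \<and> p < q \<and> i < l"
  "length pairing_list = 15" "length quadruple_list = 15" "length triple_list = 5"
  by code_simp+

section \<open>Centralizers and invariant forms\<close>

lemma sum_1_6: "(\<Sum>j\<in>{1..6::nat}. f j) = f 1 + f 2 + f 3 + f 4 + f 5 + (f 6 :: complex)"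
proof -
  have "{1..6::nat} = {1, 2, 3, 4, 5, 6}" by auto
  thus ?thesis by (simp add: add.assoc)
qed

lemma six_linear_multilinear: "G \<in> six_linear_forms \<Longrightarrow> multilinear 6 G"
  by (simp add: six_linear_forms_def multilinear_def)

lemma linear_form_arith:
  "linear_form \<phi> \<Longrightarrow> linear_form (\<lambda>x. c * \<phi> x)" "linear_form \<phi> \<Longrightarrow> linear_form (\<lambda>x. \<phi> x * c)"
  "linear_form \<phi> \<Longrightarrow> linear_form \<psi> \<Longrightarrow> linear_form (\<lambda>x. \<phi> x + \<psi> x)" "linear_form (\<lambda>x. 0)"
  by (simp_all add: linear_form_iff algebra_simps)

lemma linear_form_combination:
  "(\<And>k. k \<in> I \<Longrightarrow> linear_form (\<phi> k)) \<Longrightarrow> linear_form (\<lambda>x. \<Sum>k\<in>I. a k * \<phi> k x)"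
  unfolding linear_form_iff by (simp add: distrib_left sum.distrib sum_distrib_left mult.left_commute)

lemma six_linear_combination:
  assumes "\<And>k. k \<in> I \<Longrightarrow> G k \<in> six_linear_forms"
  shows "(\<lambda>w. \<Sum>k\<in>I. a k * G k w) \<in> six_linear_forms"
proof -
  have "(\<Sum>k\<in>I. a k * G k v) = (\<Sum>k\<in>I. a k * G k w)" if "\<forall>i\<in>{1..6}. v i = w i" for v w
    using assms that by (intro sum.cong refl) (auto simp: six_linear_forms_def)
  thus ?thesis using assms by (auto simp: six_linear_forms_def intro!: linear_form_combination)
qed

lemma derivation_combination:
  "derivation n A (\<lambda>w. \<Sum>k\<in>I. a k * G k w) w = (\<Sum>k\<in>I. a k * derivation n A (G k) w)"
  unfolding derivation_def sum_distrib_left by (rule sum.swap)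

lemma tensor3_form_skew:
  fixes \<omega> :: "complex ^ 'n \<Rightarrow> complex ^ 'n \<Rightarrow> complex"
  assumes \<omega>: "symplectic_form \<omega>" and A: "A \<in> sp_algebra \<omega>"
  shows "tensor3_form \<omega> (tensor3_action A *v s) t + tensor3_form \<omega> s (tensor3_action A *v t) = 0"
proof -
  define L where "L s t = tensor3_form \<omega> (tensor3_action A *v s) t + tensor3_form \<omega> s (tensor3_action A *v t)" for s t
  have lin: "linear_form (\<lambda>s. L s t)" "linear_form (L s)" for s t
    by (simp_all add: linear_form_iff L_def tensor3_form_bilinear vec.add vec.scale algebra_simps)
  have ax: "L (axis p 1) (axis q 1) = 0" for p q :: "'n \<times> 'n \<times> 'n"
  proof -
    obtain i j k l m n where pq: "p = (i, j, k)" "q = (l, m, n)" by (metis prod_cases3)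
    have *: "\<omega> (A *v x) y = - \<omega> x (A *v y)" for x y
      using A unfolding sp_algebra_def by (simp add: eq_neg_iff_add_eq_0)
    show ?thesis
      unfolding pq tensor3_axis[symmetric] L_def tensor3_action_tensor3
      by (simp add: tensor3_form_bilinear tensor3_form_tensor3[OF \<omega>] * algebra_simps)
  qed
  have "L s t = 0"
    by (subst linear_form_coordinates[OF lin(1)], subst linear_form_coordinates[OF lin(2)]) (simp add: ax)
  thus ?thesis by (simp add: L_def)
qed

text \<open>Elements of \<open>sp_algebra\<close> are skew for \<open>\<omega>\<close>, so the
  action on the first three arguments can be shifted to the other side of the pairing, where it
  combines with that on the last three to a commutator.\<close>

lemma derivation_Phi:
  assumes \<omega>: "symplectic_form \<omega>" and A: "A \<in> sp_algebra \<omega>"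
  shows "derivation 6 A (Phi \<omega> X) w = Phi \<omega> (X ** tensor3_action A - tensor3_action A ** X) w"
proof -
  let ?T = "tensor3_action A"
  let ?s = "tensor3 (w 1) (w 2) (w 3)" and ?t = "tensor3 (w 4) (w 5) (w 6)"
  have "derivation 6 A (Phi \<omega> X) w = tensor3_form \<omega> (?T *v ?s) (X *v ?t) + tensor3_form \<omega> ?s (X *v (?T *v ?t))"
    unfolding derivation_def sum_1_6 Phi_def tensor3_action_tensor3
    by (simp add: tensor3_form_bilinear vec.add)
  also have "tensor3_form \<omega> (?T *v ?s) (X *v ?t) = - tensor3_form \<omega> ?s (?T *v (X *v ?t))"
    using tensor3_form_skew[OF assms, of ?s "X *v ?t"] by (simp add: eq_neg_iff_add_eq_0)
  also have "- tensor3_form \<omega> ?s (?T *v (X *v ?t)) + tensor3_form \<omega> ?s (X *v (?T *v ?t))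
      = tensor3_form \<omega> ?s ((X ** ?T - ?T ** X) *v ?t)"
  proof -
    have "tensor3_form \<omega> ?s (x - y) = tensor3_form \<omega> ?s x - tensor3_form \<omega> ?s y" for x y
      using tensor3_form_bilinear(2)[of \<omega> ?s "x - y" y] by simp
    thus ?thesis by (simp add: mat_vec_simps matrix_vector_mul_assoc)
  qed
  also have "\<dots> = Phi \<omega> (X ** ?T - ?T ** X) w" by (simp add: Phi_def)
  finally show ?thesis .
qed

lemma Phi_eq_zero:
  assumes "symplectic_form (\<omega> :: complex ^ 'n \<Rightarrow> complex ^ 'n \<Rightarrow> complex)" "\<And>w. Phi \<omega> X w = 0"
  shows "X = 0"
proof -
  have "Phi \<omega> 0 w = 0" for w
    using Phi_linear(2)[of \<omega> 0 0 w] by (simp add: cmat.scale_zero_left)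
  hence "Phi \<omega> X = Phi \<omega> 0" using assms(2) by auto
  thus ?thesis using bij_betw_imp_inj_on[OF Phi_bij_betw[OF assms(1)]] by (auto dest: injD)
qed

text \<open>Since \<open>Phi\<close> is injective, \<open>derivation_Phi\<close> turns commuting
  with an operator into invariance of a form.\<close>

lemma centralizer3_iff:
  fixes \<omega> :: "complex ^ 'n \<Rightarrow> complex ^ 'n \<Rightarrow> complex"
  assumes \<omega>: "symplectic_form \<omega>" and "\<A> \<subseteq> sp_algebra \<omega>"
  shows "X \<in> centralizer3 \<A> \<longleftrightarrow> (\<forall>A\<in>\<A>. \<forall>w. derivation 6 A (Phi \<omega> X) w = 0)"
proof
  have z: "Phi \<omega> (0 :: complex ^ ('n \<times> 'n \<times> 'n) ^ ('n \<times> 'n \<times> 'n)) w = 0" for w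
    using Phi_linear(2)[of \<omega> 0 0 w] by (simp add: cmat.scale_zero_left)
  show "\<forall>A\<in>\<A>. \<forall>w. derivation 6 A (Phi \<omega> X) w = 0" if "X \<in> centralizer3 \<A>"
    using that assms derivation_Phi[OF \<omega>] by (auto simp: centralizer3_def z)
  show "X \<in> centralizer3 \<A>" if "\<forall>A\<in>\<A>. \<forall>w. derivation 6 A (Phi \<omega> X) w = 0"
    unfolding centralizer3_def
  proof (intro CollectI ballI)
    fix A assume "A \<in> \<A>"
    hence "X ** tensor3_action A - tensor3_action A ** X = 0"
      using that assms derivation_Phi[OF \<omega>, of A X] by (intro Phi_eq_zero[OF \<omega>]) auto
    thus "X ** tensor3_action A = tensor3_action A ** X" by simp
  qed
qed

lemma cmat_scale_mult:
  "cmat_scale c X ** Y = cmat_scale c (X ** Y)" "X ** cmat_scale c Y = cmat_scale c (X ** Y)"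
  by (simp_all add: cmat_scale_def matrix_matrix_mult_def vec_eq_iff sum_distrib_left mult_ac)

lemma centralizer3_subalgebra: "matrix_subalgebra (centralizer3 (\<A> :: (complex ^ 'n ^ 'n) set))"
proof -
  have "X ** Y ** T = T ** (X ** Y)" if "X ** T = T ** X" "Y ** T = T ** Y"
    for X Y T :: "complex ^ ('n \<times> 'n \<times> 'n) ^ ('n \<times> 'n \<times> 'n)"
  proof -
    have "X ** Y ** T = X ** T ** Y" by (simp add: matrix_mul_assoc[symmetric] that(2))
    thus ?thesis by (simp add: that(1) matrix_mul_assoc)
  qed
  moreover have "(0 :: complex ^ ('n \<times> 'n \<times> 'n) ^ ('n \<times> 'n \<times> 'n)) ** T = T ** 0" for T
    by (simp add: matrix_matrix_mult_def vec_eq_iff)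
  moreover have "(X + Y) ** T = X ** T + Y ** T" for X Y T :: "complex ^ ('n \<times> 'n \<times> 'n) ^ ('n \<times> 'n \<times> 'n)"
    by (simp add: matrix_matrix_mult_def vec_eq_iff distrib_right sum.distrib)
  ultimately show ?thesis
    unfolding matrix_subalgebra_def cmat.subspace_def centralizer3_def
    by (simp add: cmat_scale_mult matrix_add_ldistrib matrix_mul_lid matrix_mul_rid)
qed

lemma six_distinct:
  fixes i j k l p q :: nat
  assumes "{i, j, k, l, p, q} = {1..6}"
  shows "i \<noteq> j" "i \<noteq> k" "i \<noteq> l" "i \<noteq> p" "i \<noteq> q" "j \<noteq> i" "j
    \<noteq> k" "j \<noteq> l" "j \<noteq> p" "j \<noteq> q" "k \<noteq> i" "k \<noteq> j" "k
    \<noteq> l" "k \<noteq> p" "k \<noteq> q" "l \<noteq> i" "l \<noteq> j" "l \<noteq> k" "l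
    \<noteq> p" "l \<noteq> q" "p \<noteq> i" "p \<noteq> j" "p \<noteq> k" "p \<noteq> l" "p
    \<noteq> q" "q \<noteq> i" "q \<noteq> j" "q \<noteq> k" "q \<noteq> l" "q \<noteq> p"
proof -
  have "card (set [i, j, k, l, p, q]) = length [i, j, k, l, p, q]" using assms by simp
  from card_distinct[OF this] show "i \<noteq> j" "i \<noteq> k" "i \<noteq> l" "i \<noteq> p" "i \<noteq> q" "j \<noteq> i" "j
    \<noteq> k" "j \<noteq> l" "j \<noteq> p" "j \<noteq> q" "k \<noteq> i" "k \<noteq> j" "k
    \<noteq> l" "k \<noteq> p" "k \<noteq> q" "l \<noteq> i" "l \<noteq> j" "l \<noteq> k" "l
    \<noteq> p" "l \<noteq> q" "p \<noteq> i" "p \<noteq> j" "p \<noteq> k" "p \<noteq> l" "p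
    \<noteq> q" "q \<noteq> i" "q \<noteq> j" "q \<noteq> k" "q \<noteq> l" "q \<noteq> p" by auto
qed

lemma derivation_six:
  assumes "{i, j, k, l, p, q} = {1..6::nat}"
  shows "derivation 6 A G w = G (w(i := A *v w i)) + G (w(j := A *v w j)) + G (w(k := A *v w k))
    + G (w(l := A *v w l)) + G (w(p := A *v w p)) + G (w(q := A *v w q))"
  unfolding derivation_def assms[symmetric] by (simp add: add.assoc six_distinct[OF assms])

lemma six_linear_formsI:
  assumes "{i, j, k, l, p, q} = {1..6::nat}"
    and "\<And>m w. m \<in> {i, j, k, l, p, q} \<Longrightarrow> linear_form (\<lambda>x. G (w(m := x)))"
    and "\<And>v w. v i = w i \<Longrightarrow> v j = w j \<Longrightarrow> v k = w k \<Longrightarrow> v l = w l \<Longrightarrow> v p = w p \<Longrightarrow> v q = w q \<Longrightarrow> G v = G w"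
  shows "G \<in> six_linear_forms"
proof -
  have "(\<forall>m\<in>{i, j, k, l, p, q}. \<forall>w. linear_form (\<lambda>x. G (w(m := x)))) \<and>
      (\<forall>v w. (\<forall>m\<in>{i, j, k, l, p, q}. v m = w m) \<longrightarrow> G v = G w)"
    using assms(2) by (intro conjI ballI allI impI assms(3)) auto
  thus ?thesis unfolding assms(1) six_linear_forms_def by blast
qed

lemma order_zero_six_linear:
  assumes "symplectic_form \<omega>" "{i, j, k, l, p, q} = {1..6}"
  shows "order_zero_form \<omega> i j k l p q \<in> six_linear_forms"
proof (rule six_linear_formsI[OF assms(2)])
  fix m w assume "m \<in> {i, j, k, l, p, q}"
  hence "m = i \<or> m = j \<or> m = k \<or> m = l \<or> m = p \<or> m = q" by simp
  thus "linear_form (\<lambda>x. order_zero_form \<omega> i j k l p q (w(m := x)))"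
    by (elim disjE) (simp_all add: six_distinct[OF assms(2)] order_zero_form_def linear_form_arith sympl_linear(1,2)[OF assms(1)])
qed (simp add: order_zero_form_def)

lemma order_one_six_linear:
  assumes "symplectic_form \<omega>" "symmetric_quartic_form d" "{i, j, k, l, p, q} = {1..6}"
  shows "order_one_form \<omega> d i j k l p q \<in> six_linear_forms"
proof (rule six_linear_formsI[OF assms(3)])
  fix m w assume "m \<in> {i, j, k, l, p, q}"
  hence "m = i \<or> m = j \<or> m = k \<or> m = l \<or> m = p \<or> m = q" by simp
  thus "linear_form (\<lambda>x. order_one_form \<omega> d i j k l p q (w(m := x)))"
    by (elim disjE) (simp_all add: six_distinct[OF assms(3)] order_one_form_def linear_form_arith sympl_linear(1,2)[OF assms(1)] quartic_linear[OF assms(2)])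
qed (simp add: order_one_form_def)

lemma order_two_six_linear:
  assumes \<omega>: "symplectic_form \<omega>" and d: "symmetric_quartic_form d" and b: "is_basis b"
    and six: "{i, j, k, l, p, q} = {1..6}"
  shows "order_two_form \<omega> d b i j k l p q \<in> six_linear_forms"
proof (rule six_linear_formsI[OF six])
  fix m w assume "m \<in> {i, j, k, l, p, q}"
  hence "m = i \<or> m = j \<or> m = k \<or> m = l \<or> m = p \<or> m = q" by simp
  moreover have "linear_form (\<lambda>x. d (dual3 \<omega> d x y z) r s t)" "linear_form (\<lambda>x. d (dual3 \<omega> d y x z) r s t)"
    "linear_form (\<lambda>x. d (dual3 \<omega> d y z x) r s t)" for y z r s t
    using quartic_linear(1)[OF d, of r s t] by (simp_all add: linear_form_iff dual3_linear[OF \<omega> d])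
  ultimately show "linear_form (\<lambda>x. order_two_form \<omega> d b i j k l p q (w(m := x)))"
    unfolding order_two_form_dual3[OF \<omega> d b]
    by (elim disjE) (simp_all add: six_distinct[OF six] quartic_linear[OF d])
qed (simp add: order_two_form_dual3[OF \<omega> d b])

lemma order_zero_invariant:
  assumes "A \<in> sp_algebra \<omega>" "{i, j, k, l, p, q} = {1..6}"
  shows "derivation 6 A (order_zero_form \<omega> i j k l p q) w = 0"
proof -
  have *: "\<omega> (A *v x) y = - \<omega> x (A *v y)" for x y
    using assms(1) unfolding sp_algebra_def by (simp add: eq_neg_iff_add_eq_0)
  show ?thesis
    unfolding derivation_six[OF assms(2)] order_zero_form_def
    by (simp only: fun_upd_apply six_distinct[OF assms(2)] if_True if_False refl *)
       (simp only: mult_minus_left mult_minus_right left_minus add_0 add.assoc minus_add_cancel)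
qed

lemma order_one_invariant:
  assumes "A \<in> sp_algebra \<omega>" "{i, j, k, l, p, q} = {1..6}"
    and d: "\<And>a b c e. d (A *v a) b c e + d a (A *v b) c e + d a b (A *v c) e + d a b c (A *v e) = 0"
  shows "derivation 6 A (order_one_form \<omega> d i j k l p q) w = 0"
proof -
  have *: "\<omega> (A *v x) y = - \<omega> x (A *v y)" for x y
    using assms(1) unfolding sp_algebra_def by (simp add: eq_neg_iff_add_eq_0)
  have "derivation 6 A (order_one_form \<omega> d i j k l p q) w =
      \<omega> (w i) (w j) * (d (A *v w k) (w l) (w p) (w q) + d (w k) (A *v w l) (w p) (w q)
        + d (w k) (w l) (A *v w p) (w q) + d (w k) (w l) (w p) (A *v w q))"
    unfolding derivation_six[OF assms(2)] order_one_form_def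
    by (simp only: fun_upd_apply six_distinct[OF assms(2)] if_True if_False refl *)
       (simp only: mult_minus_left left_minus add_0 distrib_left)
  thus ?thesis using d by simp
qed

lemma order_two_invariant:
  assumes \<omega>: "symplectic_form \<omega>" and q: "symmetric_quartic_form d" and b: "is_basis b"
    and A: "A \<in> sp_algebra \<omega>" and six: "{i, j, k, l, p, q} = {1..6}"
    and d: "\<And>a b c e. d (A *v a) b c e + d a (A *v b) c e + d a b (A *v c) e + d a b c (A *v e) = 0"
  shows "derivation 6 A (order_two_form \<omega> d b i j k l p q) w = 0"
proof -
  have *: "\<omega> (A *v x) y = - \<omega> x (A *v y)" for x y
    using A unfolding sp_algebra_def by (simp add: eq_neg_iff_add_eq_0)
  \<comment> \<open>The triple product is equivariant because both \<open>\<omega>\<close> and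
    \<open>d\<close> are invariant.\<close>
  have eq: "A *v dual3 \<omega> d x y z = dual3 \<omega> d (A *v x) y z + dual3 \<omega> d x (A *v y) z + dual3 \<omega> d x y (A *v z)" for x y z
  proof (rule sympl_eqI[OF \<omega>])
    fix t
    show "\<omega> (A *v dual3 \<omega> d x y z) t = \<omega> (dual3 \<omega> d (A *v x) y z + dual3 \<omega> d x (A *v y) z + dual3 \<omega> d x y (A *v z)) t"
      using d[of x y z t] by (simp only: * sympl_linear(3)[OF \<omega>] dual3[OF \<omega> q]) algebra
  qed
  have lin: "d (x + y) r s t = d x r s t + d y r s t" for x y r s t
    using quartic_linear(1)[OF q] unfolding linear_form_iff by blast
  show ?thesis
    using d[of "dual3 \<omega> d (w i) (w j) (w k)" "w l" "w p" "w q"]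
    unfolding derivation_six[OF six] order_two_form_dual3[OF \<omega> q b] eq
    by (simp only: fun_upd_apply six_distinct[OF six] if_True if_False refl lin)
qed

section \<open>Independence and spanning\<close>

locale e7_forms_basis = e7_forms F H v \<omega> d
  for F H :: "nat \<Rightarrow> complex ^ 'n ^ 'n" and v \<omega> d +
  fixes b :: "'n \<Rightarrow> complex ^ 'n"
  assumes basis: "is_basis b"
begin

definition zero_form :: "sextuple \<Rightarrow> (nat \<Rightarrow> complex ^ 'n) \<Rightarrow> complex" where
  "zero_form = (\<lambda>(i, j, k, l, p, q). order_zero_form \<omega> i j k l p q)"

definition one_form :: "sextuple \<Rightarrow> (nat \<Rightarrow> complex ^ 'n) \<Rightarrow> complex" where
  "one_form = (\<lambda>(i, j, k, l, p, q). order_one_form \<omega> d i j k l p q)"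

definition two_form :: "sextuple \<Rightarrow> (nat \<Rightarrow> complex ^ 'n) \<Rightarrow> complex" where
  "two_form = (\<lambda>(i, j, k, l, p, q). order_two_form \<omega> d b i j k l p q)"

definition higher_form :: "nat \<Rightarrow> (nat \<Rightarrow> complex ^ 'n) \<Rightarrow> complex" where
  "higher_form k = (if k < 15 then one_form (quadruple_list ! k) else two_form (triple_list ! (k - 15)))"

definition basis_form :: "nat \<Rightarrow> (nat \<Rightarrow> complex ^ 'n) \<Rightarrow> complex" where
  "basis_form k = (if k < 15 then zero_form (pairing_list ! k) else higher_form (k - 15))"

definition is_six :: "sextuple \<Rightarrow> bool" where
  "is_six = (\<lambda>(i, j, k, l, p, q). {i, j, k, l, p, q} = {1..6})"

lemma sextuple_list_mem:
  "k < 15 \<Longrightarrow> pairing_list ! k \<in> pairings6" "k < 15 \<Longrightarrow> quadruple_list ! k \<in> pair_quadruples6"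
  "k < 5 \<Longrightarrow> triple_list ! k \<in> triple_pairs6"
proof -
  have s: "set [1..<7] = {1..6::nat}" by auto
  have "\<forall>x\<in>set pairing_list. x \<in> pairings6" "\<forall>x\<in>set quadruple_list. x \<in> pair_quadruples6"
    "\<forall>x\<in>set triple_list. x \<in> triple_pairs6"
    using sextuple_lists_check(1-3) unfolding s pairings6_def pair_quadruples6_def triple_pairs6_def
    by (simp_all add: case_prod_unfold)
  thus "k < 15 \<Longrightarrow> pairing_list ! k \<in> pairings6" "k < 15 \<Longrightarrow> quadruple_list ! k \<in> pair_quadruples6"
    "k < 5 \<Longrightarrow> triple_list ! k \<in> triple_pairs6"
    using sextuple_lists_check(4-6) nth_mem by metis+
qed

lemma is_sixI: "x \<in> pairings6 \<Longrightarrow> is_six x" "x \<in> pair_quadruples6 \<Longrightarrow> is_six x" "x \<in> triple_pairs6 \<Longrightarrow> is_six x"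
  by (auto simp: is_six_def pairings6_def pair_quadruples6_def triple_pairs6_def simp del: atLeastAtMost_iff)

lemma sextuple_list_is_six: "k < 15 \<Longrightarrow> is_six (pairing_list ! k)" "k < 15 \<Longrightarrow> is_six (quadruple_list ! k)"
  "k < 5 \<Longrightarrow> is_six (triple_list ! k)"
  by (blast intro: is_sixI sextuple_list_mem)+

lemma forms_six_linear:
  "is_six x \<Longrightarrow> zero_form x \<in> six_linear_forms" "is_six x \<Longrightarrow> one_form x \<in> six_linear_forms"
  "is_six x \<Longrightarrow> two_form x \<in> six_linear_forms"
  unfolding is_six_def zero_form_def one_form_def two_form_def
  using order_zero_six_linear[OF sympl] order_one_six_linear[OF sympl quartic] order_two_six_linear[OF sympl quartic basis]
  by (cases x, simp)+

lemma higher_form_six_linear: "k < 20 \<Longrightarrow> higher_form k \<in> six_linear_forms"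
  by (auto simp: higher_form_def intro!: forms_six_linear sextuple_list_is_six)

lemma basis_form_six_linear: "k < 35 \<Longrightarrow> basis_form k \<in> six_linear_forms"
  by (auto simp: basis_form_def intro!: forms_six_linear sextuple_list_is_six higher_form_six_linear)

lemma zero_form_invariant: "A \<in> sp_algebra \<omega> \<Longrightarrow> is_six x \<Longrightarrow> derivation 6 A (zero_form x) w = 0"
  using order_zero_invariant[of A \<omega>] by (cases x) (simp add: zero_form_def is_six_def)

lemma higher_forms_invariant:
  assumes "A \<in> sp_algebra \<omega>" "is_six x"
    and "\<And>a b c e. d (A *v a) b c e + d a (A *v b) c e + d a b (A *v c) e + d a b c (A *v e) = 0"
  shows "derivation 6 A (one_form x) w = 0" "derivation 6 A (two_form x) w = 0"
proof -
  obtain i j k l p q where x: "x = (i, j, k, l, p, q)" by (metis prod_cases6)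
  have six: "{i, j, k, l, p, q} = {1..6}" using assms(2) by (simp add: x is_six_def)
  show "derivation 6 A (one_form x) w = 0"
    unfolding x one_form_def case_prod_conv by (rule order_one_invariant[where d = d and \<omega> = \<omega> and A = A, OF assms(1) six assms(3)])
  show "derivation 6 A (two_form x) w = 0"
    unfolding x two_form_def case_prod_conv
    by (rule order_two_invariant[where d = d and \<omega> = \<omega> and A = A and b = b, OF sympl quartic basis assms(1) six assms(3)])
qed

lemma basis_form_invariant:
  assumes "A \<in> sp_algebra \<omega>" "k < 35"
    and "\<And>a b c e. d (A *v a) b c e + d a (A *v b) c e + d a b (A *v c) e + d a b c (A *v e) = 0"
  shows "derivation 6 A (basis_form k) w = 0"
proof -
  note higher = higher_forms_invariant[OF assms(1) _ assms(3)]
  have "k < 15 \<or> 15 \<le> k \<and> k < 30 \<or> 30 \<le> k" by auto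
  thus ?thesis
    using zero_form_invariant[OF assms(1) sextuple_list_is_six(1)[of k]] higher(1)[OF sextuple_list_is_six(2)[of "k - 15"]]
      higher(2)[OF sextuple_list_is_six(3)[of "k - 30"]] assms(2)
    by (auto simp: basis_form_def higher_form_def)
qed

section \<open>Values at cube vectors and the derivative along the transvection\<close>

definition cube_values :: "(nat \<Rightarrow> int) \<Rightarrow> nat \<Rightarrow> complex ^ 'n" where
  "cube_values t j = u (t j)"

lemma zero_form_cube:
  assumes "is_six x" "\<And>j. j \<in> {1..6} \<Longrightarrow> t j \<in> set cube"
  shows "zero_form x (cube_values t) = \<omega>\<^sub>0 ^ 3 * of_int (val0 x t)"
proof -
  obtain i j k l p q where x: "x = (i, j, k, l, p, q)" by (metis prod_cases6)
  have m: "t i \<in> set cube" "t j \<in> set cube" "t k \<in> set cube" "t l \<in> set cube" "t p \<in> set cube" "t q \<in> set cube"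
    using assms unfolding x is_six_def by blast+
  show ?thesis unfolding x zero_form_def val0_def
    by (simp add: order_zero_form_def cube_values_def \<omega>_cube m power3_eq_cube)
qed

definition higher_scale :: "nat \<Rightarrow> complex" where
  "higher_scale k = (if k < 15 then \<omega>\<^sub>0 * \<kappa> else \<kappa> * \<kappa> / \<omega>\<^sub>0)"

lemma higher_scale_nonzero: "higher_scale k \<noteq> 0"
  using \<omega>\<^sub>0_nonzero \<kappa>_nonzero by (simp add: higher_scale_def)

lemma one_form_cube:
  assumes "is_six x" "\<And>j. j \<in> {1..6} \<Longrightarrow> t j \<in> set cube"
  shows "one_form x (cube_values t) = \<omega>\<^sub>0 * \<kappa> * of_int (val1 x t)"
proof -
  obtain i j k l p q where x: "x = (i, j, k, l, p, q)" by (metis prod_cases6)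
  have m: "t i \<in> set cube" "t j \<in> set cube" "t k \<in> set cube" "t l \<in> set cube" "t p \<in> set cube" "t q \<in> set cube"
    using assms unfolding x is_six_def by blast+
  show ?thesis unfolding x one_form_def val1_def
    by (simp add: order_one_form_def cube_values_def \<omega>_cube d_cube m)
qed

lemma two_form_cube:
  assumes "is_six x" "\<And>j. j \<in> {1..6} \<Longrightarrow> t j \<in> set cube"
  shows "two_form x (cube_values t) = \<kappa> * \<kappa> / \<omega>\<^sub>0 * of_int (val2 x t)"
proof -
  obtain i j k l p q where x: "x = (i, j, k, l, p, q)" by (metis prod_cases6)
  have m: "t i \<in> set cube" "t j \<in> set cube" "t k \<in> set cube" "t l \<in> set cube" "t p \<in> set cube" "t q \<in> set cube"
    using assms unfolding x is_six_def by blast+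
  show ?thesis unfolding x two_form_def val2_def case_prod_conv order_two_form_dual3[OF sympl quartic basis] cube_values_def
      dual3_cube[OF m(1-3)]
    by (simp add: d_cube m d_scale d_zero Let_def)
qed

lemma higher_form_cube:
  assumes "k < 20" "\<And>j. j \<in> {1..6} \<Longrightarrow> t j \<in> set cube"
  shows "higher_form k (cube_values t) = higher_scale k * of_int (higher_val k t)"
  using one_form_cube[of "quadruple_list ! k" t] two_form_cube[of "triple_list ! (k - 15)" t]
    sextuple_list_is_six(2)[of k] sextuple_list_is_six(3)[of "k - 15"] assms
  by (auto simp: higher_form_def higher_val_def higher_scale_def)

definition transvection :: "complex ^ 'n ^ 'n" where
  "transvection = (\<chi> i j. \<omega> (axis j 1) (u 13) * u 13 $ i)"

lemma transvection: "transvection *v y = \<omega> y (u 13) *s u 13"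
  unfolding linear_form_coordinates[OF \<omega>_linear(2)[where y = "u 13"], of y]
  by (simp add: transvection_def matrix_vector_mult_def vec_eq_iff sum_distrib_left sum_distrib_right mult_ac)

lemma transvection_sp: "transvection \<in> sp_algebra \<omega>"
proof -
  have "\<omega> (transvection *v x) y + \<omega> x (transvection *v y) = 0" for x y
    using \<omega>_antisym[of y "u 13"] by (simp only: transvection \<omega>_linear(5,6)) simp
  thus ?thesis by (simp add: sp_algebra_def)
qed

text \<open>Among the cube vectors only that of code -13 pairs with that of code 13, with the value
  \<open>- \<omega>\<^sub>0\<close> in this order; so the arguments -13 are turned into 13 one at a
  time.\<close>

lemma derivation_transvection:
  assumes G: "multilinear 6 G" and t: "\<And>j. j \<in> {1..6} \<Longrightarrow> t j \<in> set cube"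
  shows "derivation 6 transvection G (cube_values t) =
    - \<omega>\<^sub>0 * (\<Sum>j\<in>{1..6}. if t j = -13 then G (cube_values (t(j := 13))) else 0)"
  unfolding derivation_def sum_distrib_left
proof (intro sum.cong refl)
  fix j :: nat assume j: "j \<in> {1..6}"
  have 13: "13 \<in> set cube" by (simp add: cube_def)
  have "(cube_values t)(j := u 13) = cube_values (t(j := 13))" by (auto simp: cube_values_def)
  moreover have "G ((cube_values t)(j := transvection *v cube_values t j))
      = \<omega> (u (t j)) (u 13) * G ((cube_values t)(j := u 13))"
    using multilinear_scale[OF G j] by (simp add: transvection cube_values_def)
  ultimately show "G ((cube_values t)(j := transvection *v cube_values t j))
      = - \<omega>\<^sub>0 * (if t j = -13 then G (cube_values (t(j := 13))) else 0)"
    using \<omega>_cube[OF t[OF j] 13] by (auto simp: wval_def cube_sign_def eq_neg_iff_add_eq_0)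
qed

lemma derivation_transvection_sample:
  assumes r: "r < 20" and k: "k < 20"
  shows "derivation 6 transvection (higher_form k) (cube_values (cube_point (sample_points ! r)))
    = - \<omega>\<^sub>0 * higher_scale k * of_int (sample_matrix ! r ! k)"
proof -
  let ?t = "cube_point (sample_points ! r)"
  have t: "?t j \<in> set cube" if "j \<in> {1..6}" for j using sample_points_check r that by auto
  have "sample_matrix ! r ! k = (\<Sum>j\<leftarrow>[1..<7]. if ?t j = -13 then higher_val k (?t(j := 13)) else 0)"
    using sample_matrix_check r k by (simp del: upt_rec_numeral)
  also have "\<dots> = (\<Sum>j\<in>{1..6}. if ?t j = -13 then higher_val k (?t(j := 13)) else 0)"
    unfolding interv_sum_list_conv_sum_set_nat by (intro sum.cong) auto
  finally have S: "sample_matrix ! r ! k = (\<Sum>j\<in>{1..6}. if ?t j = -13 then higher_val k (?t(j := 13)) else 0)" .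
  have eq: "(\<Sum>j\<in>{1..6}. if ?t j = -13 then higher_form k (cube_values (?t(j := 13))) else 0)
      = (\<Sum>j\<in>{1..6}. higher_scale k * of_int (if ?t j = -13 then higher_val k (?t(j := 13)) else 0))"
  proof (intro sum.cong refl)
    fix j :: nat
    have "13 \<in> set cube" by (simp add: cube_def)
    hence "(?t(j := 13)) m \<in> set cube" if "m \<in> {1..6}" for m using t[OF that] by simp
    thus "(if ?t j = -13 then higher_form k (cube_values (?t(j := 13))) else 0)
        = higher_scale k * of_int (if ?t j = -13 then higher_val k (?t(j := 13)) else 0)"
      using higher_form_cube[OF k, of "?t(j := 13)"] by simp
  qed
  show ?thesis
    by (simp only: derivation_transvection[OF six_linear_multilinear[OF higher_form_six_linear[OF k]] t]
        eq S of_int_sum sum_distrib_left mult.assoc)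
qed

lemma sum_split: "sum f {..<m + n} = sum f {..<m} + (\<Sum>k<n. f (m + k))" for f :: "nat \<Rightarrow> complex"
  by (induction n) (simp_all add: add.assoc)

text \<open>The derivatives at the sample points give \<open>sample_matrix\<close> with its columns
  scaled by nonzero factors; multiplication by a row of \<open>sample_inverse\<close> isolates one
  coefficient.\<close>

lemma higher_coefficients_zero:
  assumes "\<And>w. (\<Sum>k<35. a k * derivation 6 transvection (basis_form k) w) = 0" and l: "l < 20"
  shows "a (15 + l) = 0"
proof -
  define c where "c k = a (15 + k) * higher_scale k" for k
  have row: "(\<Sum>k<20. c k * of_int (sample_matrix ! r ! k)) = 0" if r: "r < 20" for r
  proof -
    let ?w = "cube_values (cube_point (sample_points ! r))"
    have "0 = (\<Sum>k<15 + 20. a k * derivation 6 transvection (basis_form k) ?w)" using assms(1)[of ?w] by simp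
    also have "\<dots> = (\<Sum>k<20. a (15 + k) * derivation 6 transvection (higher_form k) ?w)"
      unfolding sum_split using zero_form_invariant[OF transvection_sp sextuple_list_is_six(1)]
      by (simp add: basis_form_def)
    also have "\<dots> = (\<Sum>k<20. - \<omega>\<^sub>0 * (c k * of_int (sample_matrix ! r ! k)))"
      by (intro sum.cong refl) (simp add: derivation_transvection_sample[OF r] c_def)
    also have "\<dots> = - \<omega>\<^sub>0 * (\<Sum>k<20. c k * of_int (sample_matrix ! r ! k))" by (rule sum_distrib_left[symmetric])
    finally show ?thesis using \<omega>\<^sub>0_nonzero by simp
  qed
  have inv: "(\<Sum>r<20. sample_inverse ! l ! r * sample_matrix ! r ! k) = (if l = k then 8 else 0)" if "k < 20" for k
  proof -
    have "(\<Sum>r\<leftarrow>[0..<20]. sample_inverse ! l ! r * sample_matrix ! r ! k) = (if l = k then 8 else 0)"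
      using bspec[OF bspec[OF sample_inverse_check, of l], of k] l that by (simp del: upt_rec_numeral)
    thus ?thesis unfolding interv_sum_list_conv_sum_set_nat by (simp add: atLeast0LessThan)
  qed
  have "0 = (\<Sum>r<20. of_int (sample_inverse ! l ! r) * (\<Sum>k<20. c k * of_int (sample_matrix ! r ! k)))"
    using row by simp
  also have "\<dots> = (\<Sum>k<20. \<Sum>r<20. c k * of_int (sample_inverse ! l ! r * sample_matrix ! r ! k))"
    unfolding sum_distrib_left by (subst sum.swap) (simp add: mult_ac)
  also have "\<dots> = (\<Sum>k<20. c k * of_int (\<Sum>r<20. sample_inverse ! l ! r * sample_matrix ! r ! k))"
    by (simp only: sum_distrib_left of_int_sum)
  also have "\<dots> = (\<Sum>k<20. if l = k then c k * 8 else 0)"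
    by (intro sum.cong refl) (simp only: inv lessThan_iff if_distrib[of of_int], simp)
  also have "\<dots> = c l * 8" using l by simp
  finally show ?thesis using higher_scale_nonzero by (simp add: c_def)
qed

lemma basis_forms_independent:
  assumes "\<And>w. (\<Sum>k<35. a k * basis_form k w) = 0" and l: "l < 35"
  shows "a l = 0"
proof -
  have der: "(\<Sum>k<35. a k * derivation 6 transvection (basis_form k) w) = 0" for w
    unfolding derivation_combination[symmetric] using assms(1) by (simp add: derivation_def)
  have high: "a (15 + k) = 0" if "k < 20" for k by (rule higher_coefficients_zero[OF der that])
  show ?thesis
  proof (cases "l < 15")
    case False
    thus ?thesis using high[of "l - 15"] l by simp
  next
    case True
    let ?t = "pairing_point (pairing_list ! l)"
    have chk: "\<And>j. j \<in> {1..6} \<Longrightarrow> ?t j \<in> set cube"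
      "\<And>k. k < 15 \<Longrightarrow> val0 (pairing_list ! k) ?t = (if l = k then 1 else 0)"
      using bspec[OF pairing_point_check, of l] True by auto
    have "0 = (\<Sum>k<15 + 20. a k * basis_form k (cube_values ?t))" using assms(1)[of "cube_values ?t"] by simp
    also have "\<dots> = (\<Sum>k<15. a k * zero_form (pairing_list ! k) (cube_values ?t))"
      unfolding sum_split using high by (simp add: basis_form_def)
    also have "\<dots> = (\<Sum>k<15. if l = k then a k * \<omega>\<^sub>0 ^ 3 else 0)"
      using zero_form_cube[OF sextuple_list_is_six(1) chk(1)] chk(2) by (intro sum.cong refl) simp
    also have "\<dots> = a l * \<omega>\<^sub>0 ^ 3" using True by simp
    finally show ?thesis using \<omega>\<^sub>0_nonzero by simp
  qed
qed

lemma generators_sp: "i < 7 \<Longrightarrow> F i \<in> sp_algebra \<omega>" "i < 7 \<Longrightarrow> H i \<in> sp_algebra \<omega>"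
  using \<omega>_F \<omega>_H by (auto simp: sp_algebra_def)

text \<open>
  Otherwise the 35 basis forms and one more invariant form would be 36 linearly independent forms,
  but such forms are determined by their values at the 35 closed dominant paths of length six.
\<close>

lemma invariant_combination:
  assumes G: "G \<in> six_linear_forms"
    and F: "\<And>i w. i < 7 \<Longrightarrow> derivation 6 (F i) G w = 0" and H: "\<And>i w. i < 7 \<Longrightarrow> derivation 6 (H i) G w = 0"
  shows "\<exists>a. \<forall>w. G w = (\<Sum>k<35. a k * basis_form k w)"
proof -
  \<comment> \<open>The numeral type provides one coordinate for each closed path, so that the 36
    forms become vectors in \<open>complex ^ 35\<close>.\<close>
  obtain h :: "35 \<Rightarrow> nat" where h: "bij_betw h UNIV {..<35}"
    using finite_same_card_bij[of "UNIV :: 35 set" "{..<35::nat}"] by auto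
  define f where "f k = (if k < 35 then basis_form k else G)" for k
  define pt where "pt i j = v (closed_paths 3 ! i ! (j - 1))" for i j
  define x :: "nat \<Rightarrow> complex ^ 35" where "x k = (\<chi> i. f k (pt (h i)))" for k
  obtain c where c: "\<exists>k\<in>{..<36}. c k \<noteq> 0" "(\<Sum>k<36. c k *s x k) = 0"
    using family_dependent[of "{..<36::nat}" x] by auto
  define R where "R w = (\<Sum>k<36. c k * f k w)" for w
  have f6: "f k \<in> six_linear_forms" for k using G basis_form_six_linear by (simp add: f_def)
  hence R6: "R \<in> six_linear_forms" unfolding R_def by (rule six_linear_combination)
  have "R w = 0" for w
  proof (rule invariant_determined[of 3])
    show "multilinear (3 + 3) R" using six_linear_multilinear[OF R6] by simp
    show "derivation (3 + 3) (F i) R w = 0" if "i < 7" for i w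
      using F[OF that] basis_form_invariant[OF generators_sp(1)[OF that] _ d_F[OF that]]
      unfolding R_def by (simp only: derivation_combination numeral_plus_numeral add_num_simps) (intro sum.neutral ballI, simp add: f_def)
    show "derivation (3 + 3) (H i) R w = 0" if "i < 7" for i w
      using H[OF that] basis_form_invariant[OF generators_sp(2)[OF that] _ d_H[OF that]]
      unfolding R_def by (simp only: derivation_combination numeral_plus_numeral add_num_simps) (intro sum.neutral ballI, simp add: f_def)
    fix p w assume "p \<in> set (closed_paths 3)" and w: "\<And>j. j \<in> {1..3 + 3} \<Longrightarrow> w j = v (p ! (j - 1))"
    then obtain n where n: "n < 35" "p = closed_paths 3 ! n" by (metis in_set_conv_nth length_closed_paths)
    then obtain i where i: "h i = n" using h by (metis (mono_tags, lifting) bij_betw_iff_bijections lessThan_iff)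
    have "R w = R (pt n)"
      using R6 w n by (auto simp: six_linear_forms_def pt_def)
    also have "\<dots> = (\<Sum>k<36. c k *s x k) $ i" by (simp add: R_def x_def i)
    finally show "R w = 0" using c(2) by simp
  qed
  hence R: "(\<Sum>k<35. c k * basis_form k w) + c 35 * G w = 0" for w
    using sum_split[of "\<lambda>k. c k * f k w" 35 1] by (simp add: R_def f_def)
  have c35: "c 35 \<noteq> 0"
  proof
    assume 0: "c 35 = 0"
    hence "c k = 0" if "k < 35" for k using basis_forms_independent[of c k] R that by simp
    moreover have "k < 35 \<or> k = 35" if "k \<in> {..<36}" for k :: nat using that by auto
    ultimately show False using c(1) 0 by metis
  qed
  have "G w = (\<Sum>k<35. (- c k / c 35) * basis_form k w)" for w
  proof -
    have "c 35 * (\<Sum>k<35. (- c k / c 35) * basis_form k w) = - (\<Sum>k<35. c k * basis_form k w)"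
      unfolding sum_distrib_left sum_negf[symmetric] using c35 by (intro sum.cong refl) simp
    also have "\<dots> = c 35 * G w" using R[of w] by (simp add: add_eq_0_iff)
    finally show ?thesis using c35 by simp
  qed
  thus ?thesis by (intro exI[of _ "\<lambda>k. - c k / c 35"]) blast
qed


section \<open>Translation from forms to operators\<close>

definition basis_operator :: "nat \<Rightarrow> complex ^ ('n \<times> 'n \<times> 'n) ^ ('n \<times> 'n \<times> 'n)" where
  "basis_operator k = (SOME X. Phi \<omega> X = basis_form k)"

lemma Phi_basis_operator: "k < 35 \<Longrightarrow> Phi \<omega> (basis_operator k) = basis_form k"
proof -
  assume "k < 35"
  hence "basis_form k \<in> Phi \<omega> ` UNIV"
    using basis_form_six_linear bij_betw_imp_surj_on[OF Phi_bij_betw[OF sympl]] by blast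
  hence "\<exists>X. Phi \<omega> X = basis_form k" by (metis rangeE)
  thus ?thesis unfolding basis_operator_def by (rule someI_ex)
qed

lemma Phi_sum: "Phi \<omega> (\<Sum>k\<in>I. cmat_scale (a k) (X k)) w = (\<Sum>k\<in>I. a k * Phi \<omega> (X k) w)"
proof -
  have "Phi \<omega> 0 w = 0" using Phi_linear(2)[of \<omega> 0 0 w] by (simp add: cmat.scale_zero_left)
  thus ?thesis by (induction I rule: infinite_finite_induct) (simp_all add: Phi_linear)
qed

lemma Phi_inject: "(\<And>w. Phi \<omega> X w = Phi \<omega> Y w) \<Longrightarrow> X = Y"
  using bij_betw_imp_inj_on[OF Phi_bij_betw[OF sympl]] by (metis ext injD)

lemma basis_operators_independent:
  assumes "(\<Sum>k<35. cmat_scale (a k) (basis_operator k)) = 0" "l < 35"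
  shows "a l = 0"
proof (rule basis_forms_independent[OF _ assms(2)])
  fix w
  have "(\<Sum>k<35. a k * basis_form k w) = (\<Sum>k<35. a k * Phi \<omega> (basis_operator k) w)"
    by (intro sum.cong refl) (simp add: Phi_basis_operator)
  also have "\<dots> = Phi \<omega> 0 w" unfolding Phi_sum[symmetric] assms(1) ..
  also have "\<dots> = 0" using Phi_linear(2)[of \<omega> 0 0 w] by (simp add: cmat.scale_zero_left)
  finally show "(\<Sum>k<35. a k * basis_form k w) = 0" .
qed

lemma basis_operator_inj: "inj_on basis_operator {..<35}"
proof (rule inj_onI, rule ccontr)
  fix k l :: nat assume kl: "k \<in> {..<35}" "l \<in> {..<35}" "basis_operator k = basis_operator l" "k \<noteq> l"
  define a where "a m = (if m = k then 1 else if m = l then -1 else 0 :: complex)" for m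
  have "(\<Sum>m<35. cmat_scale (a m) (basis_operator m)) = (\<Sum>m\<in>{k, l}. cmat_scale (a m) (basis_operator m))"
    using kl by (intro sum.mono_neutral_right) (auto simp: a_def cmat.scale_zero_left)
  also have "\<dots> = 0" using kl by (simp add: a_def cmat.scale_minus_left)
  finally show False using basis_operators_independent[of a k] kl by (simp add: a_def)
qed

lemma basis_operators_cmat_independent: "cmat.independent (basis_operator ` {..<35})"
proof
  assume "cmat.dependent (basis_operator ` {..<35})"
  then obtain c where c: "\<exists>X\<in>basis_operator ` {..<35}. c X \<noteq> 0" "(\<Sum>X\<in>basis_operator ` {..<35}. cmat_scale (c X) X) = 0"
    by (auto simp: cmat.dependent_finite)
  have "(\<Sum>k<35. cmat_scale (c (basis_operator k)) (basis_operator k)) = 0"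
    using c(2) by (simp add: sum.reindex[OF basis_operator_inj])
  from basis_operators_independent[of "\<lambda>k. c (basis_operator k)", OF this] show False using c(1) by auto
qed

lemma corresponding_operators_eq:
  "corresponding_operators \<omega> (order_zero_forms \<omega>) = {X. \<exists>x\<in>pairings6. Phi \<omega> X = zero_form x}"
  "corresponding_operators \<omega> (order_zero_forms \<omega> \<union> order_one_forms \<omega> d \<union> order_two_forms \<omega> d b) =
     {X. (\<exists>x\<in>pairings6. Phi \<omega> X = zero_form x) \<or> (\<exists>x\<in>pair_quadruples6. Phi \<omega> X = one_form x) \<or>
         (\<exists>x\<in>triple_pairs6. Phi \<omega> X = two_form x)}"
proof -
  have 0: "order_zero_forms \<omega> = zero_form ` pairings6"
    unfolding order_zero_forms_def zero_form_def by (auto simp: image_iff Bex_def split_paired_Ex) blast+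
  have 1: "order_one_forms \<omega> d = one_form ` pair_quadruples6"
    unfolding order_one_forms_def one_form_def by (auto simp: image_iff Bex_def split_paired_Ex) blast+
  have 2: "order_two_forms \<omega> d b = two_form ` triple_pairs6"
    unfolding order_two_forms_def two_form_def by (auto simp: image_iff Bex_def split_paired_Ex) blast+
  show "corresponding_operators \<omega> (order_zero_forms \<omega>) = {X. \<exists>x\<in>pairings6. Phi \<omega> X = zero_form x}"
    "corresponding_operators \<omega> (order_zero_forms \<omega> \<union> order_one_forms \<omega> d \<union> order_two_forms \<omega> d b) =
     {X. (\<exists>x\<in>pairings6. Phi \<omega> X = zero_form x) \<or> (\<exists>x\<in>pair_quadruples6. Phi \<omega> X = one_form x) \<or>
         (\<exists>x\<in>triple_pairs6. Phi \<omega> X = two_form x)}"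
    unfolding corresponding_operators_def 0 1 2 by blast+
qed

lemma basis_operator_corresponding:
  "k < 15 \<Longrightarrow> basis_operator k \<in> corresponding_operators \<omega> (order_zero_forms \<omega>)"
  "k < 35 \<Longrightarrow> basis_operator k \<in>
     corresponding_operators \<omega> (order_zero_forms \<omega> \<union> order_one_forms \<omega> d \<union> order_two_forms \<omega> d b)"
proof -
  show "basis_operator k \<in> corresponding_operators \<omega> (order_zero_forms \<omega>)" if "k < 15"
    unfolding corresponding_operators_eq using that sextuple_list_mem(1)[of k] Phi_basis_operator[of k]
    by (auto simp: basis_form_def)
  show "basis_operator k \<in>
     corresponding_operators \<omega> (order_zero_forms \<omega> \<union> order_one_forms \<omega> d \<union> order_two_forms \<omega> d b)" if "k < 35"
  proof -
    have "k < 15 \<or> 15 \<le> k \<and> k < 30 \<or> 30 \<le> k" by auto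
    thus ?thesis
      unfolding corresponding_operators_eq
      using sextuple_list_mem(1)[of k] sextuple_list_mem(2)[of "k - 15"] sextuple_list_mem(3)[of "k - 30"] Phi_basis_operator[OF that] that
      by (auto simp: basis_form_def higher_form_def)
  qed
qed

text \<open>A form of order two is \<open>\<omega>\<close> applied to the triple products of its two
  triples, so exchanging the triples is the antisymmetry of \<open>\<omega>\<close>.\<close>

lemma sextuple_signs:
  "order_zero_form \<omega> j i k l p q w = - order_zero_form \<omega> i j k l p q w"
  "order_zero_form \<omega> i j l k p q w = - order_zero_form \<omega> i j k l p q w"
  "order_zero_form \<omega> i j k l q p w = - order_zero_form \<omega> i j k l p q w"
  "order_one_form \<omega> d j i k l p q w = - order_one_form \<omega> d i j k l p q w"
  "order_two_form \<omega> d b l p q i j k w = - order_two_form \<omega> d b i j k l p q w"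
proof -
  show "order_zero_form \<omega> j i k l p q w = - order_zero_form \<omega> i j k l p q w"
    "order_zero_form \<omega> i j l k p q w = - order_zero_form \<omega> i j k l p q w"
    "order_zero_form \<omega> i j k l q p w = - order_zero_form \<omega> i j k l p q w"
    "order_one_form \<omega> d j i k l p q w = - order_one_form \<omega> d i j k l p q w"
    using \<omega>_antisym[of "w j" "w i"] \<omega>_antisym[of "w l" "w k"] \<omega>_antisym[of "w q" "w p"]
    by (simp_all add: order_zero_form_def order_one_form_def)
  have "d x y z t = \<omega> (dual3 \<omega> d y z t) x" for x y z t
    by (simp only: dual3[OF sympl quartic]) (metis d_sym)
  thus "order_two_form \<omega> d b l p q i j k w = - order_two_form \<omega> d b i j k l p q w"
    unfolding order_two_form_dual3[OF sympl quartic basis] using \<omega>_antisym by metis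
qed

section \<open>The centralizer of operators preserving both forms and including the
  generators\<close>

context
  fixes \<A> :: "(complex ^ 'n ^ 'n) set"
  assumes sp: "\<A> \<subseteq> sp_algebra \<omega>" and gens: "\<And>i. i < 7 \<Longrightarrow> F i \<in> \<A> \<and> H i \<in> \<A>"
    and inv_d: "\<And>A a b c e. A \<in> \<A> \<Longrightarrow>
      d (A *v a) b c e + d a (A *v b) c e + d a b (A *v c) e + d a b c (A *v e) = 0"
begin

lemma centralizer_combination:
  assumes "X \<in> centralizer3 \<A>"
  shows "\<exists>a. X = (\<Sum>k<35. cmat_scale (a k) (basis_operator k))"
proof -
  have "derivation 6 (F i) (Phi \<omega> X) w = 0" "derivation 6 (H i) (Phi \<omega> X) w = 0" if "i < 7" for i w
    using assms centralizer3_iff[OF sympl sp] gens[OF that] by auto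
  then obtain a where a: "\<And>w. Phi \<omega> X w = (\<Sum>k<35. a k * basis_form k w)"
    using invariant_combination[OF Phi_six_linear] by blast
  have "X = (\<Sum>k<35. cmat_scale (a k) (basis_operator k))"
    by (rule Phi_inject) (simp add: Phi_sum a Phi_basis_operator)
  thus ?thesis by blast
qed

lemma corresponding_in_centralizer:
  "corresponding_operators \<omega> (order_zero_forms \<omega> \<union> order_one_forms \<omega> d \<union> order_two_forms \<omega> d b) \<subseteq> centralizer3 \<A>"
proof
  fix X assume "X \<in> corresponding_operators \<omega> (order_zero_forms \<omega> \<union> order_one_forms \<omega> d \<union> order_two_forms \<omega> d b)"
  then obtain x where "is_six x" "Phi \<omega> X = zero_form x \<or> Phi \<omega> X = one_form x \<or> Phi \<omega> X = two_form x"
    unfolding corresponding_operators_eq using is_sixI by blast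
  note x = this
  have "derivation 6 A (Phi \<omega> X) w = 0" if A: "A \<in> \<A>" for A w
  proof -
    have "A \<in> sp_algebra \<omega>" using A sp by blast
    from zero_form_invariant[OF this x(1)] higher_forms_invariant[OF this x(1) inv_d[OF A]] x(2)
    show ?thesis by metis
  qed
  thus "X \<in> centralizer3 \<A>" unfolding centralizer3_iff[OF sympl sp] by blast
qed

text \<open>The inclusions close up in a circle: centralizer, span of the 35 basis operators, span
  of the operators of all forms, centralizer. So the five other forms of order two add nothing to
  the span.\<close>

lemma centralizer_eq_span:
  "centralizer3 \<A> = cmat.span (basis_operator ` {..<35})"
  "centralizer3 \<A> = cmat.span (corresponding_operators \<omega>
     (order_zero_forms \<omega> \<union> order_one_forms \<omega> d \<union> order_two_forms \<omega> d b))"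
proof -
  let ?C = "corresponding_operators \<omega> (order_zero_forms \<omega> \<union> order_one_forms \<omega> d \<union> order_two_forms \<omega> d b)"
  have sub: "cmat.subspace (centralizer3 \<A>)"
    using centralizer3_subalgebra[of \<A>] by (simp add: matrix_subalgebra_def)
  have "X \<in> cmat.span (basis_operator ` {..<35})" if X: "X \<in> centralizer3 \<A>" for X
  proof -
    obtain a where a: "X = (\<Sum>k<35. cmat_scale (a k) (basis_operator k))" using centralizer_combination[OF X] by blast
    show ?thesis unfolding a by (intro cmat.span_sum cmat.span_scale cmat.span_base) simp
  qed
  hence 1: "centralizer3 \<A> \<subseteq> cmat.span (basis_operator ` {..<35})" by blast
  have 2: "cmat.span (basis_operator ` {..<35}) \<subseteq> cmat.span ?C"
    by (intro cmat.span_mono image_subsetI) (simp add: basis_operator_corresponding(2))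
  have 3: "cmat.span ?C \<subseteq> centralizer3 \<A>"
    by (rule cmat.span_minimal[OF corresponding_in_centralizer sub])
  show "centralizer3 \<A> = cmat.span (basis_operator ` {..<35})" "centralizer3 \<A> = cmat.span ?C"
    using 1 2 3 by blast+
qed

lemma dim_centralizer: "cmat.dim (centralizer3 \<A>) = 35"
  unfolding centralizer_eq_span(1) cmat.dim_span_eq_card_independent[OF basis_operators_cmat_independent]
    card_image[OF basis_operator_inj] by simp

lemma centralizer_sp_subset: "centralizer3 (sp_algebra \<omega>) \<subseteq> centralizer3 \<A>"
  using sp by (auto simp: centralizer3_def)

text \<open>Among the invariant forms, one transvection already singles out those invariant under \<open>sp\<close>.\<close>

lemma centralizer_sp_eq_span:
  "centralizer3 (sp_algebra \<omega>) = cmat.span (corresponding_operators \<omega> (order_zero_forms \<omega>))"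
proof
  show "cmat.span (corresponding_operators \<omega> (order_zero_forms \<omega>)) \<subseteq> centralizer3 (sp_algebra \<omega>)"
  proof (rule cmat.span_minimal)
    show "cmat.subspace (centralizer3 (sp_algebra \<omega>))"
      using centralizer3_subalgebra[of "sp_algebra \<omega>"] by (simp add: matrix_subalgebra_def)
    show "corresponding_operators \<omega> (order_zero_forms \<omega>) \<subseteq> centralizer3 (sp_algebra \<omega>)"
    proof
      fix X assume "X \<in> corresponding_operators \<omega> (order_zero_forms \<omega>)"
      then obtain x where "is_six x" "Phi \<omega> X = zero_form x"
        unfolding corresponding_operators_eq using is_sixI(1) by blast
      thus "X \<in> centralizer3 (sp_algebra \<omega>)"
        unfolding centralizer3_iff[OF sympl subset_refl] using zero_form_invariant by metis
    qed
  qed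
  show "centralizer3 (sp_algebra \<omega>) \<subseteq> cmat.span (corresponding_operators \<omega> (order_zero_forms \<omega>))"
  proof
    fix X assume X: "X \<in> centralizer3 (sp_algebra \<omega>)"
    then obtain a where a: "X = (\<Sum>k<35. cmat_scale (a k) (basis_operator k))"
      using centralizer_combination centralizer_sp_subset by blast
    have "Phi \<omega> X = (\<lambda>w. \<Sum>k<35. a k * basis_form k w)"
      by (simp add: a Phi_sum Phi_basis_operator fun_eq_iff)
    moreover have "derivation 6 transvection (Phi \<omega> X) w = 0" for w
      using X transvection_sp unfolding centralizer3_iff[OF sympl subset_refl] by blast
    ultimately have "a (15 + l) = 0" if "l < 20" for l
      using that by (intro higher_coefficients_zero) (simp_all add: derivation_combination)
    hence "a k = 0" if "15 \<le> k" "k < 35" for k using that le_Suc_ex[OF that(1)] by auto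
    hence a': "X = (\<Sum>k<15. cmat_scale (a k) (basis_operator k))"
      unfolding a by (intro sum.mono_neutral_right) (auto simp: cmat.scale_zero_left)
    show "X \<in> cmat.span (corresponding_operators \<omega> (order_zero_forms \<omega>))"
      unfolding a' by (intro cmat.span_sum cmat.span_scale cmat.span_base) (simp add: basis_operator_corresponding(1))
  qed
qed

end

end

section \<open>From the abstract Lie algebra to operators on the module\<close>

lemma e7_cartan_root: "i < 7 \<Longrightarrow> j < 7 \<Longrightarrow> e7_roots ! i ! j = cartan_E7 (Suc i) (Suc j)"
  using e7_roots_check by (metis atLeastLessThan_iff le0 set_upt)

text \<open>The elements preserving a given subspace form a Lie subalgebra, which is everything once
  it contains the generators; so a subspace stable under the generators is a submodule. The nodes 1
  to 7 become the indices 0 to 6.\<close>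

lemma e7_representation_triples:
  fixes scale :: "complex \<Rightarrow> 'g::ab_group_add \<Rightarrow> 'g" and bracket :: "'g \<Rightarrow> 'g \<Rightarrow> 'g"
    and \<rho> :: "'g \<Rightarrow> complex ^ 'n ^ 'n"
  assumes e7: "e7_lie_algebra scale bracket" and dim_V: "CARD('n) = 56"
    and rep: "lie_representation scale bracket \<rho>" and irred: "irreducible_representation \<rho>"
  shows "\<exists>e f h. e7_triples (\<lambda>i. \<rho> (e i)) (\<lambda>i. \<rho> (f i)) (\<lambda>i. \<rho> (h i))"
proof -
  interpret e7_lie_algebra scale bracket by fact
  have lin: "Vector_Spaces.linear scale cmat_scale \<rho>" and br: "\<And>x y. \<rho> (bracket x y) = \<rho> x ** \<rho> y - \<rho> y ** \<rho> x"
    using rep by (auto simp: lie_representation_def)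
  interpret \<rho>: Vector_Spaces.linear scale cmat_scale \<rho> by fact
  obtain e f h where cs: "chevalley_serre {1..7} cartan_E7 e f h"
    and gen: "lie_generates (e ` {1..7} \<union> f ` {1..7} \<union> h ` {1..7})"
    using chevalley_generators by blast
  have rel: "bracket (h i) (h j) = 0" "bracket (h i) (e j) = scale (of_int (cartan_E7 i j)) (e j)"
    "bracket (h i) (f j) = scale (- of_int (cartan_E7 i j)) (f j)"
    "bracket (e i) (f j) = (if i = j then h i else 0)"
    "i \<noteq> j \<Longrightarrow> (bracket (f i) ^^ nat (1 - cartan_E7 i j)) (f j) = 0"
    if "i \<in> {1..7}" "j \<in> {1..7}" for i j
    using cs that unfolding chevalley_serre_def by blast+
  have "e7_triples (\<lambda>i. \<rho> (e (Suc i))) (\<lambda>i. \<rho> (f (Suc i))) (\<lambda>i. \<rho> (h (Suc i)))"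
  proof
    fix i j :: nat assume ij: "i < 7" "j < 7"
    hence S: "Suc i \<in> {1..7}" "Suc j \<in> {1..7}" by auto
    have c: "cartan_E7 (Suc i) (Suc j) = e7_roots ! j ! i"
      using e7_cartan_root[OF ij] e7_roots_sym[OF ij] by simp
    note r = rel[OF S] and b = br[symmetric]
    show "\<rho> (h (Suc i)) ** \<rho> (h (Suc j)) = \<rho> (h (Suc j)) ** \<rho> (h (Suc i))"
      using br[of "h (Suc i)" "h (Suc j)"] r(1) by (simp add: \<rho>.zero)
    show "\<rho> (h (Suc i)) ** \<rho> (e (Suc j)) - \<rho> (e (Suc j)) ** \<rho> (h (Suc i)) = cmat_scale (of_int (e7_roots ! j ! i)) (\<rho> (e (Suc j)))"
      unfolding b r(2) c by (simp add: \<rho>.scale)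
    show "\<rho> (h (Suc i)) ** \<rho> (f (Suc j)) - \<rho> (f (Suc j)) ** \<rho> (h (Suc i)) = cmat_scale (- of_int (e7_roots ! j ! i)) (\<rho> (f (Suc j)))"
      unfolding b r(3) c by (simp only: \<rho>.scale)
    show "\<rho> (e (Suc i)) ** \<rho> (f (Suc j)) - \<rho> (f (Suc j)) ** \<rho> (e (Suc i)) = (if i = j then \<rho> (h (Suc i)) else 0)"
      unfolding b r(4) by (simp add: \<rho>.zero)
    assume "i \<noteq> j" "e7_roots ! i ! j = 0"
    hence "bracket (f (Suc i)) (f (Suc j)) = 0" using r(5) c e7_roots_sym[OF ij] by simp
    thus "\<rho> (f (Suc i)) ** \<rho> (f (Suc j)) = \<rho> (f (Suc j)) ** \<rho> (f (Suc i))"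
      using br[of "f (Suc i)" "f (Suc j)"] by (simp add: \<rho>.zero)
  next
    fix W :: "(complex ^ 'n) set"
    assume W: "vec.subspace W" and inv: "\<And>i w. i < 7 \<Longrightarrow> w \<in> W \<Longrightarrow>
      \<rho> (e (Suc i)) *v w \<in> W \<and> \<rho> (f (Suc i)) *v w \<in> W \<and> \<rho> (h (Suc i)) *v w \<in> W"
    define S where "S = {x. \<forall>w\<in>W. \<rho> x *v w \<in> W}"
    have "lie_subalgebra S"
      unfolding lie_subalgebra_def subspace_def S_def
      using W by (auto simp: \<rho>.zero \<rho>.add \<rho>.scale br mat_vec_simps vec.subspace_0 vec.subspace_add
          vec.subspace_scale vec.subspace_diff matrix_vector_mul_assoc[symmetric])
    moreover have "e ` {1..7} \<union> f ` {1..7} \<union> h ` {1..7} \<subseteq> S"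
    proof -
      have "e i \<in> S \<and> f i \<in> S \<and> h i \<in> S" if "i \<in> {1..7}" for i
        using inv[of "i - 1"] that by (auto simp: S_def)
      thus ?thesis by blast
    qed
    ultimately have "S = UNIV" using gen unfolding lie_generates_def by blast
    thus "W = {0} \<or> W = UNIV" using irred W unfolding irreducible_representation_def S_def by blast
  qed (rule dim_V)
  thus ?thesis
    by (intro exI[of _ "\<lambda>i. e (Suc i)"] exI[of _ "\<lambda>i. f (Suc i)"] exI[of _ "\<lambda>i. h (Suc i)"])
qed

theorem theorem5p3:
  fixes scale :: "complex \<Rightarrow> 'g::ab_group_add \<Rightarrow> 'g"
    and bracket :: "'g \<Rightarrow> 'g \<Rightarrow> 'g"
    and \<rho> :: "'g \<Rightarrow> complex ^ 'n ^ 'n"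
    and \<omega> :: "complex ^ 'n \<Rightarrow> complex ^ 'n \<Rightarrow> complex"
    and d :: "complex ^ 'n \<Rightarrow> complex ^ 'n \<Rightarrow> complex ^ 'n \<Rightarrow> complex ^ 'n \<Rightarrow> complex"
    and b :: "'n \<Rightarrow> complex ^ 'n"
  assumes e7: "e7_lie_algebra scale bracket"
    and dim_V: "CARD('n) = 56"
    and rep: "lie_representation scale bracket \<rho>"
    and irred: "irreducible_representation \<rho>"
    and symplectic: "symplectic_form \<omega>"
    and inv_omega: "invariant_bilinear \<rho> \<omega>"
    and quartic: "symmetric_quartic_form d"
    and inv_d: "invariant_quartic \<rho> d"
    and d_nonzero: "\<exists>v1 v2 v3 v4. d v1 v2 v3 v4 \<noteq> 0"
    and basis: "is_basis b"
  shows
    "matrix_subalgebra (centralizer3 (range \<rho>)) \<and>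
     cmat.dim (centralizer3 (range \<rho>)) = 35 \<and>
     matrix_subalgebra (centralizer3 (sp_algebra \<omega>)) \<and>
     centralizer3 (sp_algebra \<omega>) \<subseteq> centralizer3 (range \<rho>) \<and>
     centralizer3 (range \<rho>) =
       cmat.span (corresponding_operators \<omega>
         (order_zero_forms \<omega> \<union> order_one_forms \<omega> d \<union> order_two_forms \<omega> d b)) \<and>
     centralizer3 (sp_algebra \<omega>) =
       cmat.span (corresponding_operators \<omega> (order_zero_forms \<omega>)) \<and>
     (\<forall>i j k l p q v.
        order_zero_form \<omega> j i k l p q v = - order_zero_form \<omega> i j k l p q v \<and>
        order_zero_form \<omega> i j l k p q v = - order_zero_form \<omega> i j k l p q v \<and>
        order_zero_form \<omega> i j k l q p v = - order_zero_form \<omega> i j k l p q v \<and>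
        order_one_form \<omega> d j i k l p q v = - order_one_form \<omega> d i j k l p q v \<and>
        order_two_form \<omega> d b l p q i j k v = - order_two_form \<omega> d b i j k l p q v)"
proof -
  obtain e f h where "e7_triples (\<lambda>i. \<rho> (e i)) (\<lambda>i. \<rho> (f i)) (\<lambda>i. \<rho> (h i))"
    using e7_representation_triples[OF e7 dim_V rep irred] by blast
  then interpret e7_triples "\<lambda>i. \<rho> (e i)" "\<lambda>i. \<rho> (f i)" "\<lambda>i. \<rho> (h i)" .
  obtain v where v: "\<forall>\<mu>\<in>set e7_weights. v \<mu> \<noteq> 0 \<and> (\<forall>i<7. \<rho> (h i) *v v \<mu> = of_int (\<mu> ! i) *s v \<mu> \<and>
      \<rho> (f i) *v v \<mu> = (if \<mu> ! i = 1 then v (wminus \<mu> (e7_roots ! i)) else 0))"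
    using minuscule_basis by blast
  interpret e7_forms_basis "\<lambda>i. \<rho> (f i)" "\<lambda>i. \<rho> (h i)" v \<omega> d b
  proof unfold_locales
    show "\<exists>c. x = (\<Sum>\<mu>\<in>set e7_weights. c \<mu> *s v \<mu>)" for x
      using v by (intro minuscule_basis_spans) auto
  qed (use v symplectic quartic inv_omega inv_d d_nonzero basis in
       \<open>auto simp: invariant_bilinear_def invariant_quartic_def\<close>)
  have sp: "range \<rho> \<subseteq> sp_algebra \<omega>"
    using inv_omega by (auto simp: invariant_bilinear_def sp_algebra_def)
  have d: "d (A *v a) b c e + d a (A *v b) c e + d a b (A *v c) e + d a b c (A *v e) = 0"
    if "A \<in> range \<rho>" for A a b c e
    using inv_d that by (auto simp: invariant_quartic_def)
  have gens: "\<rho> (f i) \<in> range \<rho> \<and> \<rho> (h i) \<in> range \<rho>" for i by simp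
  show ?thesis
    by (intro conjI allI; rule centralizer3_subalgebra dim_centralizer[OF sp gens d]
        centralizer_sp_subset[OF sp gens d] centralizer_eq_span(2)[OF sp gens d]
        centralizer_sp_eq_span[OF sp gens d] sextuple_signs)
qed

end
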